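(* For $t\ge0$ let $\Omega_t$ be the open triangle with vertices $A_t=(-\sqrt3/3,0)$, $B_t=(\sqrt3/3+t,0)$ and $C_t=(0,1)$, and let $u(t;x,y)$ denote the torsion function on $\Omega_t$. Then, for $t\to0^+$ (i.e. for all sufficiently small $t>0$), the unique fail point of $\Omega_t$ is given by $p_t=(x(t),0)$, where $$\frac{7}{24}t<x(t)<\frac{12}{24}t.$$ Moreover, for all sufficiently small $t>0$, $$u_y\Bigl(t;\frac t2,0\Bigr)-u_y(t;0,0)>\frac{1}{32}t^2.$$
   Context: The torsion function of a planar domain $\Omega$ is the unique solution $u$ of $-\Delta u=1$ in $\Omega$, $u=0$ on $\partial\Omega$; on a triangle it is $C^1$ up to the closure. A fail point of $\Omega$ is a point at which $|\nabla u|$ attains its maximum over $\overline{\Omega}$ (such points lie on $\partial\Omega$). Subscripts $x,y$ on $u$ denote partial derivatives in the spatial variables. *)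

theory Defs
  imports "HOL-Analysis.Analysis"
begin

definition pdx :: "(real \<times> real \<Rightarrow> real) \<Rightarrow> real \<times> real \<Rightarrow> real" where
  "pdx u p = deriv (\<lambda>x. u (x, snd p)) (fst p)"

definition pdy :: "(real \<times> real \<Rightarrow> real) \<Rightarrow> real \<times> real \<Rightarrow> real" where
  "pdy u p = deriv (\<lambda>y. u (fst p, y)) (snd p)"

definition C1_on :: "(real \<times> real) set \<Rightarrow> (real \<times> real \<Rightarrow> real) \<Rightarrow> bool" where
  "C1_on \<Omega> u \<longleftrightarrow>
     (\<forall>p\<in>\<Omega>. (\<lambda>x. u (x, snd p)) field_differentiable (at (fst p)) \<and>
           (\<lambda>y. u (fst p, y)) field_differentiable (at (snd p))) \<and>
     continuous_on \<Omega> (pdx u) \<and> continuous_on \<Omega> (pdy u)"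

definition C2_on :: "(real \<times> real) set \<Rightarrow> (real \<times> real \<Rightarrow> real) \<Rightarrow> bool" where
  "C2_on \<Omega> u \<longleftrightarrow> C1_on \<Omega> u \<and> C1_on \<Omega> (pdx u) \<and> C1_on \<Omega> (pdy u)"

definition laplacian :: "(real \<times> real \<Rightarrow> real) \<Rightarrow> real \<times> real \<Rightarrow> real" where
  "laplacian u p = pdx (pdx u) p + pdy (pdy u) p"

text \<open>Classical solutions. The values of \<open>u\<close> outside \<open>closure \<Omega>\<close> are irrelevant, so on a bounded
  domain the torsion function is unique only on \<open>closure \<Omega>\<close>; this is why it is
  a predicate on \<open>u\<close>.\<close>

definition torsion_function :: "(real \<times> real) set \<Rightarrow> (real \<times> real \<Rightarrow> real) \<Rightarrow> bool" where
  "torsion_function \<Omega> u \<longleftrightarrow>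
     continuous_on (closure \<Omega>) u \<and> C2_on \<Omega> u \<and>
     (\<forall>p\<in>\<Omega>. - laplacian u p = 1) \<and> (\<forall>p\<in>frontier \<Omega>. u p = 0)"

text \<open>First partial derivatives up to the boundary: the continuous extensions to \<open>closure \<Omega>\<close> of
  the partial derivatives in \<open>\<Omega>\<close>. For \<open>u\<close> in \<open>C\<^sup>1\<close> up to the closure of an open \<open>\<Omega>\<close> these limits
  exist at all points of \<open>closure \<Omega>\<close>, and in \<open>\<Omega>\<close> they agree with \<open>pdx u\<close> and \<open>pdy u\<close>.\<close>

definition pdx_closure :: "(real \<times> real) set \<Rightarrow> (real \<times> real \<Rightarrow> real) \<Rightarrow> real \<times> real \<Rightarrow> real" where
  "pdx_closure \<Omega> u p = Lim (at p within \<Omega>) (pdx u)"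

definition pdy_closure :: "(real \<times> real) set \<Rightarrow> (real \<times> real \<Rightarrow> real) \<Rightarrow> real \<times> real \<Rightarrow> real" where
  "pdy_closure \<Omega> u p = Lim (at p within \<Omega>) (pdy u)"

definition grad_closure :: "(real \<times> real) set \<Rightarrow> (real \<times> real \<Rightarrow> real) \<Rightarrow> real \<times> real \<Rightarrow> real \<times> real" where
  "grad_closure \<Omega> u p = (pdx_closure \<Omega> u p, pdy_closure \<Omega> u p)"

definition fail_point :: "(real \<times> real) set \<Rightarrow> real \<times> real \<Rightarrow> bool" where
  "fail_point \<Omega> p \<longleftrightarrow>
     (\<exists>u. torsion_function \<Omega> u \<and> p \<in> closure \<Omega> \<and>
        (\<forall>q\<in>closure \<Omega>. norm (grad_closure \<Omega> u q) \<le> norm (grad_closure \<Omega> u p)))"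

definition Omega :: "real \<Rightarrow> (real \<times> real) set" where
  "Omega t = interior (convex hull {(- (sqrt 3 / 3), 0), (sqrt 3 / 3 + t, 0), (0, 1)})"

end

theory Submission
  imports Defs "HOL-Complex_Analysis.Complex_Analysis"
begin

text \<open>
  Write \<open>r = sqrt 3\<close>, \<open>1/b = 1/r + t\<close> and \<open>\<epsilon> = r - b\<close>, so that \<open>\<epsilon>\<close> is about \<open>3 t\<close>. In the complex plane a torsion
  function is \<open>Re F - |z|\<^sup>2/4\<close> with \<open>F\<close> holomorphic, and all estimates come from the maximum principle.

  The product \<open>P\<close> of the three affine functions that vanish on the sides satisfies
  \<open>\<Delta>(P/4) = -1 + O(\<epsilon>)\<close>, hence \<open>(1 - \<epsilon>) P/4 \<le> u \<le> (1 + 2\<epsilon>) P/4\<close>. This upper bound, applied to increments of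
  \<open>u\<close>, bounds the gradient and shows that it vanishes at the vertices; so \<open>F\<close> is Lipschitz and
  extends to the closure, and Schwarz reflection extends the gradient across the open sides.

  Moving planes: reflection in vertical lines shows that \<open>g(x) = u\<^sub>y(x, 0)\<close> is monotone outside \<open>[0, t/2]\<close>;
  reflection in the bisectors at \<open>A\<close> and \<open>B\<close> together with the Hopf lemma shows that the gradient on
  the two shorter sides is smaller than the maximum of \<open>g\<close>. In the interior, each directional derivative is harmonic.

  Near the origin \<open>u\<close> is within \<open>O(\<epsilon>)\<close> of the torsion function of the equilateral triangle, so that
  \<open>g'' = -3/2 + O(\<epsilon>)\<close>. On the hypotenuse of the right half of the equilateral triangle, the bounds by \<open>P\<close>
  determine \<open>u\<close> up to a factor \<open>1 + O(\<epsilon>)\<close>; comparing \<open>u(x, y) - u(-x, y)\<close> there with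
  the harmonic functions \<open>x y (c + 9/8 (x\<^sup>2 - y\<^sup>2))\<close> yields that \<open>g'(0)/t\<close> lies between \<open>15/32\<close> and \<open>9/16\<close> up to \<open>O(t)\<close>.
  Hence the zero of \<open>g'\<close> is between \<open>7t/24\<close> and \<open>t/2\<close>, and \<open>g(t/2) - g(0)\<close> is at least about \<open>3/64 t\<^sup>2\<close>.
\<close>

subsection \<open>Classical torsion functions and holomorphic functions\<close>

text \<open>For \<open>b = r\<close> the Laplacian of \<open>P\<close> is exactly -4, so
  \<open>P / 4\<close> is the equilateral torsion function. For \<open>t > 0\<close> no closed form
  is available, and the claims concern \<open>g\<close> on an interval of length \<open>t/2\<close>,
  where it changes only at order \<open>t^2\<close>; bounds with relative error O(\<epsilon>) do not
  see this directly. The way out is parity: the equilateral solution is even in \<open>x\<close>, so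
  \<open>g'(0)\<close> depends only on \<open>U(z) - U(-cnj z)\<close>, which is harmonic and itself
  of order \<epsilon>, so that a relative error O(\<epsilon>) is harmless. To leading order the two
  claims ask only that \<open>g'(0)/t\<close> lie between 7/16 and 3/4; crude polynomial barriers
  are enough. Vertical mirrors stop at 0, where the apex is, and at \<open>t/2\<close>, the midpoint
  of the base; in between concavity takes over. The bisector mirrors work because the base is the
  longest side. A further obstacle: \<open>torsion_function\<close> asks only for continuity up to
  the boundary, so the limits in \<open>grad_closure\<close> must be shown to exist before any
  maximum can be compared.\<close>

lemma C1_on_has_derivative:
  assumes f: "C1_on \<Omega> f" and "open \<Omega>" "p \<in> \<Omega>"
  shows "(f has_derivative (\<lambda>h. pdx f p * fst h + pdy f p * snd h)) (at p)"
proof -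
  obtain x y where p: "p = (x, y)" by (cases p)
  from assms(2,3) have "\<exists>A B. open A \<and> open B \<and> p \<in> A \<times> B \<and> A \<times> B \<subseteq> \<Omega>"
    by (auto simp: open_prod_def)
  then obtain A B0 where AB0: "open A" "open B0" "p \<in> A \<times> B0" "A \<times> B0 \<subseteq> \<Omega>"
    by metis
  then have AB: "open A" "open B0" "x \<in> A" "y \<in> B0" "A \<times> B0 \<subseteq> \<Omega>"
    by (auto simp: p)
  obtain e where e: "e > 0" "ball y e \<subseteq> B0"
    using AB openE by blast
  \<comment> \<open>A ball, because the criterion from partial derivatives needs a convex second
    factor.\<close>
  define B where "B = ball y e"
  have sub: "A \<times> B \<subseteq> \<Omega>" using AB e B_def by auto
  have opn: "open (A \<times> B)" using AB by (simp add: B_def open_Times)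
  have fx: "((\<lambda>x. f (x, y)) has_derivative (\<lambda>h. pdx f p * h)) (at x within A)"
  proof -
    have "((\<lambda>x. f (x, y)) has_field_derivative pdx f p) (at x)"
      using f assms(3) unfolding C1_on_def pdx_def p by (force simp: DERIV_deriv_iff_field_differentiable)
    then show ?thesis
      by (auto simp: has_field_derivative_def intro: has_derivative_at_withinI)
  qed
  have fy: "((\<lambda>y. f (x', y)) has_derivative blinfun_apply (blinfun_mult_right (pdy f (x', y')))) (at y' within B)"
    if "x' \<in> A" "y' \<in> B" for x' y'
  proof -
    have "(x', y') \<in> \<Omega>" using that sub by auto
    then have "((\<lambda>y. f (x', y)) has_field_derivative pdy f (x', y')) (at y')"
      using f unfolding C1_on_def pdy_def by (force simp: DERIV_deriv_iff_field_differentiable)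
    then show ?thesis
      by (auto simp: has_field_derivative_def intro: has_derivative_at_withinI)
  qed
  have "continuous_on (A \<times> B) (pdy f)" using f sub unfolding C1_on_def
    using continuous_on_subset by blast
  then have "continuous_on (A \<times> B) (\<lambda>q. blinfun_mult_right (pdy f q))"
    by (intro continuous_intros)
  then have c: "continuous (at (x, y) within A \<times> B) (\<lambda>(x, y). blinfun_mult_right (pdy f (x, y)))"
    using AB e by (auto simp: continuous_on_eq_continuous_within B_def split_def)
  have "((\<lambda>(x, y). f (x, y)) has_derivative
      (\<lambda>(tx, ty). pdx f p * tx + blinfun_apply (blinfun_mult_right (pdy f (x, y))) ty)) (at (x, y) within A \<times> B)"
    by (rule has_derivative_partialsI[OF fx fy c]) (use e in \<open>auto simp: B_def\<close>)
  then show ?thesis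
    using at_within_open[OF _ opn] AB e p by (simp add: split_def B_def)
qed

text \<open>Clairaut's theorem: by two mean value theorems, taken in either order, the second
  difference \<open>S\<close> over a small square is \<open>h\<^sup>2\<close> times each of the
  mixed partials at some point of the square. Continuity excludes different values at
  \<open>p\<close>.\<close>

lemma C2_on_mixed_partials:
  assumes u: "C2_on \<Omega> u" and "open \<Omega>" "p \<in> \<Omega>"
  shows "pdy (pdx u) p = pdx (pdy u) p"
proof (rule ccontr)
  assume ne: "pdy (pdx u) p \<noteq> pdx (pdy u) p"
  define d where "d = \<bar>pdy (pdx u) p - pdx (pdy u) p\<bar> / 2"
  have d: "d > 0" using ne by (simp add: d_def)
  obtain x y where p: "p = (x, y)" by (cases p)
  have c: "continuous_on \<Omega> (pdy (pdx u))" "continuous_on \<Omega> (pdx (pdy u))"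
    using u by (auto simp: C2_on_def C1_on_def)
  have "\<forall>\<^sub>F q in at p. q \<in> \<Omega> \<and> dist (pdy (pdx u) q) (pdy (pdx u) p) < d
          \<and> dist (pdx (pdy u) q) (pdx (pdy u) p) < d"
  proof (intro eventually_conj)
    show "\<forall>\<^sub>F q in at p. q \<in> \<Omega>" using assms eventually_at_in_open' by blast
    show "\<forall>\<^sub>F q in at p. dist (pdy (pdx u) q) (pdy (pdx u) p) < d"
      using c(1) assms d by (metis continuous_on_eq_continuous_at isCont_def tendstoD)
    show "\<forall>\<^sub>F q in at p. dist (pdx (pdy u) q) (pdx (pdy u) p) < d"
      using c(2) assms d by (metis continuous_on_eq_continuous_at isCont_def tendstoD)
  qed
  then obtain r where r: "r > 0" and rq: "\<And>q. q \<noteq> p \<Longrightarrow> dist q p < r \<Longrightarrow> q \<in> \<Omega> \<and>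
      dist (pdy (pdx u) q) (pdy (pdx u) p) < d \<and> dist (pdx (pdy u) q) (pdx (pdy u) p) < d"
    unfolding eventually_at by (auto; metis)
  define h where "h = r / 3"
  have h: "h > 0" using r by (simp add: h_def)
  have near: "dist (x', y') p < r" if "x \<le> x'" "x' \<le> x + h" "y \<le> y'" "y' \<le> y + h" for x' y'
  proof -
    have "dist (x', y') p \<le> \<bar>x' - x\<bar> + \<bar>y' - y\<bar>"
      unfolding p dist_Pair_Pair dist_real_def by (rule sqrt_sum_squares_le_sum_abs[THEN order_trans]) simp
    then show ?thesis using that h h_def by auto
  qed
  have inO: "(x', y') \<in> \<Omega>" if "x \<le> x'" "x' \<le> x + h" "y \<le> y'" "y' \<le> y + h" for x' y'
    using rq[OF _ near[OF that]] assms(3) by blast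
  have dx: "((\<lambda>x. f (x, y')) has_real_derivative pdx f (x', y')) (at x')"
    if "C1_on \<Omega> f" "(x', y') \<in> \<Omega>" for f x' y'
    using that unfolding C1_on_def pdx_def by (force simp: DERIV_deriv_iff_field_differentiable)
  have dy: "((\<lambda>y. f (x', y)) has_real_derivative pdy f (x', y')) (at y')"
    if "C1_on \<Omega> f" "(x', y') \<in> \<Omega>" for f x' y'
    using that unfolding C1_on_def pdy_def by (force simp: DERIV_deriv_iff_field_differentiable)
  have u1: "C1_on \<Omega> u" "C1_on \<Omega> (pdx u)" "C1_on \<Omega> (pdy u)" using u by (auto simp: C2_on_def)
  define S where "S = u (x + h, y + h) - u (x + h, y) - u (x, y + h) + u (x, y)"
  have "\<exists>s>x. s < x + h \<and> (u (x + h, y + h) - u (x + h, y)) - (u (x, y + h) - u (x, y))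
      = (x + h - x) * (pdx u (s, y + h) - pdx u (s, y))"
    by (rule MVT2[where f = "\<lambda>s. u (s, y + h) - u (s, y)"])
      (use h in \<open>auto intro!: DERIV_diff dx u1 inO\<close>)
  then obtain s where s: "x < s" "s < x + h" "S = h * (pdx u (s, y + h) - pdx u (s, y))"
    unfolding S_def by (auto simp: algebra_simps)
  have "\<exists>s'>y. s' < y + h \<and> pdx u (s, y + h) - pdx u (s, y) = (y + h - y) * pdy (pdx u) (s, s')"
    by (rule MVT2[where f = "\<lambda>y. pdx u (s, y)"]) (use h s in \<open>auto intro!: dy u1 inO\<close>)
  then obtain s' where s': "y < s'" "s' < y + h" "S = h * (h * pdy (pdx u) (s, s'))"
    using s(3) by auto
  have "\<exists>s>y. s < y + h \<and> (u (x + h, y + h) - u (x, y + h)) - (u (x + h, y) - u (x, y))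
      = (y + h - y) * (pdy u (x + h, s) - pdy u (x, s))"
    by (rule MVT2[where f = "\<lambda>s. u (x + h, s) - u (x, s)"])
      (use h in \<open>auto intro!: DERIV_diff dy u1 inO\<close>)
  then obtain q where q: "y < q" "q < y + h" "S = h * (pdy u (x + h, q) - pdy u (x, q))"
    unfolding S_def by (auto simp: algebra_simps)
  have "\<exists>s'>x. s' < x + h \<and> pdy u (x + h, q) - pdy u (x, q) = (x + h - x) * pdx (pdy u) (s', q)"
    by (rule MVT2[where f = "\<lambda>x. pdy u (x, q)"]) (use h q in \<open>auto intro!: dx u1 inO\<close>)
  then obtain q' where q': "x < q'" "q' < x + h" "S = h * (h * pdx (pdy u) (q', q))"
    using q(3) by auto
  have eq: "pdy (pdx u) (s, s') = pdx (pdy u) (q', q)"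
    using s'(3) q'(3) h by simp
  have "dist (pdy (pdx u) (s, s')) (pdy (pdx u) p) < d" "dist (pdx (pdy u) (q', q)) (pdx (pdy u) p) < d"
    using rq[of "(s, s')"] rq[of "(q', q)"] near[of s s'] near[of q' q] s s' q q' p by auto
  then show False unfolding dist_real_def eq d_def
    using abs_triangle_ineq[of "pdy (pdx u) p - pdx (pdy u) (q', q)" "pdx (pdy u) (q', q) - pdx (pdy u) p"]
    by (simp add: abs_minus_commute)
qed

text \<open>\<open>u + |z|\<^sup>2/4\<close> is harmonic, hence on a convex set the real part of a
  holomorphic function. This form makes Cauchy estimates and Schwarz reflection applicable.\<close>

lemma torsion_function_holomorphic:
  assumes u: "torsion_function \<Omega> u" and \<Omega>: "open \<Omega>" "convex \<Omega>"
  shows "\<exists>F. F holomorphic_on {z. (Re z, Im z) \<in> \<Omega>} \<and>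
    (\<forall>z. (Re z, Im z) \<in> \<Omega> \<longrightarrow> u (Re z, Im z) = Re (F z) - (cmod z)\<^sup>2 / 4
      \<and> pdx u (Re z, Im z) = Re (deriv F z) - Re z / 2
      \<and> pdy u (Re z, Im z) = - Im (deriv F z) - Im z / 2)"
proof -
  define S where "S = {z. (Re z, Im z) \<in> \<Omega>}"
  have Seq: "S = (\<lambda>z. (Re z, Im z)) -` \<Omega>" by (auto simp: S_def)
  have opS: "open S" unfolding Seq
    by (rule open_vimage[OF \<Omega>(1)]) (intro continuous_intros)
  have cvS: "convex S" unfolding Seq
    by (rule convex_linear_vimage[OF _ \<Omega>(2)])
      (auto intro!: linearI simp: algebra_simps)
  have C2: "C2_on \<Omega> u" using u by (simp add: torsion_function_def)
  then have C1: "C1_on \<Omega> u" "C1_on \<Omega> (pdx u)" "C1_on \<Omega> (pdy u)" by (auto simp: C2_on_def)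
  have lap: "pdy (pdy u) p = - 1 - pdx (pdx u) p" if "p \<in> \<Omega>" for p
    using u that by (force simp: torsion_function_def laplacian_def)
  have der: "((\<lambda>z. f (Re z, Im z)) has_derivative
      (\<lambda>h. pdx f (Re z, Im z) * Re h + pdy f (Re z, Im z) * Im h)) (at z)"
    if "C1_on \<Omega> f" "z \<in> S" for f z
  proof -
    have "((\<lambda>z. (Re z, Im z)) has_derivative (\<lambda>h. (Re h, Im h))) (at z)"
      by (auto intro!: derivative_eq_intros)
    from has_derivative_compose[OF this C1_on_has_derivative[OF that(1) \<Omega>(1)]]
    show ?thesis using that(2) by (simp add: S_def)
  qed
  \<comment> \<open>Twice the \<open>z\<close>-derivative of \<open>u + |z|\<^sup>2/4\<close>. Its
    Cauchy-Riemann equations are the torsion equation and the symmetry of the mixed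
    partials.\<close>
  define f where "f = (\<lambda>z. complex_of_real (pdx u (Re z, Im z)) - \<i> * complex_of_real (pdy u (Re z, Im z)) + cnj z / 2)"
  have "(f has_field_derivative Complex (pdx (pdx u) (Re z, Im z) + 1/2) (- pdx (pdy u) (Re z, Im z))) (at z)"
    if z: "z \<in> S" for z
  proof -
    have zO: "(Re z, Im z) \<in> \<Omega>" using z by (simp add: S_def)
    let ?p = "(Re z, Im z)"
    have "(f has_derivative (\<lambda>h. of_real (pdx (pdx u) ?p * Re h + pdy (pdx u) ?p * Im h)
            - \<i> * of_real (pdx (pdy u) ?p * Re h + pdy (pdy u) ?p * Im h) + cnj h / 2)) (at z)"
    proof -
      have 1: "((\<lambda>z. complex_of_real (pdx u (Re z, Im z))) has_derivative
          (\<lambda>h. of_real (pdx (pdx u) ?p * Re h + pdy (pdx u) ?p * Im h))) (at z)"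
        by (rule bounded_linear.has_derivative[OF bounded_linear_of_real der[OF C1(2) z]])
      have 2: "((\<lambda>z. complex_of_real (pdy u (Re z, Im z))) has_derivative
          (\<lambda>h. of_real (pdx (pdy u) ?p * Re h + pdy (pdy u) ?p * Im h))) (at z)"
        by (rule bounded_linear.has_derivative[OF bounded_linear_of_real der[OF C1(3) z]])
      have 3: "((\<lambda>z. cnj z / 2) has_derivative (\<lambda>h. cnj h / 2)) (at z)"
        using bounded_linear_imp_has_derivative[OF bounded_linear_compose[OF bounded_linear_divide bounded_linear_cnj]] .
      show ?thesis unfolding f_def
        by (intro has_derivative_add has_derivative_diff has_derivative_mult_right 1 2 3)
    qed
    moreover have "(\<lambda>h. of_real (pdx (pdx u) ?p * Re h + pdy (pdx u) ?p * Im h)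
            - \<i> * of_real (pdx (pdy u) ?p * Re h + pdy (pdy u) ?p * Im h) + cnj h / 2)
        = (*) (Complex (pdx (pdx u) (Re z, Im z) + 1/2) (- pdx (pdy u) (Re z, Im z)))"
      by (auto simp: fun_eq_iff complex_eq_iff lap[OF zO] C2_on_mixed_partials[OF C2 \<Omega>(1) zO] algebra_simps)
    ultimately show ?thesis by (simp add: has_field_derivative_def)
  qed
  then have "f holomorphic_on S"
    using opS by (meson field_differentiable_def holomorphic_on_open)
  then obtain G where G: "\<And>z. z \<in> S \<Longrightarrow> (G has_field_derivative f z) (at z)"
    using holomorphic_convex_primitive'[OF cvS opS] at_within_open[OF _ opS] by metis
  define \<phi> where "\<phi> = (\<lambda>z. u (Re z, Im z) - Re (G z) + (cmod z)\<^sup>2 / 4)"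
  have "(\<phi> has_derivative (\<lambda>_. 0)) (at z within S)" if z: "z \<in> S" for z
  proof -
    have "((\<lambda>z. Re (G z)) has_derivative (\<lambda>h. Re (f z * h))) (at z)"
      using G[OF z] by (auto simp: has_field_derivative_def intro!: derivative_eq_intros)
    moreover have "((\<lambda>z. (cmod z)\<^sup>2) has_derivative (\<lambda>h. 2 * (Re z * Re h + Im z * Im h))) (at z)"
      unfolding cmod_power2 by (auto intro!: derivative_eq_intros)
    ultimately have "(\<phi> has_derivative (\<lambda>h. pdx u (Re z, Im z) * Re h + pdy u (Re z, Im z) * Im h - Re (f z * h) + 2 * (Re z * Re h + Im z * Im h) / 4)) (at z)"
      unfolding \<phi>_def
      by (intro has_derivative_add has_derivative_diff bounded_linear.has_derivative[OF bounded_linear_divide] der[OF C1(1) z])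
    moreover have "(\<lambda>h. pdx u (Re z, Im z) * Re h + pdy u (Re z, Im z) * Im h - Re (f z * h) + 2 * (Re z * Re h + Im z * Im h) / 4) = (\<lambda>_. 0)"
      by (auto simp: f_def fun_eq_iff algebra_simps)
    ultimately show ?thesis by (metis has_derivative_at_withinI)
  qed
  then obtain c where c: "\<And>z. z \<in> S \<Longrightarrow> \<phi> z = c"
    using has_derivative_zero_constant[OF cvS] by blast
  define F where "F = (\<lambda>z. G z + of_real c)"
  have F: "(F has_field_derivative f z) (at z)" if "z \<in> S" for z
    unfolding F_def using G[OF that] by (auto intro!: derivative_eq_intros)
  show ?thesis
  proof (intro exI[of _ F] conjI allI impI)
    show "F holomorphic_on {z. (Re z, Im z) \<in> \<Omega>}"
      using F opS unfolding S_def[symmetric] by (auto simp: holomorphic_on_open)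
    fix z assume "(Re z, Im z) \<in> \<Omega>"
    then have z: "z \<in> S" by (simp add: S_def)
    show "u (Re z, Im z) = Re (F z) - (cmod z)\<^sup>2 / 4"
      using c[OF z] by (simp add: \<phi>_def F_def)
    show "pdx u (Re z, Im z) = Re (deriv F z) - Re z / 2"
         "pdy u (Re z, Im z) = - Im (deriv F z) - Im z / 2"
      using DERIV_imp_deriv[OF F[OF z]] by (simp_all add: f_def)
  qed
qed

subsection \<open>Maximum principles\<close>

lemma has_real_derivative_Re_line:
  assumes "(G has_field_derivative D) (at (p + of_real s * e))"
  shows "((\<lambda>s. Re (G (p + of_real s * e))) has_real_derivative Re (D * e)) (at s)"
proof -
  have "((\<lambda>s. p + of_real s * e) has_vector_derivative e) (at s)"
    by (auto intro!: derivative_eq_intros simp: has_vector_derivative_def scaleR_conv_of_real)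
  from field_vector_diff_chain_at[OF this assms]
  have "((\<lambda>s. G (p + of_real s * e)) has_vector_derivative D * e) (at s)"
    by (simp add: o_def mult.commute)
  from bounded_linear.has_vector_derivative[OF bounded_linear_Re this] show ?thesis
    by (simp add: has_real_derivative_iff_has_vector_derivative)
qed

lemma second_derivative_nonpos_at_local_max:
  fixes \<phi> \<phi>' :: "real \<Rightarrow> real"
  assumes "d > 0" and \<phi>: "\<And>s. \<bar>s - x\<bar> < d \<Longrightarrow> (\<phi> has_real_derivative \<phi>' s) (at s)"
    and \<phi>': "(\<phi>' has_real_derivative c) (at x)"
    and max: "\<And>s. \<bar>s - x\<bar> < d \<Longrightarrow> \<phi> s \<le> \<phi> x"
  shows "c \<le> 0"
proof (rule ccontr)
  assume "\<not> c \<le> 0"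
  then have "0 < c" by simp
  have z: "\<phi>' x = 0"
    by (rule DERIV_local_max[OF \<phi> \<open>d > 0\<close>]) (use max \<open>d > 0\<close> in \<open>auto simp: abs_minus_commute\<close>)
  obtain e where e: "e > 0" "\<And>h. 0 < h \<Longrightarrow> h < e \<Longrightarrow> \<phi>' x < \<phi>' (x + h)"
    using DERIV_pos_inc_right[OF \<phi>' \<open>0 < c\<close>] by blast
  define h where "h = min d e / 2"
  have h: "0 < h" "h < d" "h < e" using \<open>d > 0\<close> e(1) by (auto simp: h_def)
  have "\<exists>z>x. z < x + h \<and> \<phi> (x + h) - \<phi> x = (x + h - x) * \<phi>' z"
    by (rule MVT2) (use h in \<open>auto intro!: \<phi>\<close>)
  then obtain s where s: "x < s" "s < x + h" "\<phi> (x + h) - \<phi> x = h * \<phi>' s" by auto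
  have "\<phi>' s > 0" using e(2)[of "s - x"] s h z by auto
  then have "h * \<phi>' s > 0" using h by simp
  then have "\<phi> (x + h) > \<phi> x" using s(3) by linarith
  then show False using max[of "x + h"] h by auto
qed

text \<open>Here \<open>S\<close> need not be dense in \<open>K\<close>, which avoids computing closures and frontiers.\<close>

lemma maximum_principle:
  fixes v :: "complex \<Rightarrow> real" and q qx qy qxx qyy :: "real \<Rightarrow> real \<Rightarrow> real"
  assumes S: "open S" "S \<subseteq> K" and K: "compact K" "continuous_on K v"
    and G: "G holomorphic_on S" and v: "\<And>z. z \<in> S \<Longrightarrow> v z = Re (G z) + q (Re z) (Im z)"
    and qx: "\<And>x y. ((\<lambda>x. q x y) has_real_derivative qx x y) (at x)"
    and qxx: "\<And>x y. ((\<lambda>x. qx x y) has_real_derivative qxx x y) (at x)"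
    and qy: "\<And>x y. ((\<lambda>y. q x y) has_real_derivative qy x y) (at y)"
    and qyy: "\<And>x y. ((\<lambda>y. qy x y) has_real_derivative qyy x y) (at y)"
    and lap: "\<And>z. z \<in> S \<Longrightarrow> 0 \<le> qxx (Re z) (Im z) + qyy (Re z) (Im z)"
    and bd: "\<And>z. z \<in> K \<Longrightarrow> z \<notin> S \<Longrightarrow> v z \<le> 0"
    and "z0 \<in> K"
  shows "v z0 \<le> 0"
proof (rule ccontr)
  assume "\<not> v z0 \<le> 0"
  then have pos: "v z0 > 0" by simp
  obtain R where R: "R > 0" "\<And>z. z \<in> K \<Longrightarrow> norm z \<le> R"
    using compact_imp_bounded[OF K(1)] unfolding bounded_pos by auto
  \<comment> \<open>Adding \<open>\<eta> x\<^sup>2\<close> makes the Laplacian at least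
    \<open>2 \<eta> > 0\<close>, so that an interior maximum contradicts the second derivative test.
    The size of \<eta> keeps \<open>v > 0\<close> at the new maximum point, which is therefore in
    \<open>S\<close>.\<close>
  define \<eta> where "\<eta> = v z0 / (2 * R\<^sup>2)"
  have \<eta>: "\<eta> > 0" "\<eta> * R\<^sup>2 < v z0" using pos R by (auto simp: \<eta>_def)
  define V where "V = (\<lambda>z. v z + \<eta> * (Re z)\<^sup>2)"
  have "continuous_on K V" unfolding V_def by (intro continuous_intros K)
  then obtain z1 where z1: "z1 \<in> K" "\<And>z. z \<in> K \<Longrightarrow> V z \<le> V z1"
    using continuous_attains_sup[OF K(1)] \<open>z0 \<in> K\<close> by blast
  have "V z \<le> v z + \<eta> * R\<^sup>2" if "z \<in> K" for z
  proof -
    have "\<bar>Re z\<bar> \<le> R" using R(2)[OF that] abs_Re_le_cmod order_trans by blast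
    then have "(Re z)\<^sup>2 \<le> R\<^sup>2" by (rule power2_le_iff_abs_le[THEN iffD2, rotated]) (use R in auto)
    then show ?thesis using \<eta> by (simp add: V_def mult_left_mono)
  qed
  moreover have "V z1 \<ge> v z0"
    using z1(2)[OF \<open>z0 \<in> K\<close>] \<eta>(1) unfolding V_def by (smt (verit) zero_le_power2 zero_le_mult_iff)
  ultimately have "v z1 > 0" using z1(1) \<eta>(2) by force
  then have z1S: "z1 \<in> S" using bd z1(1) by force
  obtain d where d: "d > 0" "ball z1 d \<subseteq> S" using S(1) z1S openE by blast
  have near: "z1 + of_real s * e \<in> S" if "\<bar>s\<bar> < d" "norm e = 1" for s e
    using d(2) that by (force simp: dist_norm norm_mult)
  have dG: "(G has_field_derivative deriv G z) (at z)" if "z \<in> S" for z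
    using G S(1) that holomorphic_derivI by blast
  have dG': "(deriv G has_field_derivative deriv (deriv G) z) (at z)" if "z \<in> S" for z
    using holomorphic_deriv[OF G S(1)] S(1) that holomorphic_derivI by blast
  have "Re (deriv (deriv G) z1 * 1 * 1) + qxx (Re z1) (Im z1) + 2 * \<eta> \<le> 0"
  proof (rule second_derivative_nonpos_at_local_max[OF d(1)])
    fix s :: real assume s: "\<bar>s - 0\<bar> < d"
    show "((\<lambda>s. Re (G (z1 + of_real s * 1)) + q (Re z1 + s) (Im z1) + \<eta> * (Re z1 + s)\<^sup>2)
        has_real_derivative Re (deriv G (z1 + of_real s * 1) * 1) + qx (Re z1 + s) (Im z1) + 2 * \<eta> * (Re z1 + s)) (at s)"
    proof (intro DERIV_add)
      show "((\<lambda>s. Re (G (z1 + of_real s * 1))) has_real_derivative Re (deriv G (z1 + of_real s * 1) * 1)) (at s)"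
        by (rule has_real_derivative_Re_line[OF dG[OF near]]) (use s in auto)
      show "((\<lambda>s. q (Re z1 + s) (Im z1)) has_real_derivative qx (Re z1 + s) (Im z1)) (at s)"
        using DERIV_shift[of "\<lambda>x. q x (Im z1)" "qx (Re z1 + s) (Im z1)" s "Re z1"] qx by (simp add: add.commute)
      show "((\<lambda>s. \<eta> * (Re z1 + s)\<^sup>2) has_real_derivative 2 * \<eta> * (Re z1 + s)) (at s)"
        by (auto intro!: derivative_eq_intros)
    qed
    show "Re (G (z1 + of_real s * 1)) + q (Re z1 + s) (Im z1) + \<eta> * (Re z1 + s)\<^sup>2
       \<le> Re (G (z1 + of_real 0 * 1)) + q (Re z1 + 0) (Im z1) + \<eta> * (Re z1 + 0)\<^sup>2"
      using z1(2)[of "z1 + of_real s * 1"] near[of s 1] s S(2) v[of "z1 + of_real s * 1"] v[OF z1S] by (auto simp: V_def)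
  next
    show "((\<lambda>s. Re (deriv G (z1 + of_real s * 1) * 1) + qx (Re z1 + s) (Im z1) + 2 * \<eta> * (Re z1 + s))
        has_real_derivative Re (deriv (deriv G) z1 * 1 * 1) + qxx (Re z1) (Im z1) + 2 * \<eta>) (at 0)"
    proof -
      have "((\<lambda>s. Re (deriv G (z1 + of_real s * 1))) has_real_derivative Re (deriv (deriv G) z1 * 1)) (at 0)"
        by (rule has_real_derivative_Re_line) (use dG' z1S in simp)
      moreover have "((\<lambda>s. qx (Re z1 + s) (Im z1)) has_real_derivative qxx (Re z1) (Im z1)) (at 0)"
        using DERIV_shift[of "\<lambda>x. qx x (Im z1)" "qxx (Re z1) (Im z1)" 0 "Re z1"] qxx by (simp add: add.commute)
      moreover have "((\<lambda>s. 2 * \<eta> * (Re z1 + s)) has_real_derivative 2 * \<eta>) (at 0)"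
        by (auto intro!: derivative_eq_intros)
      ultimately show ?thesis by (simp del: times_complex.sel add: DERIV_add)
    qed
  qed
  moreover have "Re (deriv (deriv G) z1 * \<i> * \<i>) + qyy (Re z1) (Im z1) \<le> 0"
  proof (rule second_derivative_nonpos_at_local_max[OF d(1)])
    fix s :: real assume s: "\<bar>s - 0\<bar> < d"
    show "((\<lambda>s. Re (G (z1 + of_real s * \<i>)) + q (Re z1) (Im z1 + s))
        has_real_derivative Re (deriv G (z1 + of_real s * \<i>) * \<i>) + qy (Re z1) (Im z1 + s)) (at s)"
    proof (intro DERIV_add)
      show "((\<lambda>s. Re (G (z1 + of_real s * \<i>))) has_real_derivative Re (deriv G (z1 + of_real s * \<i>) * \<i>)) (at s)"
        by (rule has_real_derivative_Re_line[OF dG[OF near]]) (use s in auto)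
      show "((\<lambda>s. q (Re z1) (Im z1 + s)) has_real_derivative qy (Re z1) (Im z1 + s)) (at s)"
        using DERIV_shift[of "\<lambda>y. q (Re z1) y" "qy (Re z1) (Im z1 + s)" s "Im z1"] qy by (simp add: add.commute)
    qed
    show "Re (G (z1 + of_real s * \<i>)) + q (Re z1) (Im z1 + s)
       \<le> Re (G (z1 + of_real 0 * \<i>)) + q (Re z1) (Im z1 + 0)"
      using z1(2)[of "z1 + of_real s * \<i>"] near[of s \<i>] s S(2) v[of "z1 + of_real s * \<i>"] v[OF z1S] by (auto simp: V_def)
  next
    have "((\<lambda>s. Re (\<i> * deriv G (z1 + of_real s * \<i>))) has_real_derivative Re (\<i> * deriv (deriv G) z1 * \<i>)) (at 0)"
      by (rule has_real_derivative_Re_line) (use dG' z1S in \<open>auto intro!: derivative_eq_intros\<close>)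
    moreover have "((\<lambda>s. qy (Re z1) (Im z1 + s)) has_real_derivative qyy (Re z1) (Im z1)) (at 0)"
      using DERIV_shift[of "\<lambda>y. qy (Re z1) y" "qyy (Re z1) (Im z1)" 0 "Im z1"] qyy by (simp add: add.commute)
    ultimately show "((\<lambda>s. Re (deriv G (z1 + of_real s * \<i>) * \<i>) + qy (Re z1) (Im z1 + s))
        has_real_derivative Re (deriv (deriv G) z1 * \<i> * \<i>) + qyy (Re z1) (Im z1)) (at 0)"
      unfolding mult.commute[of _ "\<i>"] by (intro DERIV_add) (simp_all add: mult.assoc)
  qed
  ultimately show False using lap[OF z1S] \<eta>(1) by (simp add: algebra_simps)
qed

corollary maximum_principle_Re:
  fixes v :: "complex \<Rightarrow> real"
  assumes "open S" "S \<subseteq> K" "compact K" "continuous_on K v"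
    and "G holomorphic_on S" "\<And>z. z \<in> S \<Longrightarrow> v z = Re (G z)"
    and "\<And>z. z \<in> K \<Longrightarrow> z \<notin> S \<Longrightarrow> v z \<le> 0" "z0 \<in> K"
  shows "v z0 \<le> 0"
  by (rule maximum_principle[where q = "\<lambda>_ _. 0" and qx = "\<lambda>_ _. 0" and qy = "\<lambda>_ _. 0"
        and qxx = "\<lambda>_ _. 0" and qyy = "\<lambda>_ _. 0", OF assms(1-5) _ _ _ _ _ _ assms(7,8)])
    (use assms(6) in auto)

text \<open>Maximum modulus for \<open>exp \<circ> G\<close>, whose modulus is
  \<open>exp (Re G)\<close>.\<close>

lemma strong_maximum_principle_Re:
  assumes G: "G holomorphic_on S" and S: "open S" "connected S" "z0 \<in> S"
    and max: "\<And>z. z \<in> S \<Longrightarrow> Re (G z) \<le> Re (G z0)" and "z \<in> S"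
  shows "Re (G z) = Re (G z0)"
proof -
  have "(\<lambda>z. exp (G z)) constant_on S"
  proof (rule maximum_modulus_principle[OF _ S(1,2,1) subset_refl S(3)])
    show "(\<lambda>z. exp (G z)) holomorphic_on S" by (intro holomorphic_intros G)
  qed (use max in simp)
  then have "exp (G z) = exp (G z0)"
    using S(3) \<open>z \<in> S\<close> by (metis constant_on_def)
  then have "norm (exp (G z)) = norm (exp (G z0))" by simp
  then show ?thesis by simp
qed

section \<open>Cauchy estimates from a bound on the real part\<close>

lemma deriv_bound_by_Re:
  assumes G: "G holomorphic_on ball p r" and "r > 0" "B > 0"
    and Re: "\<And>z. z \<in> ball p r \<Longrightarrow> \<bar>Re (G z)\<bar> \<le> B"
  shows "cmod (deriv G p) \<le> 18 * B / r"
proof -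
  \<comment> \<open>A bound on the real part alone confines the modulus of
    \<open>exp (G / B)\<close> to the interval from 1/e to e. Cauchy's estimate on radius
    \<open>r/2\<close>, with \<open>e < 3\<close>, gives \<open>6 / r\<close>; dividing by the
    modulus at \<open>p\<close>, at least 1/3, gives the 18.\<close>
  define \<phi> where "\<phi> = (\<lambda>z. exp (G z / of_real B))"
  have hol: "\<phi> holomorphic_on ball p r" unfolding \<phi>_def using \<open>B > 0\<close> by (intro holomorphic_intros G) auto
  have sub: "cball p (r/2) \<subseteq> ball p r" using \<open>r > 0\<close> by auto
  have Re1: "\<bar>Re (G z / of_real B)\<bar> \<le> 1" if "z \<in> ball p r" for z
    using Re[OF that] \<open>B > 0\<close> by (simp add: field_simps)
  have e3: "exp 1 < (3::real)" using e_less_272 by simp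
  have "cmod ((deriv ^^ 1) \<phi> p) \<le> fact 1 * 3 / (r/2) ^ 1"
  proof (rule Cauchy_higher_deriv_bound[where y = 0])
    show "\<phi> holomorphic_on ball p (r/2)" using hol holomorphic_on_subset sub ball_subset_cball by blast
    show "continuous_on (cball p (r/2)) \<phi>"
      using hol sub holomorphic_on_imp_continuous_on continuous_on_subset by blast
    fix w assume "w \<in> ball p (r/2)"
    then have "w \<in> ball p r" using \<open>r > 0\<close> by auto
    then have "norm (\<phi> w) \<le> exp 1" using abs_le_D1[OF Re1] by (simp add: \<phi>_def)
    then show "\<phi> w \<in> ball 0 3" using e3 by simp
  qed (use \<open>r > 0\<close> in auto)
  then have 1: "cmod (deriv \<phi> p) \<le> 6 / r" by simp
  have p: "p \<in> ball p r" using \<open>r > 0\<close> by simp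
  have "(G has_field_derivative deriv G p) (at p)" using G p holomorphic_derivI open_ball by blast
  then have "(\<phi> has_field_derivative \<phi> p * (deriv G p / of_real B)) (at p)"
    unfolding \<phi>_def using \<open>B > 0\<close> by (auto intro!: derivative_eq_intros)
  then have 2: "deriv \<phi> p = \<phi> p * (deriv G p / of_real B)" by (rule DERIV_imp_deriv)
  have "norm (\<phi> p) \<ge> exp (- 1)" using abs_le_D2[OF Re1[OF p]] by (simp add: \<phi>_def)
  moreover have "exp (- 1) \<ge> (1/3 :: real)"
    using e3 by (simp add: exp_minus field_simps)
  ultimately have "1/3 * (cmod (deriv G p) / B) \<le> norm (\<phi> p) * (cmod (deriv G p) / B)"
    using \<open>B > 0\<close> by (intro mult_right_mono) auto
  also have "\<dots> \<le> 6 / r" using 1 \<open>B > 0\<close> by (simp add: 2 norm_mult norm_divide)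
  finally show ?thesis using \<open>B > 0\<close> \<open>r > 0\<close> by (simp add: field_simps)
qed

lemma third_deriv_bound_by_Re:
  assumes G: "G holomorphic_on ball 0 r" and "r > 0" "B > 0"
    and Re: "\<And>z. z \<in> ball 0 r \<Longrightarrow> \<bar>Re (G z)\<bar> \<le> B" and z: "norm z \<le> r / 4"
  shows "cmod ((deriv ^^ 3) G z) \<le> 1280 * B / r ^ 3"
proof -
  have hol: "deriv G holomorphic_on ball 0 r" by (rule holomorphic_deriv[OF G open_ball])
  have sub: "cball z (r/4) \<subseteq> ball 0 r"
  proof
    fix w assume "w \<in> cball z (r/4)"
    then have "norm w \<le> norm z + r/4" using norm_triangle_sub[of w z] by (simp add: dist_norm norm_minus_commute)
    then show "w \<in> ball 0 r" using z \<open>r > 0\<close> by simp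
  qed
  \<comment> \<open>Points within \<open>r/4\<close> of \<open>z\<close> have norm at most
    \<open>r/2\<close>, so each has a disc of radius \<open>r/2\<close> for the first estimate,
    which yields \<open>36 B / r\<close>. The 40 provides the strict inequality for the open
    ball.\<close>
  have "cmod ((deriv ^^ 2) (deriv G) z) \<le> fact 2 * (40 * B / r) / (r/4) ^ 2"
  proof (rule Cauchy_higher_deriv_bound[where y = 0])
    show "deriv G holomorphic_on ball z (r/4)" using hol holomorphic_on_subset sub ball_subset_cball by blast
    show "continuous_on (cball z (r/4)) (deriv G)"
      using hol sub holomorphic_on_imp_continuous_on continuous_on_subset by blast
    fix w assume "w \<in> ball z (r/4)"
    then have "norm w \<le> norm z + r/4" using norm_triangle_sub[of w z] by (simp add: dist_norm norm_minus_commute)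
    then have w: "norm w \<le> r/2" using z by simp
    have sub: "ball w (r/2) \<subseteq> ball 0 r"
    proof
      fix x assume "x \<in> ball w (r/2)"
      then have "norm x < norm w + r/2" using norm_triangle_sub[of x w] by (simp add: dist_norm norm_minus_commute)
      then show "x \<in> ball 0 r" using w by simp
    qed
    have "cmod (deriv G w) \<le> 18 * B / (r/2)"
    proof (rule deriv_bound_by_Re)
      show "G holomorphic_on ball w (r/2)" using G sub by (rule holomorphic_on_subset)
      show "\<bar>Re (G x)\<bar> \<le> B" if "x \<in> ball w (r/2)" for x using Re sub that by blast
    qed (use \<open>r > 0\<close> \<open>B > 0\<close> in auto)
    also have "\<dots> < 40 * B / r" using \<open>r > 0\<close> \<open>B > 0\<close> by (simp add: field_simps)
    finally show "deriv G w \<in> ball 0 (40 * B / r)" by simp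
  qed (use \<open>r > 0\<close> in auto)
  moreover have "(deriv ^^ 3) G = (deriv ^^ 2) (deriv G)" by (simp add: numeral_3_eq_3 numeral_2_eq_2)
  ultimately show ?thesis by (simp add: power2_eq_square power3_eq_cube field_simps)
qed

lemma at_within_nontrivial_open:
  fixes S :: "'a::perfect_space set"
  assumes "open S" "p \<in> closure S"
  shows "at p within S \<noteq> bot"
proof -
  have "p islimpt S"
    using assms by (cases "p \<in> S") (auto simp: closure_def interior_open intro: interior_limit_point)
  then show ?thesis by (simp add: trivial_limit_within)
qed

text \<open>Near a point \<open>q\<close> of a small ball around \<open>p\<close>, the values of
  \<open>f\<close> are already within \<open>e/2\<close> of \<open>D p\<close>, hence so is their
  limit \<open>D q\<close>. This makes the extended gradient continuous.\<close>

lemma continuous_on_limit_extension: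
  fixes f D :: "'a::metric_space \<Rightarrow> 'b::metric_space"
  assumes lim: "\<And>p. p \<in> K \<Longrightarrow> (f \<longlongrightarrow> D p) (at p within T)"
    and nontriv: "\<And>p. p \<in> K \<Longrightarrow> at p within T \<noteq> bot"
  shows "continuous_on K D"
  unfolding continuous_on_iff
proof (intro ballI allI impI)
  fix p and e :: real assume p: "p \<in> K" and e: "0 < e"
  obtain d where d: "d > 0" "\<And>x. x \<in> T \<Longrightarrow> x \<noteq> p \<Longrightarrow> dist x p < d \<Longrightarrow> dist (f x) (D p) < e/2"
    using tendstoD[OF lim[OF p], of "e/2"] e unfolding eventually_at by auto
  show "\<exists>d>0. \<forall>x'\<in>K. dist x' p < d \<longrightarrow> dist (D x') (D p) < e"
  proof (intro exI conjI ballI impI)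
    fix q assume q: "q \<in> K" "dist q p < d"
    show "dist (D q) (D p) < e"
    proof (cases "q = p")
      case False
      define d' where "d' = min (d - dist q p) (dist q p)"
      have d': "d' > 0" using q False by (simp add: d'_def)
      have "\<forall>\<^sub>F x in at q within T. dist (f x) (D p) \<le> e/2"
        unfolding eventually_at
      proof (intro exI conjI ballI impI)
        fix x assume x: "x \<in> T" "x \<noteq> q \<and> dist x q < d'"
        have "dist x p \<le> dist x q + dist q p" by (rule dist_triangle)
        then have 1: "dist x p < d" using x by (auto simp: d'_def)
        have 2: "x \<noteq> p" using x by (auto simp: d'_def dist_commute)
        show "dist (f x) (D p) \<le> e/2" using d(2)[OF x(1) 2 1] by simp
      qed (rule d')
      then have "dist (D q) (D p) \<le> e/2"
        by (rule tendsto_upperbound[OF tendsto_dist[OF lim[OF q(1)] tendsto_const] _ nontriv[OF q(1)]])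
      then show ?thesis using e by simp
    qed (use e in simp)
  qed (rule d(1))
qed

text \<open>The barrier is \<open>y (1 + (y\<^sup>2 - 3 (x - x\<^sub>0)\<^sup>2) / (2 b\<^sup>2))\<close>: it is harmonic, nonpositive on the vertical
  sides, and at least \<open>y\<close> on the axis \<open>x = x\<^sub>0\<close>.\<close>

lemma Hopf_lemma_rectangle:
  fixes w :: "complex \<Rightarrow> real" and x0 b :: real
  defines "K \<equiv> {z. \<bar>Re z - x0\<bar> \<le> b \<and> 0 \<le> Im z \<and> Im z \<le> b}"
    and "S \<equiv> {z. \<bar>Re z - x0\<bar> < b \<and> 0 < Im z \<and> Im z < b}"
  assumes b: "b > 0" and w: "continuous_on K w" and G: "G holomorphic_on S" "\<And>z. z \<in> S \<Longrightarrow> w z = Re (G z)"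
    and nonneg: "\<And>z. z \<in> K \<Longrightarrow> 0 \<le> w z" and top: "\<And>z. z \<in> K \<Longrightarrow> Im z = b \<Longrightarrow> 0 < w z"
  shows "\<exists>c>0. \<forall>y. 0 \<le> y \<longrightarrow> y \<le> b \<longrightarrow> c * y \<le> w (Complex x0 y)"
proof -
  have clK: "closed K" unfolding K_def
    by (intro closed_Collect_conj closed_Collect_le continuous_intros)
  have "K \<subseteq> cball (of_real x0) (2 * b)"
  proof
    fix z assume z: "z \<in> K"
    have "norm (of_real x0 - z) \<le> \<bar>Re (of_real x0 - z)\<bar> + \<bar>Im (of_real x0 - z)\<bar>" by (rule cmod_le)
    then show "z \<in> cball (of_real x0) (2 * b)" using z by (auto simp: K_def dist_norm)
  qed
  then have cK: "compact K" using clK bounded_subset compact_eq_bounded_closed bounded_cball by blast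
  have oS: "open S" unfolding S_def
    by (intro open_Collect_conj open_Collect_less continuous_intros)
  define L where "L = {z \<in> K. Im z = b}"
  have "L = K \<inter> {z. Im z = b}" by (auto simp: L_def)
  then have "compact L" using cK
    by (simp add: compact_Int_closed closed_Collect_eq continuous_on_Im continuous_on_const)
  moreover have "L \<noteq> {}" using b by (auto simp: L_def K_def intro!: exI[of _ "Complex x0 b"])
  moreover have "continuous_on L w" by (rule continuous_on_subset[OF w]) (auto simp: L_def)
  ultimately have "\<exists>z1\<in>L. \<forall>z\<in>L. w z1 \<le> w z" by (rule continuous_attains_inf)
  then obtain z1 where z1: "z1 \<in> L" "\<And>z. z \<in> L \<Longrightarrow> w z1 \<le> w z" by auto
  define m where "m = w z1"
  have m: "m > 0" using z1(1) top by (auto simp: m_def L_def)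
  \<comment> \<open>The barrier is at most \<open>3 b / 2\<close> on the top side, so
    \<open>c\<close> times it stays below the minimum \<open>m\<close> of \<open>w\<close>
    there.\<close>
  define c where "c = 2 * m / (3 * b)"
  have c: "c > 0" using m b by (simp add: c_def)
  define \<beta> where "\<beta> = (\<lambda>z. Im z * (1 + ((Im z)\<^sup>2 - 3 * (Re z - x0)\<^sup>2) / (2 * b\<^sup>2)))"
  have \<beta>: "\<beta> z = Re (- \<i> * (z - of_real x0) + \<i> * (z - of_real x0) ^ 3 / of_real (2 * b\<^sup>2))" for z
  proof -
    have "Re (\<i> * (z - of_real x0) ^ 3 / of_real (2 * b\<^sup>2)) = - Im ((z - of_real x0) ^ 3) / (2 * b\<^sup>2)"
      by (simp only: Re_divide_of_real) simp
    moreover have "- Im ((z - of_real x0) ^ 3) = Im z * ((Im z)\<^sup>2 - 3 * (Re z - x0)\<^sup>2)"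
      by (simp add: power3_eq_cube power2_eq_square algebra_simps)
    ultimately show ?thesis by (simp add: \<beta>_def algebra_simps)
  qed
  have main: "c * \<beta> z - w z \<le> 0" if "z \<in> K" for z
  proof (rule maximum_principle_Re[OF oS _ cK, where G = "\<lambda>z. of_real c * (- \<i> * (z - of_real x0) + \<i> * (z - of_real x0) ^ 3 / of_real (2 * b\<^sup>2)) - G z"])
    show "S \<subseteq> K" by (auto simp: S_def K_def)
    show "continuous_on K (\<lambda>z. c * \<beta> z - w z)" unfolding \<beta>_def using b by (intro continuous_intros w) auto
    show "(\<lambda>z. of_real c * (- \<i> * (z - of_real x0) + \<i> * (z - of_real x0) ^ 3 / of_real (2 * b\<^sup>2)) - G z) holomorphic_on S"
      using b by (intro holomorphic_intros G) auto
    show "c * \<beta> z - w z = Re (of_real c * (- \<i> * (z - of_real x0) + \<i> * (z - of_real x0) ^ 3 / of_real (2 * b\<^sup>2)) - G z)"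
      if "z \<in> S" for z
      unfolding \<beta> by (simp only: G(2)[OF that] minus_complex.sel Re_complex_of_real times_complex.sel Im_complex_of_real)
    show "c * \<beta> z - w z \<le> 0" if z: "z \<in> K" "z \<notin> S" for z
    proof -
      consider "Im z = 0" | "\<bar>Re z - x0\<bar> = b" | "Im z = b" using z by (force simp: K_def S_def)
      then show ?thesis
      proof cases
        case 1
        then show ?thesis using nonneg[OF z(1)] by (simp add: \<beta>_def)
      next
        case 2
        then have e: "(Re z - x0)\<^sup>2 = b\<^sup>2" by (metis power2_abs)
        have "(Im z)\<^sup>2 \<le> b\<^sup>2" using z by (intro power_mono) (auto simp: K_def)
        then have "1 + ((Im z)\<^sup>2 - 3 * (Re z - x0)\<^sup>2) / (2 * b\<^sup>2) \<le> 0"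
          unfolding e using b by (simp add: field_simps)
        then have "\<beta> z \<le> 0" using z unfolding \<beta>_def K_def by (auto intro: mult_nonneg_nonpos)
        then have "c * \<beta> z \<le> 0" using c by (simp add: mult_le_0_iff)
        then show ?thesis using nonneg[OF z(1)] by simp
      next
        case 3
        have "1 + ((Im z)\<^sup>2 - 3 * (Re z - x0)\<^sup>2) / (2 * b\<^sup>2) \<le> 3 / 2"
          unfolding 3 using b by (simp add: field_simps)
        then have "\<beta> z \<le> b * (3/2)" unfolding \<beta>_def 3 using b by (intro mult_left_mono) auto
        then have "c * \<beta> z \<le> c * (b * (3/2))" using c by (intro mult_left_mono) auto
        also have "\<dots> = m" using b by (simp add: c_def)
        also have "\<dots> \<le> w z" using z1(2)[of z] z(1) 3 by (simp add: m_def L_def)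
        finally show ?thesis by simp
      qed
    qed
  qed (rule that)
  show ?thesis
  proof (intro exI conjI allI impI)
    fix y :: real assume y: "0 \<le> y" "y \<le> b"
    have "y * 1 \<le> y * (1 + y\<^sup>2 / (2 * b\<^sup>2))" using y by (intro mult_left_mono) auto
    then have "y \<le> \<beta> (Complex x0 y)" by (simp add: \<beta>_def)
    then have "c * y \<le> c * \<beta> (Complex x0 y)" using c by simp
    also have "\<dots> \<le> w (Complex x0 y)" using main[of "Complex x0 y"] y b by (auto simp: K_def)
    finally show "c * y \<le> w (Complex x0 y)" .
  qed (rule c)
qed

subsection \<open>The torsion function on a nearly equilateral triangle\<close>

text \<open>The triangle with vertices \<open>(-1/r, 0)\<close>, \<open>(1/b, 0)\<close>, \<open>(0, 1)\<close>; below \<open>r = sqrt 3\<close> and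
  \<open>1/b = sqrt 3/3 + t\<close>.\<close>

definition lA :: "real \<Rightarrow> complex \<Rightarrow> real" where
  "lA r z = 1 - Im z + r * Re z"

definition lB :: "real \<Rightarrow> complex \<Rightarrow> real" where
  "lB b z = 1 - Im z - b * Re z"

definition tri :: "real \<Rightarrow> real \<Rightarrow> complex set" where
  "tri r b = {z. 0 < Im z \<and> 0 < lA r z \<and> 0 < lB b z}"

definition ctri :: "real \<Rightarrow> real \<Rightarrow> complex set" where
  "ctri r b = {z. 0 \<le> Im z \<and> 0 \<le> lA r z \<and> 0 \<le> lB b z}"

lemma open_tri: "open (tri r b)"
  unfolding tri_def lA_def lB_def by (intro open_Collect_conj open_Collect_less continuous_intros)

lemma closed_ctri: "closed (ctri r b)"
  unfolding ctri_def lA_def lB_def by (intro closed_Collect_conj closed_Collect_le continuous_intros)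

lemma tri_subset_ctri: "tri r b \<subseteq> ctri r b"
  by (auto simp: tri_def ctri_def)

lemma lA_line: "lA r ((1 - u) *\<^sub>R z + u *\<^sub>R w) = (1 - u) * lA r z + u * lA r w"
  by (simp add: lA_def algebra_simps)

lemma lB_line: "lB b ((1 - u) *\<^sub>R z + u *\<^sub>R w) = (1 - u) * lB b z + u * lB b w"
  by (simp add: lB_def algebra_simps)

lemma convex_tri: "convex (tri r b)"
proof (rule convexI)
  fix z w and u v :: real assume zw: "z \<in> tri r b" "w \<in> tri r b" and uv: "0 \<le> u" "0 \<le> v" "u + v = 1"
  have u: "u = 1 - v" using uv by simp
  have pos: "0 < u * x + v * y" if "0 < x" "0 < y" for x y
  proof (cases "u = 0")
    case False
    then have "0 < u * x" using that uv by simp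
    moreover have "0 \<le> v * y" using that uv by simp
    ultimately show ?thesis by linarith
  qed (use that uv in auto)
  show "u *\<^sub>R z + v *\<^sub>R w \<in> tri r b"
    using zw pos[of "Im z" "Im w"] pos[of "lA r z" "lA r w"] pos[of "lB b z" "lB b w"]
    unfolding tri_def u by (simp add: lA_line lB_line)
qed

text \<open>\<open>r\<close> is abstract with \<open>r * r = 3\<close>, so that the arithmetic never
  meets a square root. The bound 3/2, true for small \<open>t\<close>, gives numerical control of
  every constant; \<open>b < r\<close> corresponds to \<open>t > 0\<close>.\<close>

locale triangle =
  fixes r b :: real
  assumes r_pos: "0 < r" and r_sq: "r * r = 3" and b_ge: "3 / 2 \<le> b" and b_less: "b < r"
begin

abbreviation "T \<equiv> tri r b"
abbreviation "K \<equiv> ctri r b"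
definition "\<epsilon> = r - b"

lemma r_bounds: "173 / 100 < r" "r < 174 / 100"
proof -
  have "\<not> r \<le> 173 / 100" using mult_mono[of r "173/100" r "173/100"] r_pos r_sq by auto
  then show "173 / 100 < r" by simp
  have "\<not> r \<ge> 174 / 100" using mult_mono[of "174/100" r "174/100" r] r_pos r_sq by auto
  then show "r < 174 / 100" by simp
qed

lemma eps_bounds: "0 < \<epsilon>" "\<epsilon> < 24 / 100"
  using r_bounds b_ge b_less by (auto simp: \<epsilon>_def)

lemma ctri_Im_le: "z \<in> K \<Longrightarrow> Im z \<le> 1"
proof -
  assume z: "z \<in> K"
  have "0 \<le> b * lA r z + r * lB b z" using z r_pos b_ge by (auto simp: ctri_def)
  also have "\<dots> = (b + r) * (1 - Im z)" by (simp add: lA_def lB_def algebra_simps)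
  finally show ?thesis using r_pos b_ge by (simp add: zero_le_mult_iff)
qed

lemma ctri_Re_bounds:
  assumes "z \<in> K"
  shows "- (1 - Im z) / r \<le> Re z" "Re z \<le> (1 - Im z) / b" "\<bar>Re z\<bar> \<le> 2/3 * (1 - Im z)"
proof -
  show 1: "- (1 - Im z) / r \<le> Re z" "Re z \<le> (1 - Im z) / b"
    using assms r_pos b_ge by (auto simp: ctri_def lA_def lB_def field_simps)
  have le: "(1 - Im z) / c \<le> 2/3 * (1 - Im z)" if "c \<ge> 3/2" for c
    using mult_left_mono[of 1 "c * (2/3)" "1 - Im z"] ctri_Im_le[OF assms] that by (simp add: field_simps)
  have "- ((1 - Im z) / r) \<le> Re z" using 1(1) by (simp only: minus_divide_left)
  then show "\<bar>Re z\<bar> \<le> 2/3 * (1 - Im z)"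
    using 1(2) le[of r] le[of b] b_ge b_less by linarith
qed

lemma ctri_Re_le: "z \<in> K \<Longrightarrow> \<bar>Re z\<bar> \<le> 2/3"
  using ctri_Re_bounds(3)[of z] by (auto simp: ctri_def)

lemma compact_ctri: "compact K"
proof -
  have "K \<subseteq> cball 0 2"
  proof
    fix z assume z: "z \<in> K"
    have "norm z \<le> \<bar>Re z\<bar> + \<bar>Im z\<bar>" by (rule cmod_le)
    then show "z \<in> cball 0 2" using ctri_Re_le[OF z] ctri_Im_le[OF z] z by (auto simp: ctri_def)
  qed
  then show ?thesis
    using closed_ctri bounded_subset compact_eq_bounded_closed bounded_cball by blast
qed

lemma ctri_subset_closure: "K \<subseteq> closure T"
proof
  fix z assume z: "z \<in> K"
  define w where "w = Complex 0 (1/2)"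
  have w: "w \<in> T" by (simp add: w_def tri_def lA_def lB_def)
  have "\<forall>\<^sub>F u in at_right 0. (1 - u) *\<^sub>R z + u *\<^sub>R w \<in> T"
    using eventually_at_right_real[OF zero_less_one]
  proof eventually_elim
    case (elim u)
    have pos: "0 < (1 - u) * x + u * y" if "0 \<le> x" "0 < y" for x y
      using that elim by (intro add_nonneg_pos) auto
    show ?case
      using z w pos[of "Im z" "Im w"] pos[of "lA r z" "lA r w"] pos[of "lB b z" "lB b w"]
      by (simp add: tri_def ctri_def lA_line lB_line)
  qed
  moreover have "((\<lambda>u. (1 - u) *\<^sub>R z + u *\<^sub>R w) \<longlongrightarrow> (1 - 0) *\<^sub>R z + 0 *\<^sub>R w) (at_right 0)"
    by (intro tendsto_intros)
  moreover have "\<forall>\<^sub>F u in at_right 0. (1 - u) *\<^sub>R z + u *\<^sub>R w \<in> closure T"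
    using calculation(1) by (rule eventually_mono) (use closure_subset in blast)
  ultimately have "(1 - 0) *\<^sub>R z + 0 *\<^sub>R w \<in> closure T"
    by (intro Lim_in_closed_set[OF closed_closure _ trivial_limit_at_right_real]) auto
  then show "z \<in> closure T" by simp
qed

lemma closure_tri: "closure T = K"
  using ctri_subset_closure closure_minimal[OF tri_subset_ctri closed_ctri] by blast

lemma at_within_tri_nontrivial: "p \<in> K \<Longrightarrow> at p within T \<noteq> bot"
  using at_within_nontrivial_open[OF open_tri] by (simp add: closure_tri)

text \<open>Cauchy-Schwarz: a gradient \<open>(c, 1)\<close> with \<open>c * c\<close> at most 3 has
  length at most 2. This makes the side functions 2-Lipschitz.\<close>

lemma lipschitz_aux:
  assumes "c * c \<le> 3"
  shows "\<bar>Im z + c * Re z\<bar> \<le> 2 * cmod z"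
proof -
  have "(Im z + c * Re z)\<^sup>2 \<le> (1 + c * c) * (cmod z)\<^sup>2"
    unfolding cmod_power2 using zero_le_square[of "c * Im z - Re z"]
    by (simp add: power2_eq_square algebra_simps)
  also have "\<dots> \<le> 4 * (cmod z)\<^sup>2" using assms by (intro mult_right_mono) auto
  finally have "(Im z + c * Re z)\<^sup>2 \<le> (2 * cmod z)\<^sup>2" by (simp add: power2_eq_square)
  then have "\<bar>Im z + c * Re z\<bar> \<le> \<bar>2 * cmod z\<bar>" by (simp only: abs_le_square_iff)
  then show ?thesis by simp
qed

lemma lipschitz_lA: "\<bar>lA r q - lA r z\<bar> \<le> 2 * cmod (q - z)"
  using lipschitz_aux[of "- r" "q - z"] r_sq by (simp add: lA_def algebra_simps)

lemma lipschitz_lB: "\<bar>lB b q - lB b z\<bar> \<le> 2 * cmod (q - z)"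
proof -
  have "b * b \<le> r * r" using b_less b_ge r_pos by (intro mult_mono) auto
  then show ?thesis
    using lipschitz_aux[of b "q - z"] r_sq by (simp add: lB_def algebra_simps)
qed

lemma lipschitz_Im: "\<bar>Im q - Im z\<bar> \<le> 2 * cmod (q - z)"
  using abs_Im_le_cmod[of "q - z"] by simp

lemma ctri_diff_tri: "z \<in> K \<Longrightarrow> z \<notin> T \<Longrightarrow> Im z = 0 \<or> lA r z = 0 \<or> lB b z = 0"
  by (auto simp: tri_def ctri_def)

end

section \<open>Comparison with the product of the side functions\<close>

locale torsion_triangle = triangle +
  fixes U :: "complex \<Rightarrow> real" and F :: "complex \<Rightarrow> complex"
  assumes U_cont: "continuous_on K U" and F_hol: "F holomorphic_on T"
    and U_eq: "z \<in> T \<Longrightarrow> U z = Re (F z) - (cmod z)\<^sup>2 / 4"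
    and U_bd: "z \<in> K \<Longrightarrow> z \<notin> T \<Longrightarrow> U z = 0"
begin

definition "P z = Im z * lA r z * lB b z"

text \<open>One computation for both bounds, with \<sigma> equal to 1 or -1. The Laplacian of
  \<open>P\<close> is \<open>- 4 (1 + \<epsilon> (x - r y) / 2)\<close>, so the hypothesis on
  \<open>k\<close> says that \<open>\<sigma> (U - k P / 4)\<close> is subharmonic; it vanishes on
  the boundary.\<close>

lemma P_compare:
  assumes k: "\<And>z. z \<in> T \<Longrightarrow> 0 \<le> \<sigma> * (- 1 + k * (1 + \<epsilon> * (Re z - r * Im z) / 2))" and z: "z \<in> K"
  shows "\<sigma> * (U z - k / 4 * P z) \<le> 0"
proof (rule maximum_principle[OF open_tri tri_subset_ctri compact_ctri, where v = "\<lambda>z. \<sigma> * (U z - k / 4 * P z)" and ?z0.0 = z and G = "\<lambda>z. of_real \<sigma> * F z"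
      and q = "\<lambda>x y. \<sigma> * (- (x\<^sup>2 + y\<^sup>2) / 4 - k / 4 * (y * (1 - y + r * x) * (1 - y - b * x)))"
      and qx = "\<lambda>x y. \<sigma> * (- x / 2 - k / 4 * (y * (r * (1 - y - b * x) - b * (1 - y + r * x))))"
      and qxx = "\<lambda>x y. \<sigma> * (- 1 / 2 - k / 4 * (y * (- 2 * (r * b))))"
      and qy = "\<lambda>x y. \<sigma> * (- y / 2 - k / 4 * ((1 - y + r * x) * (1 - y - b * x) - y * (2 - 2 * y + (r - b) * x)))"
      and qyy = "\<lambda>x y. \<sigma> * (- 1 / 2 - k / 4 * (- 2 * (2 - 2 * y + (r - b) * x) + 2 * y))"])
  show "continuous_on K (\<lambda>z. \<sigma> * (U z - k / 4 * P z))"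
    unfolding P_def lA_def lB_def by (intro continuous_intros U_cont)
  show "(\<lambda>z. of_real \<sigma> * F z) holomorphic_on T" by (intro holomorphic_intros F_hol)
  show "\<sigma> * (U z - k / 4 * P z) = Re (of_real \<sigma> * F z)
      + \<sigma> * (- ((Re z)\<^sup>2 + (Im z)\<^sup>2) / 4 - k / 4 * (Im z * (1 - Im z + r * Re z) * (1 - Im z - b * Re z)))"
    if "z \<in> T" for z
  proof -
    have "U z - k / 4 * P z = Re (F z) + (- ((Re z)\<^sup>2 + (Im z)\<^sup>2) / 4 - k / 4 * (Im z * (1 - Im z + r * Re z) * (1 - Im z - b * Re z)))"
      by (simp add: U_eq[OF that] cmod_power2 P_def lA_def lB_def add_divide_distrib)
    then show ?thesis by (simp only: distrib_left) simp
  qed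
  show "0 \<le> \<sigma> * (- 1 / 2 - k / 4 * (Im z * (- 2 * (r * b))))
      + \<sigma> * (- 1 / 2 - k / 4 * (- 2 * (2 - 2 * Im z + (r - b) * Re z) + 2 * Im z))" if "z \<in> T" for z
  proof -
    have e: "\<epsilon> * (Re z - r * Im z) = (r - b) * Re z + r * b * Im z - 3 * Im z"
      unfolding r_sq[symmetric] by (simp add: \<epsilon>_def algebra_simps)
    have "\<sigma> * (- 1 / 2 - k / 4 * (Im z * (- 2 * (r * b)))) + \<sigma> * (- 1 / 2 - k / 4 * (- 2 * (2 - 2 * Im z + (r - b) * Re z) + 2 * Im z))
        = \<sigma> * (- 1 + k * (1 + ((r - b) * Re z + r * b * Im z - 3 * Im z) / 2))"
      by (simp add: field_simps)
    then show ?thesis using k[OF that] unfolding e by simp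
  qed
  show "\<sigma> * (U z - k / 4 * P z) \<le> 0" if "z \<in> K" "z \<notin> T" for z
    using U_bd[OF that] ctri_diff_tri[OF that] by (auto simp: P_def)
qed (use z in \<open>auto intro!: derivative_eq_intros simp: algebra_simps power2_eq_square\<close>)

lemma P_nonneg: "z \<in> K \<Longrightarrow> 0 \<le> P z"
  by (auto simp: P_def ctri_def)

lemma U_upper: "z \<in> K \<Longrightarrow> U z \<le> (1 + 2 * \<epsilon>) / 4 * P z"
proof -
  assume z: "z \<in> K"
  have "1 * (U z - (1 + 2 * \<epsilon>) / 4 * P z) \<le> 0"
  proof (rule P_compare[OF _ z])
    fix z assume "z \<in> T"
    then have z: "z \<in> K" using tri_subset_ctri by blast
    have "- (1 - Im z) \<le> r * Re z" using z by (auto simp: ctri_def lA_def)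
    then have "- 1 * (1 - Im z) - 3 * Im z \<le> r * (Re z - r * Im z)" using r_sq by (simp add: algebra_simps flip: mult.assoc)
    then have "- 3 \<le> r * (Re z - r * Im z)"
    proof (rule order_trans[rotated])
      show "- 3 \<le> - 1 * (1 - Im z) - 3 * Im z" using ctri_Im_le[OF z] by simp
    qed
    then have "r * (- r) \<le> r * (Re z - r * Im z)" using r_sq by simp
    then have "- r \<le> Re z - r * Im z" using r_pos mult_le_cancel_left_pos by blast
    \<comment> \<open>The minimum \<open>- r\<close> of \<open>x - r y\<close> is attained at the
      apex. Half of it gives the 87/100 below, which the factor \<open>1 + 2 \<epsilon>\<close>
      outweighs since \<open>\<epsilon> < 24/100\<close>.\<close>
    then have "- 174 / 100 \<le> Re z - r * Im z" using r_bounds by linarith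
    then have "\<epsilon> * (- 174 / 100) \<le> \<epsilon> * (Re z - r * Im z)" using eps_bounds by (intro mult_left_mono) auto
    then have "1 - 87/100 * \<epsilon> \<le> 1 + \<epsilon> * (Re z - r * Im z) / 2" by linarith
    then have "(1 + 2 * \<epsilon>) * (1 - 87/100 * \<epsilon>) \<le> (1 + 2 * \<epsilon>) * (1 + \<epsilon> * (Re z - r * Im z) / 2)"
      using eps_bounds by (intro mult_left_mono) auto
    moreover have "\<epsilon> * \<epsilon> \<le> 24/100 * \<epsilon>" using eps_bounds by (intro mult_right_mono) auto
    then have "1 \<le> (1 + 2 * \<epsilon>) * (1 - 87/100 * \<epsilon>)" using eps_bounds by (simp add: algebra_simps)
    ultimately show "0 \<le> 1 * (- 1 + (1 + 2 * \<epsilon>) * (1 + \<epsilon> * (Re z - r * Im z) / 2))" by simp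
  qed
  then show ?thesis by simp
qed

lemma U_lower: "z \<in> K \<Longrightarrow> (1 - \<epsilon>) / 4 * P z \<le> U z"
proof -
  assume z: "z \<in> K"
  have "(- 1) * (U z - (1 - \<epsilon>) / 4 * P z) \<le> 0"
  proof (rule P_compare[OF _ z])
    fix z assume "z \<in> T"
    then have z: "z \<in> K" using tri_subset_ctri by blast
    have "Re z - r * Im z \<le> 1 - 0" using ctri_Re_le[OF z] z r_pos by (intro diff_mono) (auto simp: ctri_def)
    then have "\<epsilon> * (Re z - r * Im z) \<le> \<epsilon> * 1" using eps_bounds by (intro mult_left_mono) auto
    then have "1 + \<epsilon> * (Re z - r * Im z) / 2 \<le> 1 + \<epsilon> / 2" by linarith
    then have "(1 - \<epsilon>) * (1 + \<epsilon> * (Re z - r * Im z) / 2) \<le> (1 - \<epsilon>) * (1 + \<epsilon> / 2)"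
      using eps_bounds by (intro mult_left_mono) auto
    moreover have "0 \<le> \<epsilon> * \<epsilon>" by simp
    then have "(1 - \<epsilon>) * (1 + \<epsilon> / 2) \<le> 1" using eps_bounds by (simp add: algebra_simps)
    ultimately show "0 \<le> (- 1) * (- 1 + (1 - \<epsilon>) * (1 + \<epsilon> * (Re z - r * Im z) / 2))" by simp
  qed
  then show ?thesis by simp
qed

lemma U_nonneg: "z \<in> K \<Longrightarrow> 0 \<le> U z"
proof -
  assume z: "z \<in> K"
  have "0 \<le> (1 - \<epsilon>) / 4 * P z" using P_nonneg[OF z] eps_bounds by simp
  then show ?thesis using U_lower[OF z] by linarith
qed

lemma U_pos: "z \<in> T \<Longrightarrow> 0 < U z"
proof -
  assume z: "z \<in> T"
  then have "0 < (1 - \<epsilon>) / 4 * P z" using eps_bounds by (auto simp: P_def tri_def)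
  then show ?thesis using U_lower[of z] z tri_subset_ctri by force
qed

section \<open>Gradient bounds and decay of the gradient at the vertices\<close>

definition "vertex V \<longleftrightarrow> Im V = 0 \<and> lA r V = 0 \<or> Im V = 0 \<and> lB b V = 0 \<or> lA r V = 0 \<and> lB b V = 0"

text \<open>A boundary point annihilates one factor of \<open>P\<close> and a vertex two, so some
  factor vanishing at \<open>V\<close> differs from one vanishing at \<open>z\<close>. These two
  factors are bounded by the two distances, the third by 11/5.\<close>

lemma U_le_boundary_vertex:
  assumes z: "z \<in> K" "z \<notin> T" and q: "q \<in> K" and V: "vertex V"
  shows "U q \<le> 4 * cmod (q - z) * cmod (q - V)"
proof -
  have l: "0 \<le> Im q" "0 \<le> lA r q" "0 \<le> lB b q" using q by (auto simp: ctri_def)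
  have rx: "r * \<bar>Re q\<bar> \<le> 174/100 * (2/3)" using r_bounds r_pos ctri_Re_le[OF q] by (intro mult_mono) auto
  have bx: "b * \<bar>Re q\<bar> \<le> 174/100 * (2/3)" using r_bounds b_ge b_less ctri_Re_le[OF q] by (intro mult_mono) auto
  have up: "Im q \<le> 11/5" "lA r q \<le> 11/5" "lB b q \<le> 11/5"
  proof -
    have "r * Re q \<le> r * \<bar>Re q\<bar>" "- b * Re q \<le> b * \<bar>Re q\<bar>"
      using r_pos b_ge by (auto simp: abs_if mult_nonneg_nonpos)
    then show "Im q \<le> 11/5" "lA r q \<le> 11/5" "lB b q \<le> 11/5"
      using rx bx l(1) ctri_Im_le[OF q] by (auto simp: lA_def lB_def)
  qed
  have prod: "(1 + 2 * \<epsilon>) / 4 * (x * y * w) \<le> 4 * cmod (q - z) * cmod (q - V)"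
    if "0 \<le> x" "x \<le> 2 * cmod (q - z)" "0 \<le> y" "y \<le> 2 * cmod (q - V)" "0 \<le> w" "w \<le> 11/5" for x y w
  proof -
    have "x * y * w \<le> (2 * cmod (q - z)) * (2 * cmod (q - V)) * (11/5)"
      using that by (intro mult_mono) auto
    \<comment> \<open>37/100 bounds \<open>(1 + 2 \<epsilon>) / 4\<close> because
      \<open>\<epsilon> < 24/100\<close>; its product with 44/5 is below 4.\<close>
    then have "(1 + 2 * \<epsilon>) / 4 * (x * y * w) \<le> (37/100) * ((2 * cmod (q - z)) * (2 * cmod (q - V)) * (11/5))"
      using that eps_bounds by (intro mult_mono) auto
    also have "\<dots> = (37/100 * 44/5) * (cmod (q - z) * cmod (q - V))" by simp
    also have "\<dots> \<le> 4 * (cmod (q - z) * cmod (q - V))" by (intro mult_right_mono) auto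
    finally show ?thesis by simp
  qed
  note lip = lipschitz_Im[of q z] lipschitz_lA[of q z] lipschitz_lB[of q z]
    lipschitz_Im[of q V] lipschitz_lA[of q V] lipschitz_lB[of q V]
  have z0: "Im z = 0 \<or> lA r z = 0 \<or> lB b z = 0" by (rule ctri_diff_tri[OF z])
  have "(1 + 2 * \<epsilon>) / 4 * P q \<le> 4 * cmod (q - z) * cmod (q - V)"
  proof -
    let ?G = "(1 + 2 * \<epsilon>) / 4 * P q \<le> 4 * cmod (q - z) * cmod (q - V)"
    have "Im z = 0 \<Longrightarrow> lA r V = 0 \<Longrightarrow> ?G" "Im z = 0 \<Longrightarrow> lB b V = 0 \<Longrightarrow> ?G"
      "lA r z = 0 \<Longrightarrow> Im V = 0 \<Longrightarrow> ?G" "lA r z = 0 \<Longrightarrow> lB b V = 0 \<Longrightarrow> ?G"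
      "lB b z = 0 \<Longrightarrow> Im V = 0 \<Longrightarrow> ?G" "lB b z = 0 \<Longrightarrow> lA r V = 0 \<Longrightarrow> ?G"
      using lip l up
        prod[of "Im q" "lA r q" "lB b q"] prod[of "Im q" "lB b q" "lA r q"]
        prod[of "lA r q" "Im q" "lB b q"] prod[of "lA r q" "lB b q" "Im q"]
        prod[of "lB b q" "Im q" "lA r q"] prod[of "lB b q" "lA r q" "Im q"]
      unfolding P_def by (simp_all only: abs_le_iff mult_ac diff_0_right)
    then show ?thesis using z0 V unfolding vertex_def by blast
  qed
  then show ?thesis using U_upper[OF q] by linarith
qed

text \<open>\<open>D\<close> is the complex gradient \<open>u\<^sub>x - \<i> u\<^sub>y\<close>.\<close>

definition "D z = deriv F z - cnj z / 2"

lemma F_deriv: "z \<in> T \<Longrightarrow> (F has_field_derivative deriv F z) (at z)"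
  using F_hol open_tri holomorphic_derivI by blast

lemma continuous_on_D: "continuous_on T D"
  unfolding D_def using holomorphic_deriv[OF F_hol open_tri]
  by (intro continuous_intros holomorphic_on_imp_continuous_on) auto

text \<open>The maximum principle for the increments of \<open>U\<close>, on the intersection of \<open>T\<close> with a translate.
  As the majorant vanishes at the vertex to first order, this shows that the gradient tends to \<open>0\<close> there.\<close>

lemma D_bound_vertex:
  assumes V: "vertex V" and L: "\<And>z. L z = \<alpha> + \<beta> * Re z + \<gamma> * Im z"
    and dom: "\<And>z. z \<in> K \<Longrightarrow> cmod (z - V) \<le> L z" and z: "z \<in> T"
  shows "cmod (D z) \<le> 4 * L z"
proof (cases "D z = 0")
  case True
  have "z \<in> K" using z tri_subset_ctri by blast
  from order_trans[OF norm_ge_zero dom[OF this]] show ?thesis using True by simp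
next
  case False
  \<comment> \<open>Harmonic in \<open>w\<close>, because
    \<open>|w + h|\<^sup>2 - |w|\<^sup>2\<close> and the majorant \<open>L\<close> are affine. The
    extra \<open>cmod h\<close> pays for replacing the distance of \<open>w + h\<close> from
    \<open>V\<close> by that of \<open>w\<close>.\<close>
  have incr: "U (w + h) - U w - 4 * cmod h * (L w + cmod h) \<le> 0" if w: "w \<in> K" "w + h \<in> K" for w h
  proof (rule maximum_principle_Re[where v = "\<lambda>w. U (w + h) - U w - 4 * cmod h * (L w + cmod h)" and ?z0.0 = w and S = "T \<inter> (\<lambda>w. w + h) -` T" and K = "K \<inter> (\<lambda>w. w + h) -` K"
        and G = "\<lambda>w. F (w + h) - F w - cnj h * w / 2 - of_real ((cmod h)\<^sup>2 / 4)
          - of_real (4 * cmod h) * (of_real (\<alpha> + cmod h) + Complex \<beta> (- \<gamma>) * w)"])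
    show "open (T \<inter> (\<lambda>w. w + h) -` T)"
      by (intro open_Int open_tri open_vimage continuous_intros)
    show "T \<inter> (\<lambda>w. w + h) -` T \<subseteq> K \<inter> (\<lambda>w. w + h) -` K" using tri_subset_ctri by blast
    show "compact (K \<inter> (\<lambda>w. w + h) -` K)"
      by (intro compact_Int_closed compact_ctri closed_vimage closed_ctri continuous_intros)
    have "continuous_on (K \<inter> (\<lambda>w. w + h) -` K) (\<lambda>w. U (w + h))"
      by (rule continuous_on_compose2[OF U_cont]) (auto intro!: continuous_intros)
    moreover have "continuous_on (K \<inter> (\<lambda>w. w + h) -` K) U"
      by (rule continuous_on_subset[OF U_cont]) auto
    ultimately show "continuous_on (K \<inter> (\<lambda>w. w + h) -` K) (\<lambda>w. U (w + h) - U w - 4 * cmod h * (L w + cmod h))"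
      unfolding L by (intro continuous_intros)
    have "(F \<circ> (\<lambda>w. w + h)) holomorphic_on (T \<inter> (\<lambda>w. w + h) -` T)"
      by (rule holomorphic_on_compose_gen[OF _ F_hol]) (auto intro!: holomorphic_intros)
    moreover have "F holomorphic_on (T \<inter> (\<lambda>w. w + h) -` T)"
      by (rule holomorphic_on_subset[OF F_hol]) auto
    ultimately show "(\<lambda>w. F (w + h) - F w - cnj h * w / 2 - of_real ((cmod h)\<^sup>2 / 4)
          - of_real (4 * cmod h) * (of_real (\<alpha> + cmod h) + Complex \<beta> (- \<gamma>) * w)) holomorphic_on (T \<inter> (\<lambda>w. w + h) -` T)"
      unfolding o_def by (intro holomorphic_intros) auto
    show "U (w + h) - U w - 4 * cmod h * (L w + cmod h) = Re (F (w + h) - F w - cnj h * w / 2 - of_real ((cmod h)\<^sup>2 / 4)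
          - of_real (4 * cmod h) * (of_real (\<alpha> + cmod h) + Complex \<beta> (- \<gamma>) * w))"
      if "w \<in> T \<inter> (\<lambda>w. w + h) -` T" for w
    proof -
      have "(cmod (w + h))\<^sup>2 = (cmod w)\<^sup>2 + (cmod h)\<^sup>2 + 2 * Re (cnj h * w)"
        unfolding cmod_power2 by (simp add: power2_eq_square algebra_simps)
      moreover have "Re (cnj h * w / 2) = Re (cnj h * w) / 2" by (rule Re_divide_numeral)
      moreover have "Re (of_real (4 * cmod h) * (of_real (\<alpha> + cmod h) + Complex \<beta> (- \<gamma>) * w)) = 4 * cmod h * (L w + cmod h)"
        by (simp add: L)
      ultimately show ?thesis
        using that by (simp add: U_eq add_divide_distrib del: times_complex.sel)
    qed
    show "U (w + h) - U w - 4 * cmod h * (L w + cmod h) \<le> 0"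
      if "w \<in> K \<inter> (\<lambda>w. w + h) -` K" "w \<notin> T \<inter> (\<lambda>w. w + h) -` T" for w
    \<comment> \<open>Either \<open>w\<close> is on the boundary and the previous estimate applies
      with \<open>z = w\<close>, or \<open>w + h\<close> is, and then \<open>U (w + h) = 0\<close>
      while \<open>- U w\<close> has the right sign.\<close>
    proof (cases "w \<in> T")
      case False
      then have "U (w + h) \<le> 4 * cmod (w + h - w) * cmod (w + h - V)"
        using that V by (intro U_le_boundary_vertex) auto
      also have "\<dots> \<le> 4 * cmod h * (L w + cmod h)"
      proof -
        have "cmod (w + h - V) \<le> cmod (w - V) + cmod h" using norm_triangle_ineq[of "w - V" h] by (simp add: algebra_simps)
        also have "\<dots> \<le> L w + cmod h" using dom that by auto
        finally show ?thesis by (simp add: mult_left_mono)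
      qed
      finally show ?thesis using U_bd[of w] False that by auto
    next
      case True
      then have "U (w + h) = 0" "0 \<le> U w" using that U_bd[of "w + h"] U_nonneg[of w] by auto
      moreover have "0 \<le> L w" using order_trans[OF norm_ge_zero dom[of w]] that by blast
      moreover from this have "0 \<le> 4 * cmod h * (L w + cmod h)" by simp
      ultimately show ?thesis by linarith
    qed
  qed (use that in auto)
  \<comment> \<open>The direction of steepest ascent: the derivative of \<open>U\<close> along
    \<open>e\<close> is \<open>cmod (D z)\<close>.\<close>
  define e where "e = cnj (D z) / of_real (cmod (D z))"
  have "D z * e = of_real ((cmod (D z))\<^sup>2) / of_real (cmod (D z))"
    unfolding e_def complex_norm_square by simp
  then have "D z * e = of_real (cmod (D z))" using False by (simp add: power2_eq_square)
  then have e: "cmod e = 1" "Re (D z * e) = cmod (D z)"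
    using False by (auto simp: e_def norm_divide)
  define \<phi> where "\<phi> = (\<lambda>s::real. Re (F (z + of_real s * e)) - (cmod (z + of_real s * e))\<^sup>2 / 4)"
  have "(\<phi> has_real_derivative Re (deriv F z * e) - (2 * (Re z * Re e + Im z * Im e)) / 4) (at 0)"
    unfolding \<phi>_def
  proof (intro DERIV_diff)
    show "((\<lambda>s. Re (F (z + of_real s * e))) has_real_derivative Re (deriv F z * e)) (at 0)"
      by (rule has_real_derivative_Re_line) (use F_deriv z in simp)
    show "((\<lambda>s. (cmod (z + of_real s * e))\<^sup>2 / 4) has_real_derivative (2 * (Re z * Re e + Im z * Im e)) / 4) (at 0)"
      unfolding cmod_power2 by (auto intro!: derivative_eq_intros)
  qed
  moreover have "Re (deriv F z * e) - (2 * (Re z * Re e + Im z * Im e)) / 4 = cmod (D z)"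
    unfolding e(2)[symmetric] by (simp add: D_def algebra_simps)
  ultimately have "(\<phi> has_real_derivative cmod (D z)) (at 0)" by simp
  then have "((\<lambda>s. (\<phi> (0 + s) - \<phi> 0) / s) \<longlongrightarrow> cmod (D z)) (at 0)" by (simp add: DERIV_def)
  then have "((\<lambda>s. (\<phi> s - \<phi> 0) / s) \<longlongrightarrow> cmod (D z)) (at_right 0)" by (simp add: filterlim_at_split)
  note lim1 = this
  have lim2: "((\<lambda>s. 4 * (L z + s)) \<longlongrightarrow> 4 * (L z + 0)) (at_right 0)" by (intro tendsto_intros)
  have "\<forall>\<^sub>F s in at_right 0. (\<phi> s - \<phi> 0) / s \<le> 4 * (L z + s)"
  proof -
    have "((\<lambda>s::real. z + of_real s * e) \<longlongrightarrow> z + of_real 0 * e) (at_right 0)" by (intro tendsto_intros)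
    then have "\<forall>\<^sub>F s in at_right (0::real). z + of_real s * e \<in> T"
      by (rule topological_tendstoD) (use open_tri z in auto)
    with eventually_at_right_less[of 0] show ?thesis
    proof eventually_elim
      case (elim s)
      then have "U (z + of_real s * e) - U z - 4 * cmod (of_real s * e) * (L z + cmod (of_real s * e)) \<le> 0"
        using tri_subset_ctri z by (intro incr) auto
      then have "\<phi> s - \<phi> 0 \<le> 4 * s * (L z + s)"
        using elim z e by (simp add: \<phi>_def U_eq norm_mult)
      then show ?case using elim by (simp add: field_simps)
    qed
  qed
  then have "cmod (D z) \<le> 4 * (L z + 0)" by (rule tendsto_le[OF trivial_limit_at_right_real lim2 lim1])
  then show ?thesis by simp
qed

text \<open>Every angle of the triangle is less than a straight angle, so some affine function
  vanishing at \<open>V\<close> dominates the distance from \<open>V\<close> on \<open>K\<close>.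
  The coefficients bound the sum of the absolute coordinate differences: 3 since the slopes of the
  sides are below 2, and 2 at the apex since \<open>|Re z|\<close> is at most
  \<open>2/3 (1 - Im z)\<close>.\<close>

lemma vertex_majorant:
  assumes "vertex V"
  shows "\<exists>\<alpha> \<beta> \<gamma>. \<alpha> + \<beta> * Re V + \<gamma> * Im V = 0 \<and> (\<forall>z\<in>K. cmod (z - V) \<le> \<alpha> + \<beta> * Re z + \<gamma> * Im z)"
  using assms unfolding vertex_def
proof (elim disjE conjE)
  assume V: "Im V = 0" "lA r V = 0"
  then have ReV: "r * Re V = - 1" by (simp add: lA_def)
  show ?thesis
  proof (rule exI[of _ "- 3 * Re V"], rule exI[of _ 3], rule exI[of _ 0], intro conjI ballI)
    fix z assume z: "z \<in> K"
    then have "Im z \<le> r * (Re z - Re V)" "0 \<le> Im z" by (auto simp: ctri_def lA_def algebra_simps ReV)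
    moreover have "0 \<le> Re z - Re V"
    proof -
      have "0 \<le> r * (Re z - Re V)" using calculation by linarith
      then show ?thesis using r_pos by (simp add: zero_le_mult_iff)
    qed
    moreover from this have "r * (Re z - Re V) \<le> 2 * (Re z - Re V)" using r_bounds by (intro mult_right_mono) auto
    moreover have "cmod (z - V) \<le> \<bar>Re (z - V)\<bar> + \<bar>Im (z - V)\<bar>" by (rule cmod_le)
    ultimately show "cmod (z - V) \<le> - 3 * Re V + 3 * Re z + 0 * Im z" using V by simp
  qed simp
next
  assume V: "Im V = 0" "lB b V = 0"
  then have ReV: "b * Re V = 1" by (simp add: lB_def)
  show ?thesis
  proof (rule exI[of _ "3 * Re V"], rule exI[of _ "- 3"], rule exI[of _ 0], intro conjI ballI)
    fix z assume z: "z \<in> K"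
    then have "Im z \<le> b * (Re V - Re z)" "0 \<le> Im z" by (auto simp: ctri_def lB_def algebra_simps ReV)
    moreover have "0 \<le> Re V - Re z"
    proof -
      have "0 \<le> b * (Re V - Re z)" using calculation by linarith
      then show ?thesis using b_ge by (simp add: zero_le_mult_iff)
    qed
    moreover from this have "b * (Re V - Re z) \<le> 2 * (Re V - Re z)" using r_bounds b_less by (intro mult_right_mono) auto
    moreover have "cmod (z - V) \<le> \<bar>Re (z - V)\<bar> + \<bar>Im (z - V)\<bar>" by (rule cmod_le)
    ultimately show "cmod (z - V) \<le> 3 * Re V + - 3 * Re z + 0 * Im z" using V by simp
  qed simp
next
  assume V: "lA r V = 0" "lB b V = 0"
  then have "(r + b) * Re V = 0" by (simp add: lA_def lB_def algebra_simps)
  then have V': "Re V = 0" "Im V = 1" using r_pos b_ge V by (auto simp: lA_def)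
  show ?thesis
  proof (rule exI[of _ 2], rule exI[of _ 0], rule exI[of _ "- 2"], intro conjI ballI)
    fix z assume z: "z \<in> K"
    have "cmod (z - V) \<le> \<bar>Re (z - V)\<bar> + \<bar>Im (z - V)\<bar>" by (rule cmod_le)
    then show "cmod (z - V) \<le> 2 + 0 * Re z + - 2 * Im z"
      using V' ctri_Re_bounds(3)[OF z] ctri_Im_le[OF z] by simp
  qed (use V' in simp)
qed

lemma D_tendsto_vertex:
  assumes "vertex V" "V \<in> K"
  shows "(D \<longlongrightarrow> 0) (at V within T)"
proof -
  obtain \<alpha> \<beta> \<gamma> where L: "\<alpha> + \<beta> * Re V + \<gamma> * Im V = 0" "\<And>z. z \<in> K \<Longrightarrow> cmod (z - V) \<le> \<alpha> + \<beta> * Re z + \<gamma> * Im z"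
    using vertex_majorant[OF assms(1)] by blast
  show ?thesis
  proof (rule Lim_null_comparison)
    show "\<forall>\<^sub>F z in at V within T. cmod (D z) \<le> 4 * (\<alpha> + \<beta> * Re z + \<gamma> * Im z)"
      unfolding eventually_at_filter
      by (rule always_eventually) (use D_bound_vertex[OF assms(1) refl L(2)] in auto)
    have "((\<lambda>z. 4 * (\<alpha> + \<beta> * Re z + \<gamma> * Im z)) \<longlongrightarrow> 4 * (\<alpha> + \<beta> * Re V + \<gamma> * Im V)) (at V within T)"
      by (intro tendsto_intros)
    then show "((\<lambda>z. 4 * (\<alpha> + \<beta> * Re z + \<gamma> * Im z)) \<longlongrightarrow> 0) (at V within T)" by (simp add: L)
  qed
qed

subsection \<open>The gradient on the boundary\<close>

lemma F_extension:
  obtains Fh where "continuous_on K Fh" "\<And>z. z \<in> T \<Longrightarrow> Fh z = F z"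
    "\<And>z. z \<in> K \<Longrightarrow> Re (Fh z) = U z + (cmod z)\<^sup>2 / 4"
proof -
  \<comment> \<open>A single vertex yields a global bound, as its affine majorant is bounded on
    \<open>K\<close>. The coordinates of the apex do not involve \<open>r\<close> and
    \<open>b\<close>.\<close>
  have V: "vertex \<i>" by (simp add: vertex_def lA_def lB_def)
  obtain \<alpha> \<beta> \<gamma> where L: "\<And>z. z \<in> K \<Longrightarrow> cmod (z - \<i>) \<le> \<alpha> + \<beta> * Re z + \<gamma> * Im z"
    using vertex_majorant[OF V] by blast
  define B where "B = 4 * (\<bar>\<alpha>\<bar> + \<bar>\<beta>\<bar> + \<bar>\<gamma>\<bar>) + 1"
  have B: "0 \<le> B" by (simp add: B_def)
  have bound: "cmod (deriv F z) \<le> B" if z: "z \<in> T" for z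
  proof -
    have zK: "z \<in> K" using z tri_subset_ctri by blast
    have "\<beta> * Re z \<le> \<bar>\<beta>\<bar> * 1" "\<gamma> * Im z \<le> \<bar>\<gamma>\<bar> * 1"
    proof -
      have "\<bar>\<beta> * Re z\<bar> \<le> \<bar>\<beta>\<bar> * 1" unfolding abs_mult using ctri_Re_le[OF zK] by (intro mult_left_mono) auto
      then show "\<beta> * Re z \<le> \<bar>\<beta>\<bar> * 1" by linarith
      have "\<bar>\<gamma> * Im z\<bar> \<le> \<bar>\<gamma>\<bar> * 1" unfolding abs_mult using ctri_Im_le[OF zK] zK
        by (intro mult_left_mono) (auto simp: ctri_def)
      then show "\<gamma> * Im z \<le> \<bar>\<gamma>\<bar> * 1" by linarith
    qed
    moreover have "cmod (D z) \<le> 4 * (\<alpha> + \<beta> * Re z + \<gamma> * Im z)"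
      by (rule D_bound_vertex[OF V refl _ z]) (rule L)
    ultimately have 1: "cmod (D z) \<le> 4 * (\<bar>\<alpha>\<bar> + \<bar>\<beta>\<bar> + \<bar>\<gamma>\<bar>)"
      using abs_ge_self[of \<alpha>] by argo
    have "cmod z \<le> \<bar>Re z\<bar> + \<bar>Im z\<bar>" by (rule cmod_le)
    then have 2: "cmod (cnj z / 2) \<le> 1"
      using ctri_Re_le[OF zK] ctri_Im_le[OF zK] zK by (simp add: norm_divide ctri_def)
    have "deriv F z = D z + cnj z / 2" by (simp add: D_def)
    then have "cmod (deriv F z) \<le> cmod (D z) + cmod (cnj z / 2)" by (metis norm_triangle_ineq)
    then show ?thesis using 1 2 by (simp add: B_def)
  qed
  have "B-lipschitz_on T F"
  proof (rule lipschitz_onI[OF _ B])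
    fix x y assume xy: "x \<in> T" "y \<in> T"
    have "cmod (F x - F y) \<le> B * cmod (x - y)"
      by (rule field_differentiable_bound[OF convex_tri _ bound xy])
        (auto intro: has_field_derivative_at_within F_deriv)
    then show "dist (F x) (F y) \<le> B * dist x y" by (simp add: dist_norm)
  qed
  from lipschitz_on_uniformly_continuous[OF this]
  obtain Fh where Fh: "uniformly_continuous_on (closure T) Fh" "\<And>z. z \<in> T \<Longrightarrow> F z = Fh z"
    using uniformly_continuous_on_extension_on_closure by metis
  then have cont: "continuous_on K Fh" using uniformly_continuous_imp_continuous closure_tri by metis
  show ?thesis
  proof (rule that[OF cont])
    fix z assume z: "z \<in> K"
    have "Re (Fh z) - U z - (cmod z)\<^sup>2 / 4 = 0"
    proof (rule continuous_constant_on_closure[where S = T])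
      show "continuous_on (closure T) (\<lambda>z. Re (Fh z) - U z - (cmod z)\<^sup>2 / 4)"
        unfolding closure_tri by (intro continuous_intros cont U_cont) auto
    qed (use z closure_tri Fh(2) U_eq in auto)
    then show "Re (Fh z) = U z + (cmod z)\<^sup>2 / 4" by simp
  qed (use Fh in auto)
qed

text \<open>\<open>p\<close> lies on an open side of the triangle whose inner normal is \<open>\<i> e\<close>.\<close>

definition "side p e \<longleftrightarrow> cmod e = 1 \<and> (\<exists>R>0. \<forall>\<zeta>\<in>ball 0 R. (0 < Im \<zeta> \<longrightarrow> p + e * \<zeta> \<in> T)
    \<and> (Im \<zeta> = 0 \<longrightarrow> p + e * \<zeta> \<in> K - T) \<and> (Im \<zeta> < 0 \<longrightarrow> p + e * \<zeta> \<notin> T))"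

text \<open>In the coordinate \<zeta> along the side, \<open>U + (Im \<zeta>)\<^sup>2 / 2\<close> is
  harmonic and, unlike \<open>U + |z|\<^sup>2 / 4\<close>, vanishes on the real axis. Hence it
  continues oddly across the side.\<close>

lemma side_reflection:
  assumes e: "cmod e = 1"
    and up: "\<And>\<zeta>. \<zeta> \<in> ball 0 R \<Longrightarrow> 0 < Im \<zeta> \<Longrightarrow> p + e * \<zeta> \<in> T"
    and mid: "\<And>\<zeta>. \<zeta> \<in> ball 0 R \<Longrightarrow> Im \<zeta> = 0 \<Longrightarrow> p + e * \<zeta> \<in> K - T"
  shows "\<exists>G. G holomorphic_on ball 0 R
    \<and> (\<forall>\<zeta>\<in>ball 0 R. 0 \<le> Im \<zeta> \<longrightarrow> Re (G \<zeta>) = U (p + e * \<zeta>) + (Im \<zeta>)\<^sup>2 / 2)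
    \<and> (\<forall>\<zeta>\<in>ball 0 R. Re (G (cnj \<zeta>)) = - Re (G \<zeta>))
    \<and> (\<forall>\<zeta>\<in>ball 0 R. 0 < Im \<zeta> \<longrightarrow> D (p + e * \<zeta>) * e = deriv G \<zeta> + \<i> * Im \<zeta>)"
proof -
  obtain Fh where Fh: "continuous_on K Fh" "\<And>z. z \<in> T \<Longrightarrow> Fh z = F z"
    "\<And>z. z \<in> K \<Longrightarrow> Re (Fh z) = U z + (cmod z)\<^sup>2 / 4"
    using F_extension by metis
  \<comment> \<open>The holomorphic polynomial that converts one quadratic correction into the
    other: its real part is
    \<open>|p + e \<zeta>|\<^sup>2 / 4 - (Im \<zeta>)\<^sup>2 / 2\<close>.\<close>
  define Q where "Q = (\<lambda>\<zeta>. of_real ((cmod p)\<^sup>2 / 4) + cnj p * e * \<zeta> / 2 + \<zeta>\<^sup>2 / 4)"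
  have ee: "cnj e * e = 1" using complex_norm_square[of e] e by (simp add: mult.commute)
  then have ee': "Re e * Re e + Im e * Im e = 1" by (simp add: complex_eq_iff)
  have ReQ: "Re (Q \<zeta>) = (cmod (p + e * \<zeta>))\<^sup>2 / 4 - (Im \<zeta>)\<^sup>2 / 2" for \<zeta>
  proof -
    have "(cmod (p + e * \<zeta>))\<^sup>2 = (cmod p)\<^sup>2 + 2 * Re (cnj p * e * \<zeta>) + (cmod (e * \<zeta>))\<^sup>2"
      unfolding cmod_power2 by (simp add: power2_eq_square algebra_simps)
    also have "(cmod (e * \<zeta>))\<^sup>2 = (Re \<zeta>)\<^sup>2 + (Im \<zeta>)\<^sup>2" by (simp add: norm_mult e cmod_power2)
    finally have 1: "(cmod (p + e * \<zeta>))\<^sup>2 = (cmod p)\<^sup>2 + 2 * Re (cnj p * e * \<zeta>) + ((Re \<zeta>)\<^sup>2 + (Im \<zeta>)\<^sup>2)" .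
    have "Re (Q \<zeta>) = (cmod p)\<^sup>2 / 4 + Re (cnj p * e * \<zeta>) / 2 + ((Re \<zeta>)\<^sup>2 - (Im \<zeta>)\<^sup>2) / 4"
      unfolding Q_def plus_complex.sel Re_complex_of_real Re_divide_numeral by (simp add: power2_eq_square)
    then show ?thesis unfolding 1 by (simp add: field_simps)
  qed
  \<comment> \<open>The factor \<i> turns a real part that vanishes on the axis into real boundary
    values, as Schwarz reflection requires.\<close>
  define f where "f = (\<lambda>\<zeta>. \<i> * (Fh (p + e * \<zeta>) - Q \<zeta>))"
  have inK: "p + e * \<zeta> \<in> K" if "\<zeta> \<in> ball 0 R" "0 \<le> Im \<zeta>" for \<zeta>
    using that up[of \<zeta>] mid[of \<zeta>] tri_subset_ctri by (cases "Im \<zeta> = 0") auto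
  have Imf: "Im (f \<zeta>) = U (p + e * \<zeta>) + (Im \<zeta>)\<^sup>2 / 2" if "\<zeta> \<in> ball 0 R" "0 \<le> Im \<zeta>" for \<zeta>
    unfolding f_def using Fh(3)[OF inK[OF that]] ReQ[of \<zeta>] by simp
  define g where "g = (\<lambda>\<zeta>. if 0 \<le> Im \<zeta> then f \<zeta> else cnj (f (cnj \<zeta>)))"
  have "g holomorphic_on ball 0 R"
    unfolding g_def
  proof (rule Schwarz_reflection)
    have "(\<lambda>\<zeta>. F (p + e * \<zeta>)) holomorphic_on ball 0 R \<inter> {\<zeta>. 0 < Im \<zeta>}"
      using holomorphic_on_compose_gen[of "\<lambda>\<zeta>. p + e * \<zeta>" "ball 0 R \<inter> {\<zeta>. 0 < Im \<zeta>}" F T] up F_hol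
      by (force intro!: holomorphic_intros simp: o_def)
    then have "(\<lambda>\<zeta>. \<i> * (F (p + e * \<zeta>) - Q \<zeta>)) holomorphic_on ball 0 R \<inter> {\<zeta>. 0 < Im \<zeta>}"
      unfolding Q_def by (intro holomorphic_intros) auto
    then show "f holomorphic_on ball 0 R \<inter> {\<zeta>. 0 < Im \<zeta>}"
      by (rule holomorphic_transform) (use up Fh(2) in \<open>auto simp: f_def\<close>)
    have "continuous_on (ball 0 R \<inter> {\<zeta>. 0 \<le> Im \<zeta>}) (\<lambda>\<zeta>. Fh (p + e * \<zeta>))"
      by (rule continuous_on_compose2[OF Fh(1)]) (use inK in \<open>auto intro!: continuous_intros\<close>)
    then show "continuous_on (ball 0 R \<inter> {\<zeta>. 0 \<le> Im \<zeta>}) f"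
      unfolding f_def Q_def by (intro continuous_intros) auto
    show "f \<zeta> \<in> \<real>" if "\<zeta> \<in> ball 0 R" "\<zeta> \<in> \<real>" for \<zeta>
    proof -
      have "Im \<zeta> = 0" using that(2) complex_is_Real_iff by blast
      then have "Im (f \<zeta>) = 0" using Imf[OF that(1)] U_bd mid[OF that(1)] by simp
      then show ?thesis using complex_is_Real_iff by blast
    qed
  qed auto
  then have hol: "(\<lambda>\<zeta>. - \<i> * g \<zeta>) holomorphic_on ball 0 R" by (intro holomorphic_intros)
  have ReG: "Re (- \<i> * g \<zeta>) = Im (g \<zeta>)" for \<zeta> by simp
  show ?thesis
  proof (intro exI[of _ "\<lambda>\<zeta>. - \<i> * g \<zeta>"] conjI ballI impI hol)
    fix \<zeta> :: complex assume z: "\<zeta> \<in> ball 0 R"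
    show "Re (- \<i> * g \<zeta>) = U (p + e * \<zeta>) + (Im \<zeta>)\<^sup>2 / 2" if "0 \<le> Im \<zeta>"
      using Imf[OF z that] that by (simp add: g_def)
  next
    fix \<zeta> :: complex assume z: "\<zeta> \<in> ball 0 R"
    have "Im (f \<zeta>) = 0" if "Im \<zeta> = 0"
      using Imf[OF z] that U_bd mid[OF z] by simp
    moreover have "cnj \<zeta> = \<zeta>" if "Im \<zeta> = 0" using that by (simp add: complex_eq_iff)
    ultimately show "Re (- \<i> * g (cnj \<zeta>)) = - Re (- \<i> * g \<zeta>)"
      unfolding ReG g_def by auto
  next
    fix \<zeta> :: complex assume z: "\<zeta> \<in> ball 0 R" and pos: "0 < Im \<zeta>"
    have zT: "p + e * \<zeta> \<in> T" by (rule up[OF z pos])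
    have "((\<lambda>\<zeta>. F (p + e * \<zeta>) - Q \<zeta>) has_field_derivative deriv F (p + e * \<zeta>) * e - (cnj p * e / 2 + \<zeta> / 2)) (at \<zeta>)"
    proof (rule DERIV_diff)
      show "((\<lambda>\<zeta>. F (p + e * \<zeta>)) has_field_derivative deriv F (p + e * \<zeta>) * e) (at \<zeta>)"
        by (rule DERIV_chain2[where f = F and g = "\<lambda>\<zeta>. p + e * \<zeta>"])
          (use F_deriv[OF zT] in \<open>auto intro!: derivative_eq_intros\<close>)
      show "(Q has_field_derivative cnj p * e / 2 + \<zeta> / 2) (at \<zeta>)"
        unfolding Q_def by (auto intro!: derivative_eq_intros)
    qed
    moreover have "\<forall>\<^sub>F \<xi> in nhds \<zeta>. - \<i> * g \<xi> = F (p + e * \<xi>) - Q \<xi>"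
    proof -
      have "open (ball 0 R \<inter> {\<zeta>. 0 < Im \<zeta>})"
        by (intro open_Int open_ball open_Collect_less continuous_intros)
      then have "\<forall>\<^sub>F \<xi> in nhds \<zeta>. \<xi> \<in> ball 0 R \<inter> {\<zeta>. 0 < Im \<zeta>}"
        by (rule eventually_nhds_in_open) (use z pos in auto)
      then show ?thesis
        by (rule eventually_mono) (use Fh(2) up in \<open>auto simp: g_def f_def\<close>)
    qed
    ultimately have "((\<lambda>\<zeta>. - \<i> * g \<zeta>) has_field_derivative deriv F (p + e * \<zeta>) * e - (cnj p * e / 2 + \<zeta> / 2)) (at \<zeta>)"
      by (subst DERIV_cong_ev[OF refl _ refl]) auto
    then have a: "deriv (\<lambda>\<zeta>. - \<i> * g \<zeta>) \<zeta> = deriv F (p + e * \<zeta>) * e - (cnj p * e / 2 + \<zeta> / 2)"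
      by (rule DERIV_imp_deriv)
    have b: "D (p + e * \<zeta>) * e = deriv F (p + e * \<zeta>) * e - cnj p * e / 2 - cnj \<zeta> / 2"
    proof -
      have "cnj (p + e * \<zeta>) * e = cnj p * e + (cnj e * e) * cnj \<zeta>" by (simp add: algebra_simps)
      then have "cnj (p + e * \<zeta>) * e = cnj p * e + cnj \<zeta>" by (simp only: ee mult_1)
      then show ?thesis by (simp add: D_def field_simps)
    qed
    have c: "\<i> * Im \<zeta> = \<zeta> / 2 - cnj \<zeta> / 2" by (simp add: complex_eq_iff)
    show "D (p + e * \<zeta>) * e = deriv (\<lambda>\<zeta>. - \<i> * g \<zeta>) \<zeta> + \<i> * Im \<zeta>"
      unfolding a b c by simp
  qed
qed

text \<open>\<open>Re G\<close> vanishes on a real interval, so \<open>deriv G 0\<close> is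
  imaginary and the limiting gradient is normal to the side. Its length is also the limit of
  difference quotients of \<open>U\<close> along the inner normal; through these, gradients at
  different boundary points can be compared by comparing values of \<open>U\<close>.\<close>

lemma side_gradient:
  assumes "side p e"
  obtains N where "0 \<le> N" "(D \<longlongrightarrow> - \<i> * of_real N * cnj e) (at p within T)"
    "((\<lambda>\<tau>. U (p + of_real \<tau> * (\<i> * e)) / \<tau>) \<longlongrightarrow> N) (at_right 0)"
proof -
  obtain R where e: "cmod e = 1" and R: "R > 0" and
    nb: "\<And>\<zeta>. \<zeta> \<in> ball 0 R \<Longrightarrow> 0 < Im \<zeta> \<Longrightarrow> p + e * \<zeta> \<in> T"
      "\<And>\<zeta>. \<zeta> \<in> ball 0 R \<Longrightarrow> Im \<zeta> = 0 \<Longrightarrow> p + e * \<zeta> \<in> K - T"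
      "\<And>\<zeta>. \<zeta> \<in> ball 0 R \<Longrightarrow> Im \<zeta> < 0 \<Longrightarrow> p + e * \<zeta> \<notin> T"
    using assms unfolding side_def by blast
  have "\<exists>G. G holomorphic_on ball 0 R
    \<and> (\<forall>\<zeta>\<in>ball 0 R. 0 \<le> Im \<zeta> \<longrightarrow> Re (G \<zeta>) = U (p + e * \<zeta>) + (Im \<zeta>)\<^sup>2 / 2)
    \<and> (\<forall>\<zeta>\<in>ball 0 R. Re (G (cnj \<zeta>)) = - Re (G \<zeta>))
    \<and> (\<forall>\<zeta>\<in>ball 0 R. 0 < Im \<zeta> \<longrightarrow> D (p + e * \<zeta>) * e = deriv G \<zeta> + \<i> * Im \<zeta>)"
    by (rule side_reflection[OF e]) (use nb in auto)
  then obtain G where G: "G holomorphic_on ball 0 R"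
    "\<And>\<zeta>. \<zeta> \<in> ball 0 R \<Longrightarrow> 0 \<le> Im \<zeta> \<Longrightarrow> Re (G \<zeta>) = U (p + e * \<zeta>) + (Im \<zeta>)\<^sup>2 / 2"
    "\<And>\<zeta>. \<zeta> \<in> ball 0 R \<Longrightarrow> Re (G (cnj \<zeta>)) = - Re (G \<zeta>)"
    "\<And>\<zeta>. \<zeta> \<in> ball 0 R \<Longrightarrow> 0 < Im \<zeta> \<Longrightarrow> D (p + e * \<zeta>) * e = deriv G \<zeta> + \<i> * Im \<zeta>"
    by blast
  have ee: "e * cnj e = 1" using complex_norm_square[of e] e by simp
  have zero: "0 \<in> ball (0::complex) R" using R by simp
  have dG: "(G has_field_derivative deriv G 0) (at 0)"
    using G(1) zero holomorphic_derivI open_ball by blast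
  have Gs: "Re (G (of_real s)) = 0" if "\<bar>s\<bar> < R" for s
  proof -
    have "of_real s \<in> ball (0::complex) R" using that by simp
    from G(3)[OF this] show ?thesis by simp
  qed
  have "((\<lambda>s. Re (G (0 + of_real s * 1))) has_real_derivative Re (deriv G 0 * 1)) (at 0)"
    by (rule has_real_derivative_Re_line) (use dG in simp)
  moreover have "((\<lambda>s. Re (G (0 + of_real s * 1))) has_real_derivative 0) (at 0)"
  proof (subst DERIV_cong_ev[OF refl _ refl])
    have "\<forall>\<^sub>F s in nhds (0::real). s \<in> ball 0 R"
      by (rule eventually_nhds_in_open) (use R in auto)
    then show "\<forall>\<^sub>F s in nhds 0. Re (G (0 + of_real s * 1)) = 0"
      by (rule eventually_mono) (use Gs in auto)
  qed auto
  ultimately have ReG0: "Re (deriv G 0) = 0" using DERIV_unique by fastforce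
  define N where "N = - Im (deriv G 0)"
  have G0: "deriv G 0 = - \<i> * of_real N" using ReG0 by (simp add: N_def complex_eq_iff)
  have lim: "((\<lambda>\<tau>. U (p + of_real \<tau> * (\<i> * e)) / \<tau>) \<longlongrightarrow> N) (at_right 0)"
  proof -
    have "((\<lambda>s. Re (G (0 + of_real s * \<i>))) has_real_derivative Re (deriv G 0 * \<i>)) (at 0)"
      by (rule has_real_derivative_Re_line) (use dG in simp)
    then have "((\<lambda>s. (Re (G (of_real s * \<i>)) - Re (G 0)) / s) \<longlongrightarrow> N) (at 0)"
      by (simp add: DERIV_def N_def)
    then have "((\<lambda>s. Re (G (of_real s * \<i>)) / s) \<longlongrightarrow> N) (at_right 0)"
      using Gs[of 0] R by (simp add: filterlim_at_split)
    moreover have "((\<lambda>s. s / 2) \<longlongrightarrow> 0 / 2) (at_right (0::real))" by (intro tendsto_intros) simp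
    ultimately have "((\<lambda>s. Re (G (of_real s * \<i>)) / s - s / 2) \<longlongrightarrow> N - 0 / 2) (at_right 0)"
      by (rule tendsto_diff)
    moreover have "\<forall>\<^sub>F s in at_right 0. Re (G (of_real s * \<i>)) / s - s / 2 = U (p + of_real s * (\<i> * e)) / s"
      using eventually_at_right_real[OF R]
    proof eventually_elim
      case (elim s)
      then have "of_real s * \<i> \<in> ball 0 R" "0 \<le> Im (of_real s * \<i>)" by (auto simp: norm_mult)
      from G(2)[OF this] show ?case using elim by (simp add: field_simps power2_eq_square)
    qed
    ultimately show ?thesis by (simp cong: filterlim_cong)
  qed
  have "0 \<le> N"
  proof (rule tendsto_lowerbound[OF lim _ trivial_limit_at_right_real])
    show "\<forall>\<^sub>F \<tau> in at_right 0. 0 \<le> U (p + of_real \<tau> * (\<i> * e)) / \<tau>"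
      using eventually_at_right_real[OF R]
    proof eventually_elim
      case (elim s)
      then have "p + e * (of_real s * \<i>) \<in> T" by (intro nb(1)) (auto simp: norm_mult)
      then have "0 < U (p + of_real s * (\<i> * e))" using U_pos by (simp add: mult_ac)
      then show ?case using elim by simp
    qed
  qed
  moreover have "(D \<longlongrightarrow> - \<i> * of_real N * cnj e) (at p within T)"
  proof -
    have pe: "z = p + e * (cnj e * (z - p))" for z
    proof -
      have "e * (cnj e * (z - p)) = (e * cnj e) * (z - p)" by simp
      then show ?thesis by (simp only: ee) simp
    qed
    have dcont: "continuous_on (ball 0 R) (deriv G)"
      using holomorphic_deriv[OF G(1) open_ball] holomorphic_on_imp_continuous_on by blast
    have arg: "((\<lambda>z. cnj e * (z - p)) \<longlongrightarrow> cnj e * (p - p)) (at p within T)" by (intro tendsto_intros)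
    then have arg0: "((\<lambda>z. cnj e * (z - p)) \<longlongrightarrow> 0) (at p within T)" by simp
    have "isCont (deriv G) 0" using dcont zero continuous_on_eq_continuous_at by blast
    from isCont_tendsto_compose[OF this arg0]
    have "((\<lambda>z. deriv G (cnj e * (z - p))) \<longlongrightarrow> deriv G 0) (at p within T)" .
    then have "((\<lambda>z. (deriv G (cnj e * (z - p)) + \<i> * of_real (Im (cnj e * (z - p)))) * cnj e)
        \<longlongrightarrow> (deriv G 0 + \<i> * of_real (Im 0)) * cnj e) (at p within T)"
      using arg0 by (intro tendsto_intros)
    moreover have "\<forall>\<^sub>F z in at p within T. (deriv G (cnj e * (z - p)) + \<i> * of_real (Im (cnj e * (z - p)))) * cnj e = D z"
    proof -
      have "\<forall>\<^sub>F z in at p within T. cnj e * (z - p) \<in> ball 0 R"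
        by (rule topological_tendstoD[OF arg0]) (use R in auto)
      moreover have "\<forall>\<^sub>F z in at p within T. z \<in> T" by (simp add: eventually_at_filter)
      ultimately show ?thesis
      proof eventually_elim
        case (elim z)
        \<comment> \<open>Near \<open>p\<close> the triangle is exactly the half disc
          \<open>Im \<zeta> > 0\<close>.\<close>
        have "0 < Im (cnj e * (z - p))"
          using nb(2,3)[OF elim(1)] elim(2) pe[of z] by (metis DiffE not_less_iff_gr_or_eq)
        from G(4)[OF elim(1) this] have "D z * e = deriv G (cnj e * (z - p)) + \<i> * of_real (Im (cnj e * (z - p)))"
          using pe[of z] by simp
        then have "(deriv G (cnj e * (z - p)) + \<i> * of_real (Im (cnj e * (z - p)))) * cnj e = D z * (e * cnj e)"
          by (simp add: mult.assoc)
        then show ?case by (simp only: ee mult_1_right)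
      qed
    qed
    ultimately show ?thesis unfolding G0 using Lim_transform_eventually by fastforce
  qed
  ultimately show ?thesis using that lim by blast
qed

lemma side_bottom:
  assumes "Im p = 0" "0 < lA r p" "0 < lB b p"
  shows "side p 1"
  unfolding side_def
proof (intro conjI exI ballI)
  show "0 < min (lA r p) (lB b p) / 2" using assms by simp
  fix \<zeta> :: complex assume "\<zeta> \<in> ball 0 (min (lA r p) (lB b p) / 2)"
  then have "2 * cmod \<zeta> < lA r p" "2 * cmod \<zeta> < lB b p" by auto
  then have "0 < lA r (p + 1 * \<zeta>)" "0 < lB b (p + 1 * \<zeta>)" "Im (p + 1 * \<zeta>) = Im \<zeta>"
    using lipschitz_lA[of "p + \<zeta>" p] lipschitz_lB[of "p + \<zeta>" p] assms by auto
  then show "0 < Im \<zeta> \<longrightarrow> p + 1 * \<zeta> \<in> T" "Im \<zeta> = 0 \<longrightarrow> p + 1 * \<zeta> \<in> K - T" "Im \<zeta> < 0 \<longrightarrow> p + 1 * \<zeta> \<notin> T"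
    unfolding tri_def ctri_def by auto
qed simp

text \<open>\<open>eA\<close> and \<open>eB\<close> are unit tangents of the left and right sides,
  oriented such that multiplication by \<i> gives the inner normal. \<rho> is the length of the
  gradient of \<open>lB\<close>; for \<open>lA\<close> that length is 2.\<close>

definition "eA = Complex (- 1 / 2) (- r / 2)"
definition "\<rho> = sqrt (1 + b * b)"
definition "eB = Complex (- 1 / \<rho>) (b / \<rho>)"

lemma rho: "\<rho> * \<rho> = 1 + b * b" "1 < \<rho>"
  using b_ge by (auto simp: \<rho>_def)

lemma norm_eA: "cmod eA = 1"
  using r_sq by (simp add: eA_def complex_norm power2_eq_square field_simps)

lemma norm_eB: "cmod eB = 1"
proof -
  have "0 < 1 + b * b" by (simp add: add_pos_nonneg)
  then have "(1 + b * b) / (\<rho> * \<rho>) = 1" unfolding rho(1) by simp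
  then show ?thesis by (simp add: eB_def complex_norm power2_eq_square add_divide_distrib)
qed

lemma side_left:
  assumes "lA r p = 0" "0 < Im p" "0 < lB b p"
  shows "side p eA"
  unfolding side_def
proof (intro conjI exI ballI)
  show "0 < min (Im p) (lB b p) / 2" using assms by simp
  fix \<zeta> :: complex assume z: "\<zeta> \<in> ball 0 (min (Im p) (lB b p) / 2)"
  then have "2 * cmod (p + eA * \<zeta> - p) < Im p" "2 * cmod (p + eA * \<zeta> - p) < lB b p" by (auto simp: norm_mult norm_eA)
  then have "0 < Im (p + eA * \<zeta>)" "0 < lB b (p + eA * \<zeta>)"
    using lipschitz_Im[of "p + eA * \<zeta>" p] lipschitz_lB[of "p + eA * \<zeta>" p] assms by auto
  moreover have "lA r (p + eA * \<zeta>) = lA r p + 2 * Im \<zeta>"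
    using r_sq by (simp add: lA_def eA_def field_simps)
  ultimately show "0 < Im \<zeta> \<longrightarrow> p + eA * \<zeta> \<in> T" "Im \<zeta> = 0 \<longrightarrow> p + eA * \<zeta> \<in> K - T" "Im \<zeta> < 0 \<longrightarrow> p + eA * \<zeta> \<notin> T"
    unfolding tri_def ctri_def using assms by auto
qed (rule norm_eA)

lemma side_right:
  assumes "lB b p = 0" "0 < Im p" "0 < lA r p"
  shows "side p eB"
  unfolding side_def
proof (intro conjI exI ballI)
  show "0 < min (Im p) (lA r p) / 2" using assms by simp
  fix \<zeta> :: complex assume z: "\<zeta> \<in> ball 0 (min (Im p) (lA r p) / 2)"
  then have "2 * cmod (p + eB * \<zeta> - p) < Im p" "2 * cmod (p + eB * \<zeta> - p) < lA r p" by (auto simp: norm_mult norm_eB)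
  then have "0 < Im (p + eB * \<zeta>)" "0 < lA r (p + eB * \<zeta>)"
    using lipschitz_Im[of "p + eB * \<zeta>" p] lipschitz_lA[of "p + eB * \<zeta>" p] assms by auto
  moreover have "lB b (p + eB * \<zeta>) = lB b p + (1 + b * b) / \<rho> * Im \<zeta>"
    using rho(2) by (simp add: lB_def eB_def field_simps)
  then have "lB b (p + eB * \<zeta>) = \<rho> * Im \<zeta>"
    unfolding rho(1)[symmetric] using rho(2) assms(1) by simp
  ultimately show "0 < Im \<zeta> \<longrightarrow> p + eB * \<zeta> \<in> T" "Im \<zeta> = 0 \<longrightarrow> p + eB * \<zeta> \<in> K - T" "Im \<zeta> < 0 \<longrightarrow> p + eB * \<zeta> \<notin> T"
    unfolding tri_def ctri_def using assms rho(2) by (auto simp: zero_less_mult_iff)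
qed (rule norm_eB)

lemma boundary_cases:
  assumes "p \<in> K" "p \<notin> T"
  obtains "vertex p" | "Im p = 0" "0 < lA r p" "0 < lB b p" | "lA r p = 0" "0 < Im p" "0 < lB b p"
    | "lB b p = 0" "0 < Im p" "0 < lA r p"
  using assms by (auto simp: ctri_def tri_def vertex_def less_le)

section \<open>The gradient on the closed triangle\<close>

definition "Dh p = Lim (at p within T) D"

lemma Dh_eqI: "p \<in> K \<Longrightarrow> (D \<longlongrightarrow> d) (at p within T) \<Longrightarrow> Dh p = d"
  unfolding Dh_def by (intro tendsto_Lim at_within_tri_nontrivial)

lemma D_tendsto_Dh: "p \<in> K \<Longrightarrow> (D \<longlongrightarrow> Dh p) (at p within T)"
proof -
  assume p: "p \<in> K"
  have "\<exists>d. (D \<longlongrightarrow> d) (at p within T)"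
  proof (cases "p \<in> T")
    case True
    then show ?thesis using continuous_on_D by (auto simp: continuous_on_def)
  next
    case False
    show ?thesis
      by (rule boundary_cases[OF p False])
        (use D_tendsto_vertex p side_gradient side_bottom side_left side_right in metis)+
  qed
  then show ?thesis using Dh_eqI[OF p] by auto
qed

lemma Dh_eq_D: "p \<in> T \<Longrightarrow> Dh p = D p"
  using continuous_on_D tri_subset_ctri by (intro Dh_eqI) (auto simp: continuous_on_def)

lemma Dh_vertex: "vertex p \<Longrightarrow> p \<in> K \<Longrightarrow> Dh p = 0"
  by (intro Dh_eqI D_tendsto_vertex)

lemma continuous_on_Dh: "continuous_on K Dh"
  by (rule continuous_on_limit_extension[OF D_tendsto_Dh at_within_tri_nontrivial])

lemma side_in_ctri:
  assumes "side p e"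
  shows "p \<in> K" "p \<notin> T"
proof -
  obtain R where "R > 0" "\<And>\<zeta>. \<zeta> \<in> ball 0 R \<Longrightarrow> Im \<zeta> = 0 \<Longrightarrow> p + e * \<zeta> \<in> K - T"
    using assms unfolding side_def by blast
  from this(2)[of 0] this(1) show "p \<in> K" "p \<notin> T" by auto
qed

lemma Dh_side:
  assumes "side p e"
  shows "Dh p = - \<i> * of_real (cmod (Dh p)) * cnj e"
    "((\<lambda>\<tau>. U (p + of_real \<tau> * (\<i> * e)) / \<tau>) \<longlongrightarrow> cmod (Dh p)) (at_right 0)"
proof -
  obtain N where N: "0 \<le> N" "(D \<longlongrightarrow> - \<i> * of_real N * cnj e) (at p within T)"
    "((\<lambda>\<tau>. U (p + of_real \<tau> * (\<i> * e)) / \<tau>) \<longlongrightarrow> N) (at_right 0)"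
    using side_gradient[OF assms] by blast
  have D: "Dh p = - \<i> * of_real N * cnj e"
    by (rule Dh_eqI[OF side_in_ctri(1)[OF assms] N(2)])
  have "cmod e = 1" using assms by (simp add: side_def)
  then have "cmod (Dh p) = N" using N(1) by (simp add: D norm_mult)
  then show "Dh p = - \<i> * of_real (cmod (Dh p)) * cnj e"
    "((\<lambda>\<tau>. U (p + of_real \<tau> * (\<i> * e)) / \<tau>) \<longlongrightarrow> cmod (Dh p)) (at_right 0)"
    using D N(3) by simp_all
qed

subsection \<open>Reflections and the location of the maximum\<close>

text \<open>The moving plane argument: the part of \<open>T\<close> on the side \<open>m < 0\<close> of the mirror is reflected into \<open>T\<close>.\<close>

context
  fixes c e :: complex and \<alpha> \<beta> \<gamma> :: real and \<sigma> :: "complex \<Rightarrow> complex" and m :: "complex \<Rightarrow> real"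
  assumes e: "cmod e = 1" and \<sigma>: "\<And>z. \<sigma> z = c + e * cnj z"
    and m: "\<And>z. m z = \<alpha> + \<beta> * Re z + \<gamma> * Im z"
    and mirror: "\<And>z. m z = 0 \<Longrightarrow> \<sigma> z = z"
    and bd: "\<And>z. z \<in> K \<Longrightarrow> z \<notin> T \<Longrightarrow> 0 \<le> m z \<Longrightarrow> \<sigma> z \<in> K \<Longrightarrow> \<sigma> z \<notin> T"
begin

definition "RS = {z \<in> T. 0 < m z \<and> \<sigma> z \<in> T}"
definition "RK = {z \<in> K. 0 \<le> m z \<and> \<sigma> z \<in> K}"
text \<open>Holomorphic with real part \<open>U \<circ> \<sigma> - U\<close>: as \<sigma> is an
  isometry, \<open>|\<sigma> z|\<^sup>2 - |z|\<^sup>2\<close> is affine in \<open>z\<close>.\<close>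

definition "RG = (\<lambda>z. cnj (F (\<sigma> z)) - F z - of_real ((cmod c)\<^sup>2 / 4) - c * cnj e * z / 2)"

lemma continuous_reflection: "continuous_on A \<sigma>" "continuous_on A m"
  unfolding \<sigma> m by (intro continuous_intros)+

lemma RS_eq: "RS = T \<inter> {z. 0 < m z} \<inter> \<sigma> -` T" and RK_eq: "RK = K \<inter> {z. 0 \<le> m z} \<inter> \<sigma> -` K"
  by (auto simp: RS_def RK_def)

lemma open_RS: "open RS"
  unfolding RS_eq
  by (intro open_Int open_tri open_Collect_less continuous_reflection continuous_intros open_vimage)

lemma compact_RK: "compact RK"
proof -
  have "closed ({z. 0 \<le> m z} \<inter> \<sigma> -` K)"
    by (intro closed_Int closed_Collect_le continuous_reflection continuous_intros closed_vimage closed_ctri)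
  then show ?thesis unfolding RK_eq Int_assoc by (rule compact_Int_closed[OF compact_ctri])
qed

lemma RS_subset_RK: "RS \<subseteq> RK"
  using tri_subset_ctri by (auto simp: RS_def RK_def)

lemma convex_RS: "convex RS"
  unfolding convex_def
proof (intro ballI allI impI)
  fix z w and u v :: real assume zw: "z \<in> RS" "w \<in> RS" and uv: "0 \<le> u" "0 \<le> v" "u + v = 1"
  have u: "u = 1 - v" using uv by simp
  have "u *\<^sub>R z + v *\<^sub>R w \<in> T" using zw uv convexD[OF convex_tri] by (auto simp: RS_def)
  moreover have "\<sigma> (u *\<^sub>R z + v *\<^sub>R w) = u *\<^sub>R \<sigma> z + v *\<^sub>R \<sigma> w"
    unfolding \<sigma> u by (simp add: scaleR_conv_of_real algebra_simps)
  then have "\<sigma> (u *\<^sub>R z + v *\<^sub>R w) \<in> T" using zw uv convexD[OF convex_tri] by (auto simp: RS_def)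
  moreover have "m (u *\<^sub>R z + v *\<^sub>R w) = u * m z + v * m w"
    unfolding m u by (simp add: algebra_simps)
  moreover have "0 < u * m z + v * m w"
    using zw uv by (cases "u = 0") (auto simp: RS_def intro: add_pos_nonneg)
  ultimately show "u *\<^sub>R z + v *\<^sub>R w \<in> RS" by (simp add: RS_def)
qed

lemma RG_holomorphic: "RG holomorphic_on RS"
proof -
  have "(\<lambda>w. F (c + e * w)) holomorphic_on cnj ` RS"
    by (rule holomorphic_on_compose_gen[of "\<lambda>w. c + e * w" _ F T, unfolded o_def, OF _ F_hol])
      (auto intro!: holomorphic_intros simp: RS_def \<sigma>)
  from holomorphic_on_compose_cnj_cnj[OF this open_RS]
  have "(\<lambda>z. cnj (F (\<sigma> z))) holomorphic_on RS" by (simp add: o_def \<sigma>)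
  moreover have "F holomorphic_on RS"
    by (rule holomorphic_on_subset[OF F_hol]) (auto simp: RS_def)
  ultimately show ?thesis unfolding RG_def by (intro holomorphic_intros) auto
qed

lemma RG_Re: "z \<in> RS \<Longrightarrow> U (\<sigma> z) - U z = Re (RG z)"
proof -
  assume z: "z \<in> RS"
  have "(cmod (\<sigma> z))\<^sup>2 = (cmod c)\<^sup>2 + (cmod (e * cnj z))\<^sup>2 + 2 * Re (c * cnj (e * cnj z))"
    unfolding \<sigma> cmod_power2 by (simp add: power2_eq_square algebra_simps)
  also have "cmod (e * cnj z) = cmod z" by (simp add: norm_mult e)
  finally have *: "(cmod (\<sigma> z))\<^sup>2 = (cmod c)\<^sup>2 + (cmod z)\<^sup>2 + 2 * Re (c * cnj e * z)" by (simp add: mult.assoc)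
  have "Re (RG z) = Re (F (\<sigma> z)) - Re (F z) - (cmod c)\<^sup>2 / 4 - Re (c * cnj e * z) / 2"
    unfolding RG_def minus_complex.sel Re_divide_numeral Re_complex_of_real by simp
  moreover have "U (\<sigma> z) - U z = Re (F (\<sigma> z)) - Re (F z) - ((cmod (\<sigma> z))\<^sup>2 - (cmod z)\<^sup>2) / 4"
    using z by (simp add: U_eq RS_def diff_divide_distrib)
  ultimately show ?thesis unfolding * by (simp add: field_simps)
qed

lemma continuous_on_RK: "continuous_on RK (\<lambda>z. U (\<sigma> z) - U z)"
proof -
  have "continuous_on RK (\<lambda>z. U (\<sigma> z))"
    by (rule continuous_on_compose2[OF U_cont continuous_reflection(1)]) (auto simp: RK_def)
  moreover have "continuous_on RK U" by (rule continuous_on_subset[OF U_cont]) (auto simp: RK_def)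
  ultimately show ?thesis by (intro continuous_intros)
qed

text \<open>Where \<open>RK\<close> exceeds \<open>RS\<close>, either \<open>z\<close> is on the
  mirror and both values agree, or the image of \<open>z\<close> is on the boundary of the triangle,
  where \<open>U\<close> vanishes. Assumption \<open>bd\<close> puts boundary points
  \<open>z\<close> into the second case.\<close>

lemma reflection_le: "z \<in> RK \<Longrightarrow> U (\<sigma> z) - U z \<le> 0"
proof (rule maximum_principle_Re[OF open_RS RS_subset_RK compact_RK continuous_on_RK RG_holomorphic RG_Re])
  fix z assume z: "z \<in> RK" "z \<notin> RS"
  then have zK: "z \<in> K" "0 \<le> m z" "\<sigma> z \<in> K" by (auto simp: RK_def)
  show "U (\<sigma> z) - U z \<le> 0"
  proof (cases "m z = 0")
    case True
    then show ?thesis using mirror by simp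
  next
    case False
    then have "\<sigma> z \<notin> T" using z zK bd by (auto simp: RS_def)
    then show ?thesis using U_bd[OF zK(3)] U_nonneg[OF zK(1)] by simp
  qed
qed auto

text \<open>A reflection reverses orientation: the tangent \<open>e0\<close> is mapped to
  \<open>e * cnj e0\<close>, and the minus sign restores the convention that \<i> times the tangent
  points inwards.\<close>

lemma reflection_side:
  "\<sigma> (p + of_real \<tau> * (\<i> * e0)) = \<sigma> p + of_real \<tau> * (\<i> * (- (e * cnj e0)))"
  by (simp add: \<sigma> algebra_simps)

text \<open>The inequality between values of \<open>U\<close> passes to the difference quotients
  along the normals at \<open>p\<close> and at its image, and so to the lengths of the
  gradients.\<close>

lemma reflection_weak:
  assumes p: "side p e0" and q: "side (\<sigma> p) (- (e * cnj e0))" and mp: "0 < m p"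
  shows "cmod (Dh (\<sigma> p)) \<le> cmod (Dh p)"
proof -
  obtain R1 where R1: "R1 > 0" "\<And>\<zeta>. \<zeta> \<in> ball 0 R1 \<Longrightarrow> 0 < Im \<zeta> \<Longrightarrow> p + e0 * \<zeta> \<in> T"
    using p unfolding side_def by blast
  obtain R2 where R2: "R2 > 0" "\<And>\<zeta>. \<zeta> \<in> ball 0 R2 \<Longrightarrow> 0 < Im \<zeta> \<Longrightarrow> \<sigma> p + (- (e * cnj e0)) * \<zeta> \<in> T"
    using q unfolding side_def by blast
  have "((\<lambda>\<tau>::real. m (p + of_real \<tau> * (\<i> * e0))) \<longlongrightarrow> m (p + of_real 0 * (\<i> * e0))) (at_right 0)"
    unfolding m by (intro tendsto_intros)
  then have "((\<lambda>\<tau>::real. m (p + of_real \<tau> * (\<i> * e0))) \<longlongrightarrow> m p) (at_right 0)" by simp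
  then have "\<forall>\<^sub>F \<tau> in at_right 0. 0 < m (p + of_real \<tau> * (\<i> * e0))"
    using mp order_tendstoD(1) by fast
  then have "\<forall>\<^sub>F \<tau> in at_right 0. U (\<sigma> p + of_real \<tau> * (\<i> * (- (e * cnj e0)))) / \<tau> \<le> U (p + of_real \<tau> * (\<i> * e0)) / \<tau>"
    using eventually_at_right_real[OF R1(1)] eventually_at_right_real[OF R2(1)]
  proof eventually_elim
    case (elim \<tau>)
    have 1: "p + of_real \<tau> * (\<i> * e0) \<in> T"
      using R1(2)[of "\<i> * of_real \<tau>"] elim by (simp add: norm_mult mult_ac)
    have "\<sigma> p + of_real \<tau> * (\<i> * (- (e * cnj e0))) \<in> T"
      using R2(2)[of "\<i> * of_real \<tau>"] elim by (simp add: norm_mult mult_ac)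
    then have 2: "\<sigma> (p + of_real \<tau> * (\<i> * e0)) \<in> T" by (simp only: reflection_side)
    have "p + of_real \<tau> * (\<i> * e0) \<in> RK" using 1 2 elim tri_subset_ctri by (auto simp: RK_def)
    from reflection_le[OF this] show ?case
      unfolding reflection_side using elim by (simp add: divide_right_mono)
  qed
  then show ?thesis
    by (rule tendsto_le[OF trivial_limit_at_right_real Dh_side(2)[OF p] Dh_side(2)[OF q]])
qed

text \<open>Equality at one point would spread over the connected set \<open>RS\<close> and by
  continuity to \<open>c0\<close>. But \<open>c0\<close> is interior while its image is on the
  boundary, so it witnesses that the triangle is not symmetric in the mirror.\<close>

lemma RS_strict:
  assumes inv: "\<And>z. \<sigma> (\<sigma> z) = z" and c0: "c0 \<in> T" "0 < m c0" "\<sigma> c0 \<in> K" "\<sigma> c0 \<notin> T" and z: "z \<in> RS"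
  shows "U (\<sigma> z) < U z"
proof (rule ccontr)
  assume "\<not> U (\<sigma> z) < U z"
  then have Re0: "Re (RG z) = 0"
    using reflection_le[of z] z RS_subset_RK RG_Re[OF z] by force
  have const: "U (\<sigma> w) - U w = 0" if w: "w \<in> RS" for w
    unfolding RG_Re[OF w] Re0[symmetric]
    by (rule strong_maximum_principle_Re[OF RG_holomorphic open_RS convex_connected[OF convex_RS] z _ w])
      (use Re0 RG_Re reflection_le RS_subset_RK in force)
  \<comment> \<open>Points of the triangle close to \<open>\<sigma> c0\<close> have their images in
    \<open>RS\<close> and close to \<open>c0\<close>.\<close>
  have "c0 \<in> closure RS"
    unfolding closure_approachable
  proof (intro allI impI)
    fix \<delta> :: real assume "0 < \<delta>"
    have "open (T \<inter> {z. 0 < m z})"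
      by (intro open_Int open_tri open_Collect_less continuous_reflection continuous_intros)
    then obtain d where d: "d > 0" "ball c0 d \<subseteq> T \<inter> {z. 0 < m z}"
      using c0 openE[of "T \<inter> {z. 0 < m z}" c0] by auto
    have "\<sigma> c0 \<in> closure T" using c0(3) closure_tri by simp
    then obtain w where w: "w \<in> T" "dist w (\<sigma> c0) < min \<delta> d"
      unfolding closure_approachable using \<open>0 < \<delta>\<close> d(1) by (metis min_less_iff_conj)
    have "dist (\<sigma> w) c0 = dist (\<sigma> w) (\<sigma> (\<sigma> c0))" by (simp add: inv)
    also have "\<dots> = cmod (e * cnj (w - \<sigma> c0))" unfolding dist_norm \<sigma>[of w] \<sigma>[of "\<sigma> c0"] by (simp add: algebra_simps)
    also have "\<dots> = dist w (\<sigma> c0)" by (simp only: norm_mult e complex_mod_cnj dist_norm mult_1)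
    finally have dist: "dist (\<sigma> w) c0 = dist w (\<sigma> c0)" .
    then have "\<sigma> w \<in> ball c0 d" using w(2) by (simp add: dist_commute)
    then have "\<sigma> w \<in> RS" using d(2) w(1) inv by (auto simp: RS_def)
    then show "\<exists>y\<in>RS. dist y c0 < \<delta>" using dist w(2) by (intro bexI[of _ "\<sigma> w"]) auto
  qed
  moreover have "continuous_on (closure RS) (\<lambda>z. U (\<sigma> z) - U z)"
    by (rule continuous_on_subset[OF continuous_on_RK])
      (rule closure_minimal[OF RS_subset_RK compact_imp_closed[OF compact_RK]])
  ultimately have "U (\<sigma> c0) - U c0 = 0"
    using continuous_constant_on_closure[where S = RS and f = "\<lambda>z. U (\<sigma> z) - U z"] const by blast
  then show False using U_bd[OF c0(3,4)] U_pos[OF c0(1)] by simp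
qed

text \<open>The Hopf lemma on a small rectangle above \<open>p\<close>:
  \<open>U - U \<circ> \<sigma>\<close> is nonnegative, positive on the top side, and thus grows at
  least linearly from the base, which separates the two normal derivatives by \<kappa>.\<close>

lemma reflection_strict:
  assumes p: "side p 1" and q: "side (\<sigma> p) (- e)" and mp: "0 < m p"
    and inv: "\<And>z. \<sigma> (\<sigma> z) = z" and c0: "c0 \<in> T" "0 < m c0" "\<sigma> c0 \<in> K" "\<sigma> c0 \<notin> T"
    and Im: "Im p = 0"
  shows "cmod (Dh (\<sigma> p)) < cmod (Dh p)"
proof -
  obtain R1 where R1: "R1 > 0" "\<And>\<zeta>. \<zeta> \<in> ball 0 R1 \<Longrightarrow> 0 < Im \<zeta> \<Longrightarrow> p + 1 * \<zeta> \<in> T"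
    "\<And>\<zeta>. \<zeta> \<in> ball 0 R1 \<Longrightarrow> Im \<zeta> = 0 \<Longrightarrow> p + 1 * \<zeta> \<in> K - T"
    using p unfolding side_def by blast
  obtain R2 where R2: "R2 > 0" "\<And>\<zeta>. \<zeta> \<in> ball 0 R2 \<Longrightarrow> 0 < Im \<zeta> \<Longrightarrow> \<sigma> p + (- e) * \<zeta> \<in> T"
    "\<And>\<zeta>. \<zeta> \<in> ball 0 R2 \<Longrightarrow> Im \<zeta> = 0 \<Longrightarrow> \<sigma> p + (- e) * \<zeta> \<in> K - T"
    using q unfolding side_def by blast
  have "open {z. 0 < m z}" by (intro open_Collect_less continuous_reflection continuous_intros)
  then obtain R3 where R3: "R3 > 0" "ball p R3 \<subseteq> {z. 0 < m z}"
    using mp openE[of "{z. 0 < m z}" p] by auto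
  have sig: "\<sigma> (p + \<zeta>) = \<sigma> p + (- e) * (- cnj \<zeta>)" for \<zeta> by (simp add: \<sigma> algebra_simps)
  have m_near: "0 < m (p + \<zeta>)" if "cmod \<zeta> < R3" for \<zeta>
    using subsetD[OF R3(2), of "p + \<zeta>"] that by (simp add: dist_norm)
  define R where "R = min R1 (min R2 R3)"
  have R: "R > 0" using R1 R2 R3 by (simp add: R_def)
  have inS: "p + \<zeta> \<in> RS" if "cmod \<zeta> < R" "0 < Im \<zeta>" for \<zeta>
    using R1(2)[of \<zeta>] R2(2)[of "- cnj \<zeta>"] m_near[of \<zeta>] that unfolding R_def RS_def mem_Collect_eq sig by simp
  have inK: "p + \<zeta> \<in> RK" if "cmod \<zeta> < R" "0 \<le> Im \<zeta>" for \<zeta>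
  proof (cases "Im \<zeta> = 0")
    case True
    then show ?thesis
      using R1(3)[of \<zeta>] R2(3)[of "- cnj \<zeta>"] m_near[of \<zeta>] that unfolding R_def RK_def mem_Collect_eq sig by simp
  next
    case False
    then show ?thesis using inS[OF that(1)] that(2) RS_subset_RK by auto
  qed
  define d where "d = R / 3"
  have d: "d > 0" using R by (simp add: d_def)
  have near: "z = p + (z - p)" "cmod (z - p) < R" "Im (z - p) = Im z"
    if "\<bar>Re z - Re p\<bar> \<le> d" "0 \<le> Im z" "Im z \<le> d" for z
  proof -
    have "cmod (z - p) \<le> \<bar>Re (z - p)\<bar> + \<bar>Im (z - p)\<bar>" by (rule cmod_le)
    then show "cmod (z - p) < R" using that Im d by (simp add: d_def)
  qed (use Im in auto)
  have "\<exists>\<kappa>>0. \<forall>y. 0 \<le> y \<longrightarrow> y \<le> d \<longrightarrow> \<kappa> * y \<le> U (Complex (Re p) y) - U (\<sigma> (Complex (Re p) y))"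
  proof (rule Hopf_lemma_rectangle[OF d, where G = "\<lambda>z. - RG z" and w = "\<lambda>z. U z - U (\<sigma> z)"])
    have "continuous_on RK (\<lambda>z. - (U (\<sigma> z) - U z))" by (intro continuous_on_minus continuous_on_RK)
    then have "continuous_on RK (\<lambda>z. U z - U (\<sigma> z))" by simp
    then show "continuous_on {z. \<bar>Re z - Re p\<bar> \<le> d \<and> 0 \<le> Im z \<and> Im z \<le> d} (\<lambda>z. U z - U (\<sigma> z))"
      by (rule continuous_on_subset) (use inK near in force)
    have sub: "{z. \<bar>Re z - Re p\<bar> < d \<and> 0 < Im z \<and> Im z < d} \<subseteq> RS"
    proof clarify
      fix z assume "\<bar>Re z - Re p\<bar> < d" "0 < Im z" "Im z < d"
      then show "z \<in> RS" using inS[of "z - p"] near[of z] by simp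
    qed
    show "(\<lambda>z. - RG z) holomorphic_on {z. \<bar>Re z - Re p\<bar> < d \<and> 0 < Im z \<and> Im z < d}"
      by (intro holomorphic_on_minus holomorphic_on_subset[OF RG_holomorphic sub])
    show "U z - U (\<sigma> z) = Re (- RG z)" if "z \<in> {z. \<bar>Re z - Re p\<bar> < d \<and> 0 < Im z \<and> Im z < d}" for z
      using RG_Re[of z] that sub by auto
    show "0 \<le> U z - U (\<sigma> z)" if "z \<in> {z. \<bar>Re z - Re p\<bar> \<le> d \<and> 0 \<le> Im z \<and> Im z \<le> d}" for z
      using reflection_le[of z] inK[of "z - p"] near[of z] that by auto
    show "0 < U z - U (\<sigma> z)" if "z \<in> {z. \<bar>Re z - Re p\<bar> \<le> d \<and> 0 \<le> Im z \<and> Im z \<le> d}" "Im z = d" for z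
    proof -
      have "z \<in> RS" using inS[of "z - p"] near[of z] that d by auto
      from RS_strict[OF inv c0 this] show ?thesis by simp
    qed
  qed
  then obtain \<kappa> where \<kappa>: "\<kappa> > 0" "\<And>y. 0 \<le> y \<Longrightarrow> y \<le> d \<Longrightarrow> \<kappa> * y \<le> U (Complex (Re p) y) - U (\<sigma> (Complex (Re p) y))"
    by blast
  have q': "side (\<sigma> p) (- (e * cnj 1))" using q by simp
  have "\<forall>\<^sub>F \<tau> in at_right 0. U (\<sigma> p + of_real \<tau> * (\<i> * (- (e * cnj 1)))) / \<tau> + \<kappa> \<le> U (p + of_real \<tau> * (\<i> * 1)) / \<tau>"
    using eventually_at_right_real[OF d]
  proof eventually_elim
    case (elim \<tau>)
    have "Complex (Re p) \<tau> = p + of_real \<tau> * (\<i> * 1)" using Im by (simp add: complex_eq_iff)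
    then have "\<kappa> * \<tau> \<le> U (p + of_real \<tau> * (\<i> * 1)) - U (\<sigma> p + of_real \<tau> * (\<i> * (- (e * cnj 1))))"
      using \<kappa>(2)[of \<tau>] elim reflection_side[of p \<tau> 1] by simp
    moreover have "A / \<tau> + \<kappa> \<le> B / \<tau>" if "\<kappa> * \<tau> \<le> B - A" for A B
    proof -
      have "(A + \<kappa> * \<tau>) / \<tau> \<le> B / \<tau>" using that elim by (intro divide_right_mono) auto
      then show ?thesis using elim by (simp add: add_divide_distrib)
    qed
    ultimately show ?case by blast
  qed
  then have "cmod (Dh (\<sigma> p)) + \<kappa> \<le> cmod (Dh p)"
    by (rule tendsto_le[OF trivial_limit_at_right_real Dh_side(2)[OF p] tendsto_add[OF Dh_side(2)[OF q'] tendsto_const]])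
  then show ?thesis using \<kappa>(1) by simp
qed

end

section \<open>Moving planes along the base and in the base angles\<close>

definition "g x = cmod (Dh (of_real x))"

lemma side_real:
  assumes "- 1 < r * x" "b * x < 1"
  shows "side (of_real x) 1"
  by (rule side_bottom) (use assms in \<open>auto simp: lA_def lB_def\<close>)

text \<open>The mirror is the vertical line halfway between \<open>x1\<close> and \<open>x2\<close>.
  It must not lie left of the midpoint of the base, at half of \<open>1/b - 1/r\<close>: then the
  image of the left side starts at or beyond \<open>1/b\<close> and ends to the right of the apex,
  hence lies outside the open triangle.\<close>

lemma g_antimono_right:
  assumes x: "1 / b - 1 / r \<le> x1 + x2" "x1 \<le> x2" "- 1 < r * x1" "b * x2 < 1"
  shows "g x2 \<le> g x1"
proof (cases "x1 = x2")
  case False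
  define s where "s = (x1 + x2) / 2"
  define \<sigma> where "\<sigma> = (\<lambda>z. of_real (2 * s) + (- 1) * cnj z)"
  have Re\<sigma>: "Re (\<sigma> z) = 2 * s - Re z" "Im (\<sigma> z) = Im z" for z by (auto simp: \<sigma>_def)
  have \<sigma>x: "\<sigma> (of_real x1) = of_real x2" by (simp add: complex_eq_iff Re\<sigma> s_def field_simps)
  have x1: "b * x1 \<le> b * x2" using b_ge x by simp
  have x2: "r * x1 \<le> r * x2" using r_pos x by simp
  have "cmod (Dh (\<sigma> (of_real x1))) \<le> cmod (Dh (of_real x1))"
  proof (rule reflection_weak[where e = "- 1" and \<sigma> = \<sigma> and c = "of_real (2 * s)" and m = "\<lambda>z. s - Re z"
      and \<alpha> = s and \<beta> = "- 1" and \<gamma> = 0])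
    fix z assume z: "z \<in> K" "z \<notin> T" "0 \<le> s - Re z" "\<sigma> z \<in> K"
    have "lB b (\<sigma> z) \<le> 0" if "lA r z = 0"
    proof -
      have z1: "1 - Im z = - (r * Re z)" using that by (simp add: lA_def)
      have "- (1 - Im z) / r \<le> Re z" "Im z \<ge> 0" using ctri_Re_bounds[OF z(1)] z(1) by (auto simp: ctri_def)
      have "- 1 \<le> r * Re z" using z1 \<open>Im z \<ge> 0\<close> by simp
      have "(r - b) * (- (1 / r)) \<le> (r - b) * Re z"
        using b_less r_pos \<open>- 1 \<le> r * Re z\<close> by (intro mult_left_mono) (auto simp: field_simps)
      moreover have "b * (1 / b - 1 / r) \<le> b * (2 * s)" using x b_ge by (intro mult_left_mono) (auto simp: s_def)
      moreover have "b * (1 / b - 1 / r) = (r - b) * (1 / r)" using b_ge r_pos by (simp add: field_simps)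
      moreover have "lB b (\<sigma> z) = - ((r - b) * Re z) - b * (2 * s)" using z1 by (simp add: lB_def Re\<sigma> algebra_simps)
      ultimately show ?thesis by linarith
    qed
    moreover have "lB b (\<sigma> z) \<le> 0" if "lB b z = 0"
    proof -
      have "lB b (\<sigma> z) = lB b z - 2 * (b * (s - Re z))" by (simp add: lB_def Re\<sigma> algebra_simps)
      moreover have "0 \<le> b * (s - Re z)" using z b_ge by simp
      ultimately show ?thesis using that by simp
    qed
    ultimately show "\<sigma> z \<notin> T" using ctri_diff_tri[OF z(1,2)] Re\<sigma> by (auto simp: tri_def)
  next
    show "side (of_real x1) 1" using x x1 by (intro side_real) auto
    show "side (\<sigma> (of_real x1)) (- (- 1 * cnj 1))" using side_real[of x2] x x2 by (simp add: \<sigma>x)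
  qed (use x False in \<open>auto simp: \<sigma>_def complex_eq_iff s_def\<close>)
  then show ?thesis by (simp add: g_def \<sigma>x)
qed auto

text \<open>Here the apex over 0 sets the limit: for a mirror not right of it, the image of the
  right side stays outside, since the right part of the base is longer than the left part.\<close>

lemma g_mono_left:
  assumes x: "x1 + x2 \<le> 0" "x1 \<le> x2" "- 1 < r * x1" "b * x2 < 1"
  shows "g x1 \<le> g x2"
proof (cases "x1 = x2")
  case False
  define s where "s = (x1 + x2) / 2"
  define \<sigma> where "\<sigma> = (\<lambda>z. of_real (2 * s) + (- 1) * cnj z)"
  have Re\<sigma>: "Re (\<sigma> z) = 2 * s - Re z" "Im (\<sigma> z) = Im z" for z by (auto simp: \<sigma>_def)
  have \<sigma>x: "\<sigma> (of_real x2) = of_real x1" by (simp add: complex_eq_iff Re\<sigma> s_def field_simps)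
  have x1: "b * x1 \<le> b * x2" using b_ge x by simp
  have x2: "r * x1 \<le> r * x2" using r_pos x by simp
  have s0: "r * s \<le> 0" using x r_pos by (simp add: s_def mult_le_0_iff)
  have "cmod (Dh (\<sigma> (of_real x2))) \<le> cmod (Dh (of_real x2))"
  proof (rule reflection_weak[where e = "- 1" and \<sigma> = \<sigma> and c = "of_real (2 * s)" and m = "\<lambda>z. Re z - s"
      and \<alpha> = "- s" and \<beta> = 1 and \<gamma> = 0])
    fix z assume z: "z \<in> K" "z \<notin> T" "0 \<le> Re z - s" "\<sigma> z \<in> K"
    have "lA r (\<sigma> z) \<le> 0" if "lB b z = 0"
    proof -
      have z1: "1 - Im z = b * Re z" using that by (simp add: lB_def)
      have "0 \<le> b * Re z" using ctri_Im_le[OF z(1)] z1 by simp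
      then have "0 \<le> Re z" using b_ge by (simp add: zero_le_mult_iff)
      then have "0 \<le> (r - b) * Re z" using b_less by simp
      moreover have "lA r (\<sigma> z) = 2 * (r * s) - (r - b) * Re z" using z1 by (simp add: lA_def Re\<sigma> algebra_simps)
      ultimately show ?thesis using s0 by linarith
    qed
    moreover have "lA r (\<sigma> z) \<le> 0" if "lA r z = 0"
    proof -
      have "lA r (\<sigma> z) = lA r z - 2 * (r * (Re z - s))" by (simp add: lA_def Re\<sigma> algebra_simps)
      moreover have "0 \<le> r * (Re z - s)" using z r_pos by simp
      ultimately show ?thesis using that by simp
    qed
    ultimately show "\<sigma> z \<notin> T" using ctri_diff_tri[OF z(1,2)] Re\<sigma> by (auto simp: tri_def)
  next
    show "side (of_real x2) 1" using x x2 by (intro side_real) auto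
    show "side (\<sigma> (of_real x2)) (- (- 1 * cnj 1))" using side_real[of x1] x x1 by (simp add: \<sigma>x)
  qed (use x False in \<open>auto simp: \<sigma>_def complex_eq_iff s_def\<close>)
  then show ?thesis by (simp add: g_def \<sigma>x)
qed auto

text \<open>The bisector at the left base vertex, where the angle is 60 degrees because its tangent
  is \<open>r\<close>. The base is longer than the left side, by \<open>b < r\<close>, so the open
  left side is mapped into the open base. Strictness excludes further maximum points on the left
  side.\<close>

lemma left_dominated:
  assumes q: "lA r q = 0" "0 < Im q" "0 < lB b q"
  obtains x where "- 1 < r * x" "b * x < 1" "cmod (Dh q) < g x"
proof -
  define \<sigma> where "\<sigma> = (\<lambda>z. of_real (- 1 / r) + Complex (1/2) (r/2) / of_real r + Complex (1/2) (r/2) * cnj z)"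
  \<comment> \<open>The difference of the distances from the left side and from the base; its zero
    set is the bisector.\<close>
  define m where "m = (\<lambda>z. lA r z / 2 - Im z)"
  have rr: "r * (r * y) = 3 * y" for y unfolding mult.assoc[symmetric] r_sq by simp
  have Re\<sigma>: "Re (\<sigma> z) = - 1 / (2 * r) + Re z / 2 + r * Im z / 2" "Im (\<sigma> z) = lA r z / 2" for z
    using r_pos by (auto simp: \<sigma>_def lA_def field_simps Re_divide_of_real Im_divide_of_real)
  have lA\<sigma>: "lA r (\<sigma> z) = 2 * Im z" for z
    unfolding lA_def[of r "\<sigma> z"] Re\<sigma> using r_pos by (simp add: lA_def field_simps rr)
  have lB\<sigma>: "lB b (\<sigma> z) = lB b z - (1 - b / r) * m z" for z
    unfolding lB_def[of b "\<sigma> z"] Re\<sigma> m_def using r_pos by (simp add: lA_def lB_def field_simps rr)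
  have m\<sigma>: "m (\<sigma> z) = - m z" for z by (simp add: m_def lA\<sigma> Re\<sigma>)
  have inv: "\<sigma> (\<sigma> z) = z" for z
    using r_pos by (auto simp: complex_eq_iff Re\<sigma> lA\<sigma> lA_def[of r z] field_simps rr)
  have br: "0 < 1 - b / r" using b_less r_pos by simp
  define p where "p = \<sigma> q"
  have pq: "\<sigma> p = q" by (simp add: p_def inv)
  have mq: "m q < 0" using q by (simp add: m_def)
  have Imp: "Im p = 0" using q by (simp add: p_def Re\<sigma>)
  have lAp: "0 < lA r p" using q by (simp add: p_def lA\<sigma>)
  have "(1 - b / r) * m q \<le> 0" using br mq by (intro mult_nonneg_nonpos) auto
  then have lBp: "0 < lB b p" using q by (simp add: p_def lB\<sigma>)
  \<comment> \<open>A point of the right side that is nearer to the left side than to the base. Its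
    mirror image is interior, which supplies the witness of asymmetry.\<close>
  define q0 where "q0 = Complex (1 / (4 * b)) (3 / 4)"
  have lq0: "lA r q0 = 1 / 4 + r / (4 * b)" "lB b q0 = 0" using b_ge by (auto simp: q0_def lA_def lB_def)
  have "r / (4 * b) \<le> 1/2" using b_ge r_bounds by (simp add: field_simps)
  then have mq0: "m q0 < 0" by (simp add: m_def lq0) (simp add: q0_def)
  have lq0': "0 < lA r q0" using b_ge r_pos by (simp add: lq0 add_pos_pos)
  have "cmod (Dh (\<sigma> p)) < cmod (Dh p)"
  proof (rule reflection_strict[where e = "Complex (1/2) (r/2)" and \<sigma> = \<sigma> and m = m and p = p and ?c0.0 = "\<sigma> q0"
      and c = "of_real (- 1 / r) + Complex (1/2) (r/2) / of_real r" and \<alpha> = "1/2" and \<beta> = "r / 2" and \<gamma> = "- 3 / 2"])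
    show "cmod (Complex (1/2) (r/2)) = 1"
      using r_sq by (simp add: complex_norm power2_eq_square field_simps)
    show "m z = 1/2 + r / 2 * Re z + - 3 / 2 * Im z" for z by (simp add: m_def lA_def field_simps)
    show "\<sigma> z = z" if "m z = 0" for z
      using that r_pos by (auto simp: complex_eq_iff Re\<sigma> m_def lA_def field_simps rr)
    show "\<sigma> z \<notin> T" if z: "z \<in> K" "z \<notin> T" "0 \<le> m z" "\<sigma> z \<in> K" for z
    proof -
      have "lA r z = 0 \<Longrightarrow> Im z = 0" using z by (auto simp: m_def ctri_def)
      moreover have "0 \<le> (1 - b / r) * m z" using br z by simp
      then have "lB b z = 0 \<Longrightarrow> lB b (\<sigma> z) \<le> 0" by (simp add: lB\<sigma>)
      ultimately show ?thesis using ctri_diff_tri[OF z(1,2)] lA\<sigma>[of z] by (auto simp: tri_def)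
    qed
    show "side p 1" by (rule side_bottom[OF Imp lAp lBp])
    have "- Complex (1/2) (r/2) = eA" by (simp add: eA_def complex_eq_iff)
    then show "side (\<sigma> p) (- Complex (1/2) (r/2))" using side_left[OF q] by (simp add: pq)
    show "0 < m p" using mq by (simp add: p_def m\<sigma>)
    have "(1 - b / r) * m q0 < 0" using br mq0 by (simp add: mult_pos_neg)
    then show "\<sigma> q0 \<in> T" using lq0 lq0' by (simp add: tri_def Re\<sigma> lA\<sigma> lB\<sigma>) (simp add: q0_def)
    show "0 < m (\<sigma> q0)" using mq0 by (simp add: m\<sigma>)
    show "\<sigma> (\<sigma> q0) \<in> K" "\<sigma> (\<sigma> q0) \<notin> T"
      unfolding inv ctri_def tri_def mem_Collect_eq using lq0' by (simp_all add: lq0(2)) (simp add: q0_def)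
  qed (use inv Imp in \<open>auto simp: \<sigma>_def\<close>)
  moreover have "p = of_real (Re p)" using Imp by (simp add: complex_eq_iff)
  ultimately show ?thesis
    using that[of "Re p"] lAp lBp Imp by (simp add: pq g_def lA_def lB_def)
qed

text \<open>The same at the right base vertex, whose angle is not explicit. The right side has
  length \<open>\<rho> / b\<close> and the base \<open>1/b + 1/r\<close>; that the base is longer
  takes the form \<open>r * v < 1\<close>.\<close>

lemma right_dominated:
  assumes q: "lB b q = 0" "0 < Im q" "0 < lA r q"
  obtains x where "- 1 < r * x" "b * x < 1" "cmod (Dh q) < g x"
proof -
  define e where "e = Complex (1 / \<rho>) (- b / \<rho>)"
  define \<sigma> where "\<sigma> = (\<lambda>z. of_real (1 / b) - e / of_real b + e * cnj z)"
  define m where "m = (\<lambda>z. lB b z / \<rho> - Im z)"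
  define v where "v = (\<rho> - 1) / b"
  have b0: "b > 0" using b_ge by simp
  have rho0: "\<rho> > 0" using rho by simp
  have rr: "\<rho> * (\<rho> * y) = y + b * (b * y)" for y
    unfolding mult.assoc[symmetric] rho(1) by (simp add: algebra_simps)
  have Im\<sigma>: "Im (\<sigma> z) = lB b z / \<rho>" for z
    using b0 rho0 by (simp add: \<sigma>_def e_def lB_def field_simps Re_divide_of_real Im_divide_of_real)
  have Re\<sigma>: "Re (\<sigma> z) = 1 / b - 1 / (\<rho> * b) + Re z / \<rho> - b * Im z / \<rho>" for z
    using b0 rho0 by (simp add: \<sigma>_def e_def field_simps Re_divide_of_real Im_divide_of_real)
  have lB\<sigma>: "lB b (\<sigma> z) = \<rho> * Im z" for z
  proof -
    have "b * Re (\<sigma> z) = 1 - 1 / \<rho> + b * Re z / \<rho> - b * b * Im z / \<rho>"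
      using b0 by (simp add: Re\<sigma> right_diff_distrib distrib_left)
    then have "lB b (\<sigma> z) = (1 + b * b) * Im z / \<rho>"
      unfolding lB_def[of b "\<sigma> z"] Im\<sigma> by (simp add: lB_def diff_divide_distrib add_divide_distrib distrib_right)
    then show ?thesis unfolding rho(1)[symmetric] using rho0 by simp
  qed
  have m\<sigma>: "m (\<sigma> z) = - m z" for z using rho0 by (simp add: m_def lB\<sigma> Im\<sigma>)
  have Re\<sigma>': "Re (\<sigma> z) = Re z + v * m z" for z
    unfolding Re\<sigma> m_def v_def using b0 rho0 by (simp add: lB_def field_simps rr)
  have lA\<sigma>: "lA r (\<sigma> z) = lA r z - (1 - r * v) * m z" for z
    unfolding lA_def[of r "\<sigma> z"] Re\<sigma>' Im\<sigma> m_def by (simp add: lA_def algebra_simps flip: add_divide_distrib)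
  have inv: "\<sigma> (\<sigma> z) = z" for z
  proof -
    have "Re (\<sigma> (\<sigma> z)) = Re z" by (simp add: Re\<sigma>' m\<sigma>)
    moreover have "Im (\<sigma> (\<sigma> z)) = Im z" using rho0 by (simp add: Im\<sigma>[of "\<sigma> z"] lB\<sigma>)
    ultimately show ?thesis by (simp add: complex_eq_iff)
  qed
  have br: "0 < 1 - r * v"
  proof -
    \<comment> \<open>After squaring, this comes down to \<open>b * r < 3\<close>.\<close>
    have "\<rho> < 1 + b / r"
    proof (rule ccontr)
      assume "\<not> \<rho> < 1 + b / r"
      then have "(1 + b / r) * (1 + b / r) \<le> \<rho> * \<rho>" using b0 r_pos rho0 by (intro mult_mono) auto
      moreover have "(1 + b / r) * (1 + b / r) = 1 + 2 * (b / r) + b * b / (r * r)"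
        using r_pos by (simp add: field_simps)
      ultimately have "1 + 2 * (b / r) + b * b / (r * r) \<le> 1 + b * b" by (simp add: rho(1))
      then have "2 * (b / r) \<le> 2 / 3 * (b * b)" unfolding r_sq by simp
      then have "2 * b \<le> 2 / 3 * (b * b) * r" using r_pos by (simp add: field_simps)
      then have "b * 3 \<le> b * (b * r)" by simp
      then have "3 \<le> b * r" using b0 mult_le_cancel_left_pos by blast
      moreover have "b * r < r * r" using b_less r_pos by simp
      ultimately show False using r_sq by simp
    qed
    then have "r * (\<rho> - 1) < r * (b / r)" using r_pos by (intro mult_strict_left_mono) auto
    then show ?thesis using b0 r_pos by (simp add: v_def field_simps)
  qed
  define p where "p = \<sigma> q"
  have pq: "\<sigma> p = q" by (simp add: p_def inv)
  have mq: "m q < 0" using q by (simp add: m_def)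
  have Imp: "Im p = 0" using q by (simp add: p_def Im\<sigma>)
  have lBp: "0 < lB b p" using q rho0 by (simp add: p_def lB\<sigma>)
  have "(1 - r * v) * m q \<le> 0" using br mq by (intro mult_nonneg_nonpos) auto
  then have lAp: "0 < lA r p" using q by (simp add: p_def lA\<sigma>)
  define q0 where "q0 = Complex (- 1 / (4 * r)) (3 / 4)"
  have lq0: "lB b q0 = 1 / 4 + b / (4 * r)" "lA r q0 = 0" using r_pos by (auto simp: q0_def lA_def lB_def)
  have "b / (4 * r) \<le> 1/4" using b_less r_pos by (simp add: field_simps)
  then have "lB b q0 \<le> 1/2" unfolding lq0 by linarith
  then have "lB b q0 / \<rho> \<le> (1/2) / 1" using rho(2) by (intro frac_le) auto
  moreover have "Im q0 = 3/4" by (simp add: q0_def)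
  ultimately have mq0: "m q0 < 0" unfolding m_def by linarith
  have lq0': "0 < lB b q0" using b0 r_pos by (simp add: lq0 add_pos_pos)
  have "cmod (Dh (\<sigma> p)) < cmod (Dh p)"
  proof (rule reflection_strict[where e = e and \<sigma> = \<sigma> and m = m and p = p and ?c0.0 = "\<sigma> q0"
      and c = "of_real (1 / b) - e / of_real b" and \<alpha> = "1/\<rho>" and \<beta> = "- b / \<rho>" and \<gamma> = "- 1 / \<rho> - 1"])
    have e: "- e = eB" by (simp add: e_def eB_def complex_eq_iff)
    show "cmod e = 1" using norm_eB unfolding e[symmetric] by simp
    show "m z = 1/\<rho> + - b / \<rho> * Re z + (- 1 / \<rho> - 1) * Im z" for z
      using rho0 by (simp add: m_def lB_def field_simps)
    show "\<sigma> z = z" if "m z = 0" for z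
    proof -
      have "lB b z / \<rho> = Im z" using that by (simp add: m_def)
      then show ?thesis by (simp add: complex_eq_iff Re\<sigma>' Im\<sigma> that)
    qed
    show "\<sigma> z \<notin> T" if z: "z \<in> K" "z \<notin> T" "0 \<le> m z" "\<sigma> z \<in> K" for z
    proof -
      have "0 \<le> (1 - r * v) * m z" using br z by simp
      then have "lA r z = 0 \<Longrightarrow> lA r (\<sigma> z) \<le> 0" by (simp add: lA\<sigma>)
      then show ?thesis using ctri_diff_tri[OF z(1,2)] lB\<sigma>[of z] Im\<sigma>[of z] by (auto simp: tri_def)
    qed
    show "side p 1" by (rule side_bottom[OF Imp lAp lBp])
    show "side (\<sigma> p) (- e)" unfolding e pq by (rule side_right[OF q])
    show "0 < m p" using mq by (simp add: p_def m\<sigma>)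
    have "(1 - r * v) * m q0 < 0" using br mq0 by (simp add: mult_pos_neg)
    then show "\<sigma> q0 \<in> T" using lq0(2) lq0' rho0 by (simp add: tri_def Im\<sigma> lA\<sigma> lB\<sigma>) (simp add: q0_def)
    show "0 < m (\<sigma> q0)" using mq0 by (simp add: m\<sigma>)
    show "\<sigma> (\<sigma> q0) \<in> K" "\<sigma> (\<sigma> q0) \<notin> T"
      unfolding inv ctri_def tri_def mem_Collect_eq using lq0' by (simp_all add: lq0(2)) (simp add: q0_def)
  qed (use inv Imp in \<open>auto simp: \<sigma>_def\<close>)
  moreover have "p = of_real (Re p)" using Imp by (simp add: complex_eq_iff)
  ultimately show ?thesis
    using that[of "Re p"] lAp lBp Imp by (simp add: pq g_def lA_def lB_def)
qed

text \<open>For fixed \<open>e\<close> the directional derivative \<open>Re (e * Dh z)\<close> is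
  harmonic, so it is at most the boundary maximum of the gradient length. If an interior point
  attained this, the derivative in the direction of its gradient would be constant up to the apex,
  where the gradient is 0.\<close>

lemma gradient_maximum:
  assumes x0: "- 1 < r * x0" "b * x0 < 1" and pos: "0 < g x0"
    and max: "\<And>x. - 1 < r * x \<Longrightarrow> b * x < 1 \<Longrightarrow> x \<noteq> x0 \<Longrightarrow> g x < g x0"
    and p: "p \<in> K" "p \<noteq> of_real x0"
  shows "cmod (Dh p) < g x0"
proof -
  have le: "g x \<le> g x0" if "- 1 < r * x" "b * x < 1" for x
    using max[OF that] by (cases "x = x0") auto
  have boundary: "cmod (Dh q) < g x0" if q: "q \<in> K" "q \<notin> T" "q \<noteq> of_real x0" for q
  proof (rule boundary_cases[OF q(1,2)])
    assume "vertex q"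
    then show ?thesis using Dh_vertex[OF _ q(1)] pos by simp
  next
    assume *: "Im q = 0" "0 < lA r q" "0 < lB b q"
    then have "q = of_real (Re q)" by (simp add: complex_eq_iff)
    moreover from this have "Re q \<noteq> x0" using q(3) by auto
    ultimately show ?thesis using max[of "Re q"] * by (simp add: g_def lA_def lB_def)
  next
    assume "lA r q = 0" "0 < Im q" "0 < lB b q"
    from left_dominated[OF this] show ?thesis using le by (metis less_le_trans)
  next
    assume "lB b q = 0" "0 < Im q" "0 < lA r q"
    from right_dominated[OF this] show ?thesis using le by (metis less_le_trans)
  qed
  have boundary_le: "cmod (Dh q) \<le> g x0" if q: "q \<in> K" "q \<notin> T" for q
    using boundary[OF q] by (cases "q = of_real x0") (auto simp: g_def)
  show ?thesis
  proof (cases "p \<in> T")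
    case False
    then show ?thesis using boundary p by blast
  next
    case pT: True
    have cont: "continuous_on K (\<lambda>z. Re (e * Dh z))" for e
      by (intro continuous_intros continuous_on_Dh)
    define G where "G = (\<lambda>e z. e * deriv F z - cnj e * z / 2)"
    have G: "G e holomorphic_on T" for e
      unfolding G_def by (intro holomorphic_intros holomorphic_deriv[OF F_hol open_tri]) auto
    have ReG: "Re (e * Dh z) = Re (G e z)" if "z \<in> T" for e z
      by (simp add: Dh_eq_D[OF that] D_def G_def algebra_simps)
    have bound: "Re (e * Dh z) \<le> g x0" if "cmod e = 1" "z \<in> K" for e z
    proof -
      have "Re (e * Dh z) - g x0 \<le> 0"
      proof (rule maximum_principle_Re[where v = "\<lambda>z. Re (e * Dh z) - g x0" and ?z0.0 = z
            and G = "\<lambda>z. G e z - of_real (g x0)", OF open_tri tri_subset_ctri compact_ctri])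
        show "continuous_on K (\<lambda>z. Re (e * Dh z) - g x0)" by (intro continuous_intros cont)
        show "(\<lambda>z. G e z - of_real (g x0)) holomorphic_on T" by (intro holomorphic_intros G)
        show "Re (e * Dh z) - g x0 \<le> 0" if "z \<in> K" "z \<notin> T" for z
          using complex_Re_le_cmod[of "e * Dh z"] boundary_le[OF that] \<open>cmod e = 1\<close>
          unfolding norm_mult by simp
      qed (use ReG that in auto)
      then show ?thesis by simp
    qed
    show ?thesis
    proof (rule ccontr)
      assume n: "\<not> cmod (Dh p) < g x0"
      then have ne: "Dh p \<noteq> 0" using pos by auto
      define e where "e = cnj (Dh p) / of_real (cmod (Dh p))"
      have e1: "cmod e = 1" using ne by (simp add: e_def norm_divide)
      have "e * Dh p = of_real ((cmod (Dh p))\<^sup>2) / of_real (cmod (Dh p))"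
        unfolding e_def complex_norm_square by (simp add: mult.commute)
      then have "e * Dh p = of_real (cmod (Dh p))" using ne by (simp add: power2_eq_square)
      then have Rep: "Re (e * Dh p) = cmod (Dh p)" by simp
      have "Re (e * Dh z) = cmod (Dh p)" if z: "z \<in> T" for z
        unfolding ReG[OF z] Rep[symmetric] ReG[OF pT]
      proof (rule strong_maximum_principle_Re[OF G open_tri convex_connected[OF convex_tri] pT _ z])
        fix w assume w: "w \<in> T"
        then have "Re (e * Dh w) \<le> g x0" using bound[OF e1] tri_subset_ctri by blast
        then show "Re (G e w) \<le> Re (G e p)" using n Rep ReG[OF w, of e] ReG[OF pT, of e] by linarith
      qed
      then have "Re (e * Dh \<i>) = cmod (Dh p)"
        using continuous_constant_on_closure[where S = T and f = "\<lambda>z. Re (e * Dh z)" and x = \<i>]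
          cont closure_tri by (auto simp: ctri_def lA_def lB_def)
      moreover have "Dh \<i> = 0" by (rule Dh_vertex) (auto simp: vertex_def ctri_def lA_def lB_def)
      ultimately show False using ne by simp
    qed
  qed
qed

end

subsection \<open>Expansion at the origin\<close>

lemma second_derivative_le_if_quadratic_bound:
  fixes \<phi> \<phi>' :: "real \<Rightarrow> real"
  assumes "d > 0" and \<phi>: "\<And>s. \<bar>s\<bar> < d \<Longrightarrow> (\<phi> has_real_derivative \<phi>' s) (at s)"
    and \<phi>': "(\<phi>' has_real_derivative A) (at 0)" and "\<phi> 0 = 0" "\<phi>' 0 = 0"
    and le: "\<And>s. 0 < s \<Longrightarrow> s < d \<Longrightarrow> \<phi> s \<le> B * s\<^sup>2"
  shows "A \<le> 2 * B"
proof (rule ccontr)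
  assume "\<not> A \<le> 2 * B"
  then have pos: "0 < A - 2 * B" by simp
  have "((\<lambda>s. \<phi>' s - 2 * B * s) has_real_derivative A - 2 * B) (at 0)"
    by (auto intro!: derivative_eq_intros \<phi>')
  from DERIV_pos_inc_right[OF this pos]
  obtain e where e: "e > 0" "\<And>h. 0 < h \<Longrightarrow> h < e \<Longrightarrow> \<phi>' 0 - 2 * B * 0 < \<phi>' (0 + h) - 2 * B * (0 + h)" by blast
  define h where "h = min d e / 2"
  have h: "0 < h" "h < d" "h < e" using \<open>d > 0\<close> e(1) by (auto simp: h_def)
  have "\<exists>z>0. z < h \<and> (\<phi> h - B * h\<^sup>2) - (\<phi> 0 - B * 0\<^sup>2) = (h - 0) * (\<phi>' z - 2 * B * z)"
  proof (rule MVT2)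
    fix x assume "0 \<le> x" "x \<le> h"
    then show "((\<lambda>s. \<phi> s - B * s\<^sup>2) has_real_derivative \<phi>' x - 2 * B * x) (at x)"
      using h by (auto intro!: derivative_eq_intros \<phi>)
  qed (rule h(1))
  then obtain s where s: "0 < s" "s < h" "\<phi> h - B * h\<^sup>2 = h * (\<phi>' s - 2 * B * s)" using assms by auto
  have "\<phi>' s - 2 * B * s > 0" using e(2)[of s] s h assms by auto
  then have "h * (\<phi>' s - 2 * B * s) > 0" using h by simp
  then show False using s(3) le[of h] h by linarith
qed

context torsion_triangle
begin

lemma half_ball:
  assumes "\<zeta> \<in> ball 0 (1/2)"
  shows "0 < Im \<zeta> \<Longrightarrow> \<zeta> \<in> T" "0 \<le> Im \<zeta> \<Longrightarrow> \<zeta> \<in> K" "Im \<zeta> = 0 \<Longrightarrow> \<zeta> \<notin> T"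
proof -
  have "2 * cmod (\<zeta> - 0) < 1" using assms by simp
  then have "0 < lA r \<zeta>" "0 < lB b \<zeta>"
    using lipschitz_lA[of \<zeta> 0] lipschitz_lB[of \<zeta> 0] by (auto simp: lA_def lB_def)
  then show "0 < Im \<zeta> \<Longrightarrow> \<zeta> \<in> T" "0 \<le> Im \<zeta> \<Longrightarrow> \<zeta> \<in> K" "Im \<zeta> = 0 \<Longrightarrow> \<zeta> \<notin> T"
    by (auto simp: tri_def ctri_def)
qed

text \<open>The torsion function of the equilateral triangle \<open>b = r\<close>.\<close>

definition U0 :: "complex \<Rightarrow> real" where
  "U0 z = Im z * ((1 - Im z)\<^sup>2 - 3 * (Re z)\<^sup>2) / 4"

lemma U_minus_U0_bound:
  assumes z: "z \<in> ball 0 (1/2)" "0 \<le> Im z"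
  shows "\<bar>U z - U0 z\<bar> \<le> 2 * \<epsilon>"
proof -
  have zK: "z \<in> K" by (rule half_ball(2)[OF z])
  have "cmod z \<le> 1/2" using z by simp
  then have xy: "\<bar>Re z\<bar> \<le> 1/2" "Im z \<le> 1/2"
    using abs_Re_le_cmod[of z] abs_Im_le_cmod[of z] by linarith+
  have P: "P z = 4 * U0 z + \<epsilon> * (Im z * (Re z * (1 - Im z) + r * (Re z)\<^sup>2))"
  proof -
    have "P z = Im z * ((1 - Im z)\<^sup>2 + \<epsilon> * Re z * (1 - Im z) - r * b * (Re z)\<^sup>2)"
      by (simp add: P_def lA_def lB_def \<epsilon>_def power2_eq_square algebra_simps)
    moreover have rb: "r * b = 3 - r * \<epsilon>" unfolding r_sq[symmetric] by (simp add: \<epsilon>_def algebra_simps)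
    moreover have "4 * U0 z = Im z * ((1 - Im z)\<^sup>2 - 3 * (Re z)\<^sup>2)" by (simp add: U0_def)
    ultimately show ?thesis unfolding rb by (simp add: algebra_simps)
  qed
  have x2: "(Re z)\<^sup>2 \<le> 1/4"
    using power_mono[OF xy(1), of 2] by (simp add: power2_eq_square)
  have rx2: "r * (Re z)\<^sup>2 \<le> 2 * (1/4)" "0 \<le> r * (Re z)\<^sup>2"
    using r_bounds r_pos x2 mult_mono[of r 2 "(Re z)\<^sup>2" "1/4"] by auto
  have "\<bar>Re z * (1 - Im z)\<bar> \<le> 1/2 * 1" unfolding abs_mult using xy z by (intro mult_mono) auto
  then have "\<bar>Re z * (1 - Im z) + r * (Re z)\<^sup>2\<bar> \<le> 1" using rx2 by linarith
  then have "\<bar>Im z * (Re z * (1 - Im z) + r * (Re z)\<^sup>2)\<bar> \<le> 1/2 * 1"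
    unfolding abs_mult[of "Im z"] using xy z by (intro mult_mono) auto
  then have "\<bar>\<epsilon> * (Im z * (Re z * (1 - Im z) + r * (Re z)\<^sup>2))\<bar> \<le> \<epsilon> * (1/2)"
    unfolding abs_mult[of \<epsilon>] using eps_bounds by (intro mult_mono) auto
  then have d: "\<bar>P z - 4 * U0 z\<bar> \<le> \<epsilon> / 2" unfolding P by simp
  have "lA r z \<le> 2" "lB b z \<le> 2"
    using lipschitz_lA[of z 0] lipschitz_lB[of z 0] \<open>cmod z \<le> 1/2\<close> by (auto simp: lA_def lB_def)
  then have "Im z * lA r z * lB b z \<le> 1/2 * 2 * 2"
    using xy zK by (intro mult_mono) (auto simp: ctri_def)
  then have P2: "P z \<le> 2" by (simp add: P_def)
  have "\<epsilon> * P z \<le> \<epsilon> * 2" using P2 eps_bounds by (intro mult_left_mono) auto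
  moreover have "U z \<le> P z / 4 + \<epsilon> * P z / 2" "P z / 4 - \<epsilon> * P z / 4 \<le> U z"
    using U_upper[OF zK] U_lower[OF zK] by (simp_all add: field_simps)
  moreover have "0 \<le> \<epsilon>" using eps_bounds by simp
  ultimately show ?thesis using d by linarith
qed

text \<open>As \<open>b < r\<close>, the right half of the equilateral triangle and its mirror image
  lie in \<open>K\<close>. The odd difference is harmonic and vanishes on the axis and on the base;
  on the hypotenuse the mirrored point is on the left side, so only \<open>U\<close> itself has to
  be compared there. The polynomial is a combination of the imaginary parts of
  \<open>z\<^sup>2\<close> and \<open>z^4\<close>, which have the same zeros. In both uses
  \<open>s\<close> is 1 or -1.\<close>

lemma odd_part_compare:
  assumes hyp: "\<And>x y. 0 \<le> y \<Longrightarrow> y \<le> 1 \<Longrightarrow> r * x = 1 - y \<Longrightarrow> x + \<i> * y \<in> K \<Longrightarrow>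
      s * (U (x + \<i> * y) - \<kappa> * (x * y * (c + 9/8 * (x\<^sup>2 - y\<^sup>2)))) \<le> 0"
    and z: "0 \<le> Re z" "0 \<le> Im z" "r * Re z + Im z \<le> 1"
  shows "s * (U z - U (- cnj z) - \<kappa> * (Re z * Im z * (c + 9/8 * ((Re z)\<^sup>2 - (Im z)\<^sup>2)))) \<le> 0"
proof -
  define S where "S = {z. 0 < Re z \<and> 0 < Im z \<and> r * Re z + Im z < 1}"
  define Q where "Q = {z. 0 \<le> Re z \<and> 0 \<le> Im z \<and> r * Re z + Im z \<le> 1}"
  have bx: "\<exists>k. r * Re z = b * Re z + k \<and> 0 \<le> k \<and> 0 \<le> b * Re z" if "0 \<le> Re z" for z
    using that b_less b_ge by (intro exI[of _ "(r - b) * Re z"]) (auto simp: algebra_simps mult_right_mono)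
  have QK: "z \<in> K" "- cnj z \<in> K" if z: "z \<in> Q" for z
  proof -
    have "0 \<le> Re z" using z by (simp add: Q_def)
    from bx[OF this] obtain k where "r * Re z = b * Re z + k" "0 \<le> k" "0 \<le> b * Re z"
      by blast
    then show "z \<in> K" "- cnj z \<in> K" using z by (auto simp: Q_def ctri_def lA_def lB_def)
  qed
  have ST: "z \<in> T" "- cnj z \<in> T" if z: "z \<in> S" for z
  proof -
    have "0 \<le> Re z" using z by (simp add: S_def)
    from bx[OF this] obtain k where "r * Re z = b * Re z + k" "0 \<le> k" "0 \<le> b * Re z"
      by blast
    then show "z \<in> T" "- cnj z \<in> T" using z by (auto simp: S_def tri_def lA_def lB_def)
  qed
  have oS: "open S" unfolding S_def by (intro open_Collect_conj open_Collect_less continuous_intros)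
  have "closed Q" unfolding Q_def by (intro closed_Collect_conj closed_Collect_le continuous_intros)
  moreover have "Q \<subseteq> K" using QK by blast
  ultimately have cQ: "compact Q" using compact_Int_closed[OF compact_ctri] by (metis inf.absorb_iff2)
  let ?p = "\<lambda>z. \<kappa> * (Re z * Im z * (c + 9/8 * ((Re z)\<^sup>2 - (Im z)\<^sup>2)))"
  show ?thesis
  proof (rule maximum_principle_Re[where v = "\<lambda>z. s * (U z - U (- cnj z) - ?p z)" and ?z0.0 = z and S = S and K = Q
        and G = "\<lambda>z. of_real s * (F z - cnj (F (- cnj z)) + of_real \<kappa> * \<i> * (of_real c * z\<^sup>2 / 2 + 9/32 * z ^ 4))"])
    show "open S" "compact Q" "S \<subseteq> Q" by (fact oS cQ | auto simp: S_def Q_def)+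
    show "z \<in> Q" using z by (simp add: Q_def)
    have "continuous_on Q (\<lambda>z. U (- cnj z))"
      by (rule continuous_on_compose2[OF U_cont]) (use QK in \<open>auto intro!: continuous_intros\<close>)
    moreover have "continuous_on Q U" using continuous_on_subset[OF U_cont] QK by blast
    ultimately show "continuous_on Q (\<lambda>z. s * (U z - U (- cnj z) - ?p z))" by (intro continuous_intros)
    have "(\<lambda>w. F (- w)) holomorphic_on cnj ` S"
      by (rule holomorphic_on_compose_gen[of uminus _ F T, unfolded o_def, OF _ F_hol])
        (use ST in \<open>auto intro!: holomorphic_intros\<close>)
    from holomorphic_on_compose_cnj_cnj[OF this oS]
    have "(\<lambda>z. cnj (F (- cnj z))) holomorphic_on S" by (simp add: o_def)
    moreover have "F holomorphic_on S" by (rule holomorphic_on_subset[OF F_hol]) (use ST in blast)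
    ultimately show "(\<lambda>z. of_real s * (F z - cnj (F (- cnj z)) + of_real \<kappa> * \<i> * (of_real c * z\<^sup>2 / 2 + 9/32 * z ^ 4))) holomorphic_on S"
      by (intro holomorphic_intros) auto
    show "s * (U z - U (- cnj z) - ?p z) = Re (of_real s * (F z - cnj (F (- cnj z)) + of_real \<kappa> * \<i> * (of_real c * z\<^sup>2 / 2 + 9/32 * z ^ 4)))"
      if z: "z \<in> S" for z
    proof -
      have "z ^ 4 = z\<^sup>2 * z\<^sup>2" by (simp flip: power_add)
      then have "Im (z ^ 4) = 4 * (Re z * Im z * ((Re z)\<^sup>2 - (Im z)\<^sup>2))"
        by (simp add: power2_eq_square algebra_simps)
      moreover have "Im (z\<^sup>2) = 2 * (Re z * Im z)" by (simp add: power2_eq_square)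
      moreover have "Im (of_real c * z\<^sup>2 / 2 + 9/32 * z ^ 4) = c * Im (z\<^sup>2) / 2 + 9/32 * Im (z ^ 4)"
        by (simp add: Im_divide_numeral)
      ultimately have "Im (of_real c * z\<^sup>2 / 2 + 9/32 * z ^ 4) = Re z * Im z * (c + 9/8 * ((Re z)\<^sup>2 - (Im z)\<^sup>2))"
        by (simp add: algebra_simps)
      then have "Re (of_real \<kappa> * \<i> * (of_real c * z\<^sup>2 / 2 + 9/32 * z ^ 4)) = - ?p z"
        by (simp del: plus_complex.sel)
      moreover have "U z - U (- cnj z) = Re (F z - cnj (F (- cnj z)))"
        using U_eq[OF ST(1)[OF z]] U_eq[OF ST(2)[OF z]] by simp
      ultimately have "U z - U (- cnj z) - ?p z = Re (F z - cnj (F (- cnj z)) + of_real \<kappa> * \<i> * (of_real c * z\<^sup>2 / 2 + 9/32 * z ^ 4))"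
        by (simp only: plus_complex.sel)
      then show ?thesis by (simp only: times_complex.sel Re_complex_of_real Im_complex_of_real)
    qed
    show "s * (U z - U (- cnj z) - ?p z) \<le> 0" if z: "z \<in> Q" "z \<notin> S" for z
    proof -
      consider "Re z = 0" | "Im z = 0" | "r * Re z + Im z = 1" using z by (force simp: Q_def S_def)
      then show ?thesis
      proof cases
        case 1
        then have "- cnj z = z" by (simp add: complex_eq_iff)
        then show ?thesis using 1 by simp
      next
        case 2
        then have "z \<notin> T" "- cnj z \<notin> T" by (auto simp: tri_def)
        then have "U z = 0" "U (- cnj z) = 0" using U_bd QK[OF z(1)] by blast+
        then show ?thesis using 2 by simp
      next
        case 3
        then have "- cnj z \<notin> T" by (auto simp: tri_def lA_def)
        then have 0: "U (- cnj z) = 0" using U_bd QK[OF z(1)] by blast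
        have "0 \<le> r * Re z" using z r_pos by (simp add: Q_def)
        moreover have "of_real (Re z) + \<i> * of_real (Im z) = z" by (simp add: complex_eq_iff)
        ultimately have "s * (U z - ?p z) \<le> 0"
          using hyp[of "Im z" "Re z"] 3 z QK(1)[OF z(1)] by (simp add: Q_def)
        then show ?thesis by (simp add: 0)
      qed
    qed
  qed
qed

text \<open>There \<open>lA = 2 (1 - y)\<close> and \<open>lB = \<epsilon> x\<close>. The boundary
  data are thus of order \<epsilon>, and the relative error in the bounds by \<open>P\<close> costs
  only O(\<open>\<epsilon>\<^sup>2\<close>).\<close>

lemma P_hypotenuse:
  assumes "r * x = 1 - y"
  shows "P (x + \<i> * y) = 2 * \<epsilon> * (x * y * (1 - y))"
proof -
  have "P (x + \<i> * y) = y * ((1 - y) + r * x) * ((1 - y) - b * x)" by (simp add: P_def lA_def lB_def)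
  also have "\<dots> = y * (2 * (1 - y)) * (\<epsilon> * x)" unfolding assms[symmetric] by (simp add: \<epsilon>_def algebra_simps)
  finally show ?thesis by (simp add: mult_ac)
qed

lemma x2_hypotenuse: "r * x = 1 - y \<Longrightarrow> x\<^sup>2 = (1 - y)\<^sup>2 / (3 :: real)"
proof -
  assume h: "r * x = 1 - y"
  have "(r * r) * x\<^sup>2 = (1 - y)\<^sup>2" unfolding h[symmetric] by (simp add: power2_eq_square)
  then show ?thesis unfolding r_sq by simp
qed

text \<open>On the hypotenuse \<open>P / 4\<close> is \<open>\<epsilon> / 3\<close> times
  \<open>x y\<close> times \<open>3/2 (1 - y)\<close>, and with
  \<open>x\<^sup>2 = (1 - y)\<^sup>2 / 3\<close> the bracket becomes a concave quadratic in
  \<open>y\<close>. The two coefficients 9/8 are those for which it equals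
  \<open>3/2 (1 - y)\<close> at \<open>y = 0\<close> and \<open>y = 1\<close>; in between it lies
  above.\<close>

lemma odd_part_upper:
  assumes z: "0 \<le> Re z" "0 \<le> Im z" "r * Re z + Im z \<le> 1"
  shows "U z - U (- cnj z) \<le> \<epsilon> / 3 * (1 + 2 * \<epsilon>) * (Re z * Im z * (9/8 + 9/8 * ((Re z)\<^sup>2 - (Im z)\<^sup>2)))"
proof -
  have "1 * (U z - U (- cnj z) - \<epsilon> / 3 * (1 + 2 * \<epsilon>) * (Re z * Im z * (9/8 + 9/8 * ((Re z)\<^sup>2 - (Im z)\<^sup>2)))) \<le> 0"
  proof (rule odd_part_compare[OF _ z])
    fix x y :: real assume y: "0 \<le> y" "y \<le> 1" and h: "r * x = 1 - y" and K: "x + \<i> * y \<in> K"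
    have x: "0 \<le> x" using h y r_pos by (metis diff_ge_0_iff_ge zero_le_mult_iff not_less)
    have "y * y \<le> y" using y mult_left_le_one_le by blast
    then have "3/2 * (1 - y) \<le> 9/8 + 9/8 * (x\<^sup>2 - y\<^sup>2)"
      unfolding x2_hypotenuse[OF h] by (simp add: power2_eq_square algebra_simps add_divide_distrib diff_divide_distrib)
    then have le: "\<epsilon> / 3 * (1 + 2 * \<epsilon>) * (x * y) * (3/2 * (1 - y)) \<le> \<epsilon> / 3 * (1 + 2 * \<epsilon>) * (x * y) * (9/8 + 9/8 * (x\<^sup>2 - y\<^sup>2))"
      using x y eps_bounds by (intro mult_left_mono) auto
    have eq: "(1 + 2 * \<epsilon>) / 4 * P (x + \<i> * y) = \<epsilon> / 3 * (1 + 2 * \<epsilon>) * (x * y) * (3/2 * (1 - y))"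
      unfolding P_hypotenuse[OF h] by (simp add: field_simps)
    have "U (x + \<i> * y) \<le> \<epsilon> / 3 * (1 + 2 * \<epsilon>) * (x * y) * (9/8 + 9/8 * (x\<^sup>2 - y\<^sup>2))"
      using U_upper[OF K] le unfolding eq by (rule order_trans)
    then show "1 * (U (x + \<i> * y) - \<epsilon> / 3 * (1 + 2 * \<epsilon>) * (x * y * (9/8 + 9/8 * (x\<^sup>2 - y\<^sup>2)))) \<le> 0"
      by (simp add: mult.assoc)
  qed
  then show ?thesis by simp
qed

text \<open>Lowering the constant from 9/8 to 15/16 moves the same quadratic down until it touches
  the line \<open>3/2 (1 - y)\<close> from below, at \<open>y = 1/2\<close>.\<close>

lemma odd_part_lower:
  assumes z: "0 \<le> Re z" "0 \<le> Im z" "r * Re z + Im z \<le> 1"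
  shows "\<epsilon> / 3 * (1 - \<epsilon>) * (Re z * Im z * (15/16 + 9/8 * ((Re z)\<^sup>2 - (Im z)\<^sup>2))) \<le> U z - U (- cnj z)"
proof -
  have "(- 1) * (U z - U (- cnj z) - \<epsilon> / 3 * (1 - \<epsilon>) * (Re z * Im z * (15/16 + 9/8 * ((Re z)\<^sup>2 - (Im z)\<^sup>2)))) \<le> 0"
  proof (rule odd_part_compare[OF _ z])
    fix x y :: real assume y: "0 \<le> y" "y \<le> 1" and h: "r * x = 1 - y" and K: "x + \<i> * y \<in> K"
    have x: "0 \<le> x" using h y r_pos by (metis diff_ge_0_iff_ge zero_le_mult_iff not_less)
    have "0 \<le> 3/4 * (y - 1/2)\<^sup>2" by simp
    then have "15/16 + 9/8 * (x\<^sup>2 - y\<^sup>2) \<le> 3/2 * (1 - y)"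
      unfolding x2_hypotenuse[OF h] by (simp add: power2_eq_square algebra_simps add_divide_distrib diff_divide_distrib)
    then have le: "\<epsilon> / 3 * (1 - \<epsilon>) * (x * y) * (15/16 + 9/8 * (x\<^sup>2 - y\<^sup>2)) \<le> \<epsilon> / 3 * (1 - \<epsilon>) * (x * y) * (3/2 * (1 - y))"
      using x y eps_bounds by (intro mult_left_mono) auto
    have eq: "(1 - \<epsilon>) / 4 * P (x + \<i> * y) = \<epsilon> / 3 * (1 - \<epsilon>) * (x * y) * (3/2 * (1 - y))"
      unfolding P_hypotenuse[OF h] by (simp add: field_simps)
    have "\<epsilon> / 3 * (1 - \<epsilon>) * (x * y) * (15/16 + 9/8 * (x\<^sup>2 - y\<^sup>2)) \<le> U (x + \<i> * y)"
      using le U_lower[OF K] unfolding eq by (rule order_trans)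
    then show "(- 1) * (U (x + \<i> * y) - \<epsilon> / 3 * (1 - \<epsilon>) * (x * y * (15/16 + 9/8 * (x\<^sup>2 - y\<^sup>2)))) \<le> 0"
      by (simp add: mult.assoc)
  qed
  then show ?thesis by simp
qed

section \<open>Derivatives of \<open>g\<close> near the origin\<close>

lemma g_local:
  obtains g1 g2 where
    "\<And>x. \<bar>x\<bar> < 1/8 \<Longrightarrow> (g has_real_derivative g1 x) (at x)"
    "\<And>x. \<bar>x\<bar> < 1/8 \<Longrightarrow> (g1 has_real_derivative g2 x) (at x)"
    "\<And>x. \<bar>x\<bar> < 1/8 \<Longrightarrow> \<bar>g2 x + 3/2\<bar> \<le> 20480 * \<epsilon>"
    "5/32 * \<epsilon> * (1 - \<epsilon>) \<le> g1 0" "g1 0 \<le> 3/16 * \<epsilon> * (1 + 2 * \<epsilon>)"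
proof -
  have "\<exists>G. G holomorphic_on ball 0 (1/2)
    \<and> (\<forall>\<zeta>\<in>ball 0 (1/2). 0 \<le> Im \<zeta> \<longrightarrow> Re (G \<zeta>) = U (0 + 1 * \<zeta>) + (Im \<zeta>)\<^sup>2 / 2)
    \<and> (\<forall>\<zeta>\<in>ball 0 (1/2). Re (G (cnj \<zeta>)) = - Re (G \<zeta>))
    \<and> (\<forall>\<zeta>\<in>ball 0 (1/2). 0 < Im \<zeta> \<longrightarrow> D (0 + 1 * \<zeta>) * 1 = deriv G \<zeta> + \<i> * Im \<zeta>)"
    by (rule side_reflection) (use half_ball in auto)
  then obtain G where G: "G holomorphic_on ball 0 (1/2)"
    "\<And>\<zeta>. \<zeta> \<in> ball 0 (1/2) \<Longrightarrow> 0 \<le> Im \<zeta> \<Longrightarrow> Re (G \<zeta>) = U \<zeta> + (Im \<zeta>)\<^sup>2 / 2"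
    "\<And>\<zeta>. \<zeta> \<in> ball 0 (1/2) \<Longrightarrow> Re (G (cnj \<zeta>)) = - Re (G \<zeta>)"
    "\<And>\<zeta>. \<zeta> \<in> ball 0 (1/2) \<Longrightarrow> 0 < Im \<zeta> \<Longrightarrow> D \<zeta> = deriv G \<zeta> + \<i> * Im \<zeta>"
    by auto
  \<comment> \<open>\<open>- \<i> z / 4 + \<i> z^3 / 4\<close> is what reflection produces from
    \<open>U0\<close>. Subtracting it leaves the real part \<open>U - U0\<close> on the upper half
    disc, continued oddly, so of size O(\<epsilon>) on the whole disc.\<close>
  define H where "H = (\<lambda>z. G z + \<i> * z / 4 - \<i> * z ^ 3 / 4)"
  have H: "H holomorphic_on ball 0 (1/2)" unfolding H_def by (intro holomorphic_intros G) auto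
  have Im3: "Im (z ^ 3) = 3 * (Re z)\<^sup>2 * Im z - (Im z) ^ 3" for z
    by (simp add: power3_eq_cube power2_eq_square algebra_simps)
  have ReH: "Re (H z) = Re (G z) - Im z / 4 + Im (z ^ 3) / 4" for z
    unfolding H_def plus_complex.sel minus_complex.sel Re_divide_numeral by simp
  have ReH_up: "Re (H z) = U z - U0 z" if "z \<in> ball 0 (1/2)" "0 \<le> Im z" for z
  proof -
    have "Im z * ((1 - Im z)\<^sup>2 - 3 * (Re z)\<^sup>2) = Im z - 2 * (Im z)\<^sup>2 + (Im z) ^ 3 - 3 * (Re z)\<^sup>2 * Im z"
      by (simp add: power3_eq_cube power2_eq_square algebra_simps)
    then have "4 * U0 z = Im z - 2 * (Im z)\<^sup>2 + (Im z) ^ 3 - 3 * (Re z)\<^sup>2 * Im z" by (simp add: U0_def)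
    then show ?thesis unfolding ReH G(2)[OF that] Im3 by argo
  qed
  have ReH_cnj: "Re (H (cnj z)) = - Re (H z)" if "z \<in> ball 0 (1/2)" for z
  proof -
    have "Im (cnj z ^ 3) = - Im (z ^ 3)" by (simp flip: complex_cnj_power)
    then show ?thesis unfolding ReH G(3)[OF that] by simp
  qed
  have ReH_bound: "\<bar>Re (H z)\<bar> \<le> 2 * \<epsilon>" if "z \<in> ball 0 (1/2)" for z
  proof (cases "0 \<le> Im z")
    case True
    then show ?thesis using U_minus_U0_bound[OF that] ReH_up[OF that] by simp
  next
    case False
    then have "cnj z \<in> ball 0 (1/2)" "0 \<le> Im (cnj z)" using that by auto
    then have "\<bar>Re (H (cnj z))\<bar> \<le> 2 * \<epsilon>" using U_minus_U0_bound ReH_up by simp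
    then show ?thesis using ReH_cnj[OF that] by simp
  qed
  have dH: "((deriv ^^ n) H has_field_derivative (deriv ^^ Suc n) H z) (at z)" if "z \<in> ball 0 (1/2)" for n z
    using holomorphic_derivI[OF holomorphic_higher_deriv[OF H open_ball] open_ball that] by simp
  define H1 H2 H3 where "H1 = deriv H" and "H2 = (deriv ^^ 2) H" and "H3 = (deriv ^^ 3) H"
  have dHs: "(H has_field_derivative H1 z) (at z)" "(H1 has_field_derivative H2 z) (at z)"
    "(H2 has_field_derivative H3 z) (at z)" if "z \<in> ball 0 (1/2)" for z
    using dH[OF that, of 0] dH[OF that, of 1] dH[OF that, of 2]
    by (simp_all add: H1_def H2_def H3_def numeral_2_eq_2 numeral_3_eq_3)
  have G1: "deriv G z = H1 z - \<i> / 4 + 3 * \<i> * z\<^sup>2 / 4" if "z \<in> ball 0 (1/2)" for z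
  proof -
    have "((\<lambda>z. H z - \<i> * z / 4 + \<i> * z ^ 3 / 4) has_field_derivative H1 z - \<i> / 4 + 3 * \<i> * z\<^sup>2 / 4) (at z)"
      using dHs(1)[OF that] by (auto intro!: derivative_eq_intros)
    moreover have "(\<lambda>z. H z - \<i> * z / 4 + \<i> * z ^ 3 / 4) = G" by (simp add: H_def fun_eq_iff)
    ultimately show ?thesis by (simp add: DERIV_imp_deriv)
  qed
  have g_eq: "g x = (1 - 3 * x\<^sup>2) / 4 + Re (\<i> * H1 (0 + of_real x * 1))" if x: "\<bar>x\<bar> < 1/2" for x
  proof -
    have xb: "of_real x \<in> ball (0::complex) (1/2)" using x by simp
    have xK: "of_real x \<in> K" using half_ball(2)[OF xb] by simp
    have "Dh (of_real x) = deriv G (of_real x)"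
    proof (rule Dh_eqI[OF xK])
      have "isCont (deriv G) (of_real x)"
        using holomorphic_deriv[OF G(1) open_ball] holomorphic_on_imp_continuous_on continuous_on_eq_continuous_at
          open_ball xb by blast
      then have "((\<lambda>z. deriv G z + \<i> * of_real (Im z)) \<longlongrightarrow> deriv G (of_real x) + \<i> * of_real (Im (of_real x))) (at (of_real x) within T)"
        by (intro tendsto_intros) (simp add: continuous_at_imp_continuous_at_within continuous_within[symmetric])
      moreover have "\<forall>\<^sub>F z in at (of_real x) within T. deriv G z + \<i> * of_real (Im z) = D z"
      proof -
        have "\<forall>\<^sub>F z in at (of_real x) within T. z \<in> ball 0 (1/2)"
          by (rule topological_tendstoD[OF tendsto_ident_at]) (use xb in auto)
        moreover have "\<forall>\<^sub>F z in at (of_real x) within T. z \<in> T" by (simp add: eventually_at_filter)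
        ultimately show ?thesis by eventually_elim (use G(4) in \<open>auto simp: tri_def\<close>)
      qed
      ultimately show "(D \<longlongrightarrow> deriv G (of_real x)) (at (of_real x) within T)"
        using Lim_transform_eventually by fastforce
    qed
    moreover have "side (of_real x) 1"
    proof (rule side_bottom)
      have "2 * cmod (of_real x - 0) < 1" using x by simp
      then show "0 < lA r (of_real x)" "0 < lB b (of_real x)"
        using lipschitz_lA[of "of_real x" 0] lipschitz_lB[of "of_real x" 0] by (auto simp: lA_def lB_def)
    qed simp
    from Dh_side(1)[OF this] have "g x = - Im (Dh (of_real x))"
      unfolding g_def by (metis complex_cnj_one minus_complex.sel(2) mult.right_neutral mult_minus_left Im_i_times Re_complex_of_real uminus_complex.sel(2) minus_minus)
    ultimately show ?thesis unfolding G1[OF xb] by (simp add: power2_eq_square)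
  qed
  define g1 where "g1 = (\<lambda>x. - 3 * x / 2 + Re (\<i> * H2 (0 + of_real x * 1)))"
  define g2 where "g2 = (\<lambda>x. - 3 / 2 + Re (\<i> * H3 (0 + of_real x * 1)))"
  have d1: "(g has_real_derivative g1 x) (at x)" if x: "\<bar>x\<bar> < 1/2" for x
  proof (subst DERIV_cong_ev[OF refl _ refl])
    have "\<forall>\<^sub>F y in nhds x. y \<in> ball 0 (1/2)" by (rule eventually_nhds_in_open) (use x in auto)
    then show "\<forall>\<^sub>F y in nhds x. g y = (1 - 3 * y\<^sup>2) / 4 + Re (\<i> * H1 (0 + of_real y * 1))"
      by (rule eventually_mono) (use g_eq in auto)
    have "((\<lambda>y. Re (\<i> * H1 (0 + of_real y * 1))) has_real_derivative Re (\<i> * H2 (0 + of_real x * 1) * 1)) (at x)"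
      by (rule has_real_derivative_Re_line) (use dHs(2) x in \<open>auto intro!: derivative_eq_intros\<close>)
    moreover have "((\<lambda>y. (1 - 3 * y\<^sup>2) / 4) has_real_derivative - 3 * x / 2) (at x)"
      by (auto intro!: derivative_eq_intros)
    ultimately show "((\<lambda>y. (1 - 3 * y\<^sup>2) / 4 + Re (\<i> * H1 (0 + of_real y * 1))) has_real_derivative g1 x) (at x)"
      unfolding g1_def mult_1_right by (rule DERIV_add[rotated])
  qed
  have d2: "(g1 has_real_derivative g2 x) (at x)" if x: "\<bar>x\<bar> < 1/2" for x
  proof -
    have "((\<lambda>y. Re (\<i> * H2 (0 + of_real y * 1))) has_real_derivative Re (\<i> * H3 (0 + of_real x * 1) * 1)) (at x)"
      by (rule has_real_derivative_Re_line) (use dHs(3) x in \<open>auto intro!: derivative_eq_intros\<close>)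
    moreover have "((\<lambda>y. - 3 * y / 2) has_real_derivative - 3 / 2) (at x)"
      by (auto intro!: derivative_eq_intros)
    ultimately show ?thesis unfolding g1_def g2_def mult_1_right by (rule DERIV_add[rotated])
  qed
  \<comment> \<open>The third derivative estimate for radius 1/2 and bound
    \<open>2 \<epsilon>\<close>, valid up to a quarter of the radius.\<close>
  have d2_bound: "\<bar>g2 x + 3/2\<bar> \<le> 20480 * \<epsilon>" if x: "\<bar>x\<bar> < 1/8" for x
  proof -
    have "cmod (H3 (of_real x)) \<le> 1280 * (2 * \<epsilon>) / (1/2) ^ 3"
      unfolding H3_def by (rule third_deriv_bound_by_Re[OF H _ _ ReH_bound]) (use eps_bounds x in auto)
    then have "cmod (\<i> * H3 (of_real x)) \<le> 20480 * \<epsilon>" by (simp add: norm_mult power3_eq_cube)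
    then have "\<bar>Re (\<i> * H3 (of_real x))\<bar> \<le> 20480 * \<epsilon>" using abs_Re_le_cmod order_trans by blast
    then show ?thesis by (simp add: g2_def)
  qed
  \<comment> \<open>The odd part is evaluated along the two diagonals, where
    \<open>x\<^sup>2 = y\<^sup>2\<close> and the quartic terms of the barriers vanish. Since
    \<open>(1 + \<i>)\<^sup>2 - (- 1 + \<i>)\<^sup>2 = 4 \<i>\<close>, the second derivative of
    \<phi> at 0 is \<open>4 * g1 0\<close>.\<close>
  define \<phi> where "\<phi> = (\<lambda>\<tau>. Re (H (0 + of_real \<tau> * (1 + \<i>))) - Re (H (0 + of_real \<tau> * (- 1 + \<i>))))"
  define \<phi>' where "\<phi>' = (\<lambda>\<tau>. Re (H1 (0 + of_real \<tau> * (1 + \<i>)) * (1 + \<i>)) - Re (H1 (0 + of_real \<tau> * (- 1 + \<i>)) * (- 1 + \<i>)))"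
  have diag: "0 + of_real \<tau> * (1 + \<i>) \<in> ball 0 (1/2)" "0 + of_real \<tau> * (- 1 + \<i>) \<in> ball 0 (1/2)"
    if "\<bar>\<tau>\<bar> < 1/4" for \<tau>
  proof -
    have "cmod (1 + \<i>) \<le> 2" "cmod (- 1 + \<i>) \<le> 2" using cmod_le[of "1 + \<i>"] cmod_le[of "- 1 + \<i>"] by auto
    then have "\<bar>\<tau>\<bar> * cmod (1 + \<i>) \<le> \<bar>\<tau>\<bar> * 2" "\<bar>\<tau>\<bar> * cmod (- 1 + \<i>) \<le> \<bar>\<tau>\<bar> * 2" by (auto intro!: mult_left_mono)
    then show "0 + of_real \<tau> * (1 + \<i>) \<in> ball 0 (1/2)" "0 + of_real \<tau> * (- 1 + \<i>) \<in> ball 0 (1/2)"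
      using that by (auto simp: norm_mult)
  qed
  have \<phi>1: "(\<phi> has_real_derivative \<phi>' \<tau>) (at \<tau>)" if "\<bar>\<tau>\<bar> < 1/4" for \<tau>
    unfolding \<phi>_def \<phi>'_def by (intro DERIV_diff has_real_derivative_Re_line dHs diag that)
  have \<phi>2: "(\<phi>' has_real_derivative 4 * g1 0) (at 0)"
  proof -
    have "((\<lambda>\<tau>. Re ((1 + \<i>) * H1 (0 + of_real \<tau> * (1 + \<i>)))) has_real_derivative Re ((1 + \<i>) * H2 (0 + of_real 0 * (1 + \<i>)) * (1 + \<i>))) (at 0)"
      by (rule has_real_derivative_Re_line) (intro DERIV_cmult dHs diag, simp)
    moreover have "((\<lambda>\<tau>. Re ((- 1 + \<i>) * H1 (0 + of_real \<tau> * (- 1 + \<i>)))) has_real_derivative Re ((- 1 + \<i>) * H2 (0 + of_real 0 * (- 1 + \<i>)) * (- 1 + \<i>))) (at 0)"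
      by (rule has_real_derivative_Re_line) (intro DERIV_cmult dHs diag, simp)
    ultimately have "((\<lambda>\<tau>. Re ((1 + \<i>) * H1 (0 + of_real \<tau> * (1 + \<i>))) - Re ((- 1 + \<i>) * H1 (0 + of_real \<tau> * (- 1 + \<i>))))
       has_real_derivative Re ((1 + \<i>) * H2 (0 + of_real 0 * (1 + \<i>)) * (1 + \<i>)) - Re ((- 1 + \<i>) * H2 (0 + of_real 0 * (- 1 + \<i>)) * (- 1 + \<i>))) (at 0)"
      by (rule DERIV_diff)
    moreover have "Re ((1 + \<i>) * H2 (0 + of_real 0 * (1 + \<i>)) * (1 + \<i>)) - Re ((- 1 + \<i>) * H2 (0 + of_real 0 * (- 1 + \<i>)) * (- 1 + \<i>)) = 4 * g1 0"
      by (simp add: g1_def)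
    ultimately show ?thesis unfolding \<phi>'_def by (simp only: mult.commute)
  qed
  have \<phi>'0: "\<phi>' 0 = 0"
  proof -
    have "Re (H (of_real x)) = 0" if "\<bar>x\<bar> < 1/2" for x
      using ReH_cnj[of "of_real x"] that by simp
    then have "\<forall>\<^sub>F x in nhds (0::real). Re (H (0 + of_real x * 1)) = 0"
      using eventually_nhds_in_open[of "ball (0::real) (1/2)" 0] by (auto elim!: eventually_mono)
    then have "((\<lambda>x. Re (H (0 + of_real x * 1))) has_real_derivative 0) (at 0)"
      by (subst DERIV_cong_ev[OF refl _ refl]) auto
    moreover have "((\<lambda>x. Re (H (0 + of_real x * 1))) has_real_derivative Re (H1 0 * 1)) (at 0)"
      by (rule has_real_derivative_Re_line) (use dHs(1)[of 0] in simp)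
    ultimately have "Re (H1 0) = 0" using DERIV_unique by fastforce
    then show ?thesis by (simp add: \<phi>'_def)
  qed
  have \<phi>_bounds: "\<phi> \<tau> \<le> 3/8 * \<epsilon> * (1 + 2 * \<epsilon>) * \<tau>\<^sup>2" "5/16 * \<epsilon> * (1 - \<epsilon>) * \<tau>\<^sup>2 \<le> \<phi> \<tau>"
    if \<tau>: "0 < \<tau>" "\<tau> < 1/4" for \<tau>
  proof -
    define z where "z = of_real \<tau> * (1 + \<i>)"
    have z: "Re z = \<tau>" "Im z = \<tau>" by (auto simp: z_def)
    have mz: "- cnj z = of_real \<tau> * (- 1 + \<i>)" by (simp add: z_def complex_eq_iff)
    have zb: "z \<in> ball 0 (1/2)" using diag(1)[of \<tau>] \<tau> by (simp add: z_def)
    then have mzb: "- cnj z \<in> ball 0 (1/2)" by simp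
    have "\<phi> \<tau> = Re (H z) - Re (H (- cnj z))" unfolding mz by (simp add: \<phi>_def z_def)
    also have "\<dots> = (U z - U0 z) - (U (- cnj z) - U0 (- cnj z))"
      using ReH_up[OF zb] ReH_up[OF mzb] \<tau> z by simp
    also have "\<dots> = U z - U (- cnj z)" by (simp add: U0_def)
    finally have \<phi>z: "\<phi> \<tau> = U z - U (- cnj z)" .
    have "r * \<tau> \<le> 174/100 * (1/4)" using r_bounds \<tau> by (intro mult_mono) auto
    then have h: "0 \<le> Re z" "0 \<le> Im z" "r * Re z + Im z \<le> 1" using \<tau> by (auto simp: z)
    show "\<phi> \<tau> \<le> 3/8 * \<epsilon> * (1 + 2 * \<epsilon>) * \<tau>\<^sup>2"
    proof -
      have "\<epsilon> / 3 * (1 + 2 * \<epsilon>) * (\<tau> * \<tau> * (9/8 + 9/8 * (\<tau>\<^sup>2 - \<tau>\<^sup>2))) = 3/8 * \<epsilon> * (1 + 2 * \<epsilon>) * \<tau>\<^sup>2"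
        by (simp add: power2_eq_square)
      then show ?thesis using odd_part_upper[OF h] unfolding \<phi>z z by argo
    qed
    show "5/16 * \<epsilon> * (1 - \<epsilon>) * \<tau>\<^sup>2 \<le> \<phi> \<tau>"
    proof -
      have "\<epsilon> / 3 * (1 - \<epsilon>) * (\<tau> * \<tau> * (15/16 + 9/8 * (\<tau>\<^sup>2 - \<tau>\<^sup>2))) = 5/16 * \<epsilon> * (1 - \<epsilon>) * \<tau>\<^sup>2"
        by (simp add: power2_eq_square)
      then show ?thesis using odd_part_lower[OF h] unfolding \<phi>z z by argo
    qed
  qed
  have \<phi>0: "\<phi> 0 = 0" by (simp add: \<phi>_def)
  have "4 * g1 0 \<le> 2 * (3/8 * \<epsilon> * (1 + 2 * \<epsilon>))"
    by (rule second_derivative_le_if_quadratic_bound[of "1/4", OF _ \<phi>1 \<phi>2 \<phi>0 \<phi>'0]) (use \<phi>_bounds in auto)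
  then have up: "g1 0 \<le> 3/16 * \<epsilon> * (1 + 2 * \<epsilon>)" by simp
  have "- (4 * g1 0) \<le> 2 * (- (5/16 * \<epsilon> * (1 - \<epsilon>)))"
    by (rule second_derivative_le_if_quadratic_bound[of "1/4" "\<lambda>\<tau>. - \<phi> \<tau>" "\<lambda>\<tau>. - \<phi>' \<tau>"])
      (use \<phi>1 \<phi>2 \<phi>0 \<phi>'0 \<phi>_bounds in \<open>auto intro!: DERIV_minus\<close>)
  then have lo: "5/32 * \<epsilon> * (1 - \<epsilon>) \<le> g1 0" by simp
  show ?thesis by (rule that[OF d1 d2 d2_bound lo up]) auto
qed

subsection \<open>The fail point\<close>

lemma g_eq_Im: "side (of_real x) 1 \<Longrightarrow> g x = - Im (Dh (of_real x))"
proof -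
  assume "side (of_real x) 1"
  from Dh_side(1)[OF this] have "Im (Dh (of_real x)) = Im (- \<i> * of_real (cmod (Dh (of_real x))) * cnj 1)"
    by (rule arg_cong)
  then show ?thesis by (simp add: g_def)
qed

lemma fail_point_location:
  assumes t: "0 < t" "t \<le> 1 / 10 ^ 7" and bt: "1 / b = 1 / r + t"
  obtains x0 where "7/24 * t < x0" "x0 < 12/24 * t" "of_real x0 \<in> K"
    "\<And>p. p \<in> K \<Longrightarrow> p \<noteq> of_real x0 \<Longrightarrow> cmod (Dh p) < cmod (Dh (of_real x0))"
    "1/32 * t\<^sup>2 < - Im (Dh (of_real (t/2))) - (- Im (Dh 0))"
proof -
  have "b * (1 / b) = b * (1 / r + t)" using bt by simp
  then have "r = b + b * (r * t)" using b_ge r_pos by (simp add: field_simps)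
  then have eps: "\<epsilon> = b * r * t" by (simp add: \<epsilon>_def)
  have "b * r \<le> r * r" using b_less r_pos by simp
  then have br: "b * r \<le> 3" using r_sq by simp
  have e_up: "\<epsilon> \<le> 3 * t" unfolding eps using br t by (intro mult_right_mono) auto
  have "r * \<epsilon> \<le> 2 * \<epsilon>" using eps_bounds r_bounds by (intro mult_right_mono) auto
  moreover have "b * r = 3 - r * \<epsilon>" unfolding r_sq[symmetric] by (simp add: \<epsilon>_def algebra_simps)
  ultimately have "299/100 \<le> b * r" using e_up t by simp
  then have e_lo: "299/100 * t \<le> \<epsilon>" unfolding eps using t by (intro mult_right_mono) auto
  obtain g1 g2 where g: "\<And>x. \<bar>x\<bar> < 1/8 \<Longrightarrow> (g has_real_derivative g1 x) (at x)"
    "\<And>x. \<bar>x\<bar> < 1/8 \<Longrightarrow> (g1 has_real_derivative g2 x) (at x)"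
    "\<And>x. \<bar>x\<bar> < 1/8 \<Longrightarrow> \<bar>g2 x + 3/2\<bar> \<le> 20480 * \<epsilon>"
    "5/32 * \<epsilon> * (1 - \<epsilon>) \<le> g1 0" "g1 0 \<le> 3/16 * \<epsilon> * (1 + 2 * \<epsilon>)"
    using g_local by metis
  have t8: "\<bar>x\<bar> < 1/8" if "0 \<le> x" "x \<le> t/2" for x using that t by simp
  \<comment> \<open>The bound on \<open>t\<close> is what makes \<open>20480 * \<epsilon>\<close>
    smaller than 1/100.\<close>
  have g2: "- 151/100 \<le> g2 x" "g2 x \<le> - 149/100" if "0 \<le> x" "x \<le> t/2" for x
    using g(3)[OF t8[OF that]] e_up t by (auto simp: abs_le_iff)
  have "5/32 * (299/100 * t) * (999/1000) \<le> 5/32 * \<epsilon> * (1 - \<epsilon>)"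
    using e_lo e_up t by (intro mult_mono) auto
  \<comment> \<open>466/1000 and, below, 564/1000 are the leading coefficients 15/32 and 9/16 of
    \<open>g1 0 / t\<close>, rounded outwards to absorb the higher order terms.\<close>
  then have A_lo: "466/1000 * t \<le> g1 0" using g(4) t by simp
  have "3/16 * \<epsilon> * (1 + 2 * \<epsilon>) \<le> 3/16 * (3 * t) * (1 + 1/1000)"
    using e_lo e_up t eps_bounds by (intro mult_mono) auto
  then have A_up: "g1 0 \<le> 564/1000 * t" using g(5) t by simp
  have g1_mvt: "\<exists>z. x < z \<and> z < y \<and> g1 y - g1 x = (y - x) * g2 z" if "0 \<le> x" "x < y" "y \<le> t/2" for x y
    by (rule MVT2[OF \<open>x < y\<close>]) (use that t8 in \<open>auto intro!: g(2)\<close>)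
  have g_mvt: "\<exists>z. x < z \<and> z < y \<and> g y - g x = (y - x) * g1 z" if "0 \<le> x" "x < y" "y \<le> t/2" for x y
    by (rule MVT2[OF \<open>x < y\<close>]) (use that t8 in \<open>auto intro!: g(1)\<close>)
  have g1_bounds: "g1 0 - 151/100 * x \<le> g1 x" "g1 x \<le> g1 0 - 149/100 * x" if x: "0 < x" "x \<le> t/2" for x
  proof -
    obtain z where z: "0 < z" "z < x" "g1 x - g1 0 = (x - 0) * g2 z" using g1_mvt[of 0 x] x by auto
    have "x * (- 151/100) \<le> x * g2 z" "x * g2 z \<le> x * (- 149/100)"
      using mult_left_mono[of "- 151/100" "g2 z" x] mult_left_mono[of "g2 z" "- 149/100" x] g2[of z] z x by auto
    then show "g1 0 - 151/100 * x \<le> g1 x" "g1 x \<le> g1 0 - 149/100 * x" using z(3) by auto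
  qed
  have g1_decr: "g1 y < g1 x" if xy: "0 \<le> x" "x < y" "y \<le> t/2" for x y
  proof -
    obtain z where z: "x < z" "z < y" "g1 y - g1 x = (y - x) * g2 z" using g1_mvt[OF xy] by auto
    have "(y - x) * g2 z < 0" using g2[of z] z xy by (intro mult_pos_neg) auto
    then show ?thesis using z(3) by simp
  qed
  have p1: "0 < g1 (7/24 * t)" using g1_bounds(1)[of "7/24 * t"] A_lo t by simp
  have p2: "g1 (t/2) < 0" using g1_bounds(2)[of "t/2"] A_up t by simp
  have "continuous_on {7/24 * t..t/2} g1"
    by (intro continuous_at_imp_continuous_on ballI DERIV_isCont[OF g(2)] t8) (use t in auto)
  then have "\<exists>x. 7/24 * t \<le> x \<and> x \<le> t/2 \<and> g1 x = 0"
    using IVT2'[of g1 "t/2" 0 "7/24 * t"] p1 p2 t by simp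
  then obtain x0 where "7/24 * t \<le> x0" "x0 \<le> t/2" and x00: "g1 x0 = 0" by blast
  then have x0: "7/24 * t < x0" "x0 < t/2" using p1 p2 by (auto simp: less_le)
  have incr: "g x < g x0" if x: "0 \<le> x" "x < x0" for x
  proof -
    obtain z where z: "x < z" "z < x0" "g x0 - g x = (x0 - x) * g1 z" using g_mvt[of x x0] x x0 by auto
    have "0 < (x0 - x) * g1 z" using g1_decr[of z x0] z x x0 x00 by (intro mult_pos_pos) auto
    then show ?thesis using z(3) by simp
  qed
  have decr: "g x < g x0" if x: "x0 < x" "x \<le> t/2" for x
  proof -
    obtain z where z: "x0 < z" "z < x" "g x - g x0 = (x - x0) * g1 z" using g_mvt[of x0 x] x x0 t by auto
    have "(x - x0) * g1 z < 0" using g1_decr[of x0 z] z x x0 x00 t by (intro mult_pos_neg) auto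
    then show ?thesis using z(3) by simp
  qed
  have near: "- 1 < r * x" "b * x < 1" if "0 \<le> x" "x \<le> t/2" for x
  proof -
    have "0 \<le> r * x" using that r_pos by simp
    then show "- 1 < r * x" by simp
    have "b * x \<le> 2 * (t/2)" using that b_less b_ge r_bounds by (intro mult_mono) auto
    then show "b * x < 1" using t by simp
  qed
  \<comment> \<open>For negative \<open>x\<close> and for \<open>x\<close> beyond
    \<open>t/2\<close>, the moving planes reduce the claim to the endpoints 0 and
    \<open>t/2\<close>, which the local monotonicity then compares with \<open>x0\<close>.\<close>
  have max: "g x < g x0" if x: "- 1 < r * x" "b * x < 1" "x \<noteq> x0" for x
  proof -
    consider "x < 0" | "0 \<le> x" "x < x0" | "x0 < x" "x \<le> t/2" | "t/2 < x" using x(3) by linarith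
    then show ?thesis
    proof cases
      case 1
      then have "g x \<le> g 0" using x by (intro g_mono_left) auto
      then show ?thesis using incr[of 0] x0 t by simp
    next
      case 4
      then have "g x \<le> g (t/2)" using x near[of "t/2"] t bt by (intro g_antimono_right) auto
      then show ?thesis using decr[of "t/2"] x0 by simp
    qed (use incr decr in auto)
  qed
  have pos: "0 < g x0"
  proof -
    have "0 \<le> g 0" by (simp add: g_def)
    then show ?thesis using incr[of 0] x0 t by simp
  qed
  \<comment> \<open>The subtracted quadratic has the lower bound of \<open>g1\<close> as its
    derivative. The mean value theorem for the difference thus integrates that bound over the
    interval from 0 to \<open>t/2\<close>.\<close>
  have "\<exists>z. 0 < z \<and> z < t/2 \<and> (g (t/2) - 466/1000 * t * (t/2) + 151/200 * (t/2)\<^sup>2) - (g 0 - 466/1000 * t * 0 + 151/200 * 0\<^sup>2)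
      = (t/2 - 0) * (g1 z - 466/1000 * t + 151/100 * z)"
  proof (rule MVT2)
    fix x assume x: "0 \<le> x" "x \<le> t/2"
    show "((\<lambda>x. g x - 466/1000 * t * x + 151/200 * x\<^sup>2) has_real_derivative g1 x - 466/1000 * t + 151/100 * x) (at x)"
      using g(1)[OF t8[OF x]] by (auto intro!: derivative_eq_intros)
  qed (use t in simp)
  then obtain z where z: "0 < z" "z < t/2"
    "g (t/2) - 466/1000 * t * (t/2) + 151/200 * (t/2)\<^sup>2 - g 0 = t/2 * (g1 z - 466/1000 * t + 151/100 * z)"
    by auto
  have "0 \<le> t/2 * (g1 z - 466/1000 * t + 151/100 * z)"
    using g1_bounds(1)[of z] z A_lo t by (intro mult_nonneg_nonneg) auto
  then have "466/1000 * t * (t/2) - 151/200 * (t/2)\<^sup>2 \<le> g (t/2) - g 0" using z(3) by linarith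
  moreover have "466/1000 * t * (t/2) - 151/200 * (t/2)\<^sup>2 = (1/32 + 13/1000) * t\<^sup>2"
    by (simp add: power2_eq_square)
  moreover have "1/32 * t\<^sup>2 < (1/32 + 13/1000) * t\<^sup>2" using t by (intro mult_strict_right_mono) auto
  ultimately have diff: "1/32 * t\<^sup>2 < g (t/2) - g 0" by linarith
  have side: "side (of_real x) 1" if "0 \<le> x" "x \<le> t/2" for x
    using near[OF that] by (intro side_real)
  have gI: "g (t/2) = - Im (Dh (of_real (t/2)))" "g 0 = - Im (Dh 0)"
    using g_eq_Im[OF side[of "t/2"]] g_eq_Im[OF side[of 0]] t by auto
  show ?thesis
  proof (rule that[of x0])
    show "of_real x0 \<in> K" using side_in_ctri(1)[OF side[of x0]] x0 t by simp
    show "cmod (Dh p) < cmod (Dh (of_real x0))" if "p \<in> K" "p \<noteq> of_real x0" for p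
      using gradient_maximum[OF near[of x0] pos max that] x0 t by (simp add: g_def)
    show "1/32 * t\<^sup>2 < - Im (Dh (of_real (t/2))) - (- Im (Dh 0))" using diff unfolding gI .
  qed (use x0 in auto)
qed

end

section \<open>Transfer to the domains \<open>Omega t\<close>\<close>

abbreviation slope :: "real \<Rightarrow> real" where
  "slope t \<equiv> 1 / (sqrt 3 / 3 + t)"

lemma triangle_slope:
  assumes "0 < t" "t \<le> 1 / 10 ^ 7"
  shows "triangle (sqrt 3) (slope t)" "1 / slope t = 1 / sqrt 3 + t"
proof -
  have "sqrt 3 \<le> sqrt ((174/100)\<^sup>2)" by (rule real_sqrt_le_mono) (simp add: power2_eq_square)
  then have s: "sqrt 3 \<le> 174/100" by simp
  have "1 < sqrt 3 * (sqrt 3 / 3 + t)" using assms by (simp add: distrib_left)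
  then have "slope t < sqrt 3" using assms by (simp add: divide_less_eq add_pos_pos)
  then show "triangle (sqrt 3) (slope t)"
    using s assms by unfold_locales (auto simp: field_simps add_pos_pos)
  have "sqrt 3 / 3 = 1 / sqrt 3" by (simp add: field_simps)
  then show "1 / slope t = 1 / sqrt 3 + t" by simp
qed

lemma convex_hull_triangle:
  assumes "0 < r" "0 < b"
  shows "convex hull {(- (1 / r), 0), (1 / b, 0), (0, 1)} = {p. Complex (fst p) (snd p) \<in> ctri r b}"
proof (intro set_eqI iffI)
  fix p :: "real \<times> real"
  assume "p \<in> convex hull {(- (1 / r), 0), (1 / b, 0), (0, 1)}"
  then obtain u v w where p: "p = u *\<^sub>R (- (1 / r), 0) + v *\<^sub>R (1 / b, 0) + w *\<^sub>R (0, 1)"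
    and uvw: "0 \<le> u" "0 \<le> v" "0 \<le> w" "u + v + w = 1"
    unfolding convex_hull_3 by blast
  have xy: "fst p = v / b - u / r" "snd p = w" by (simp_all add: p)
  have "r * fst p = v * (r / b) - u" "b * fst p = v - u * (b / r)"
    using assms by (simp_all add: xy right_diff_distrib)
  then have "lA r (Complex (fst p) (snd p)) = v + v * (r / b)" "lB b (Complex (fst p) (snd p)) = u + u * (b / r)"
    using uvw(4) by (simp_all add: xy(2) lA_def lB_def)
  then show "p \<in> {p. Complex (fst p) (snd p) \<in> ctri r b}"
    using uvw assms by (simp add: ctri_def p)
next
  fix p :: "real \<times> real"
  assume "p \<in> {p. Complex (fst p) (snd p) \<in> ctri r b}"
  then have p: "0 \<le> snd p" "0 \<le> lA r (Complex (fst p) (snd p))" "0 \<le> lB b (Complex (fst p) (snd p))"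
    by (auto simp: ctri_def)
  \<comment> \<open>Barycentric coordinates: the function of the opposite side, divided by its value
    at the vertex.\<close>
  define u where "u = lB b (Complex (fst p) (snd p)) * r / (r + b)"
  define v where "v = lA r (Complex (fst p) (snd p)) * b / (r + b)"
  have rb: "r + b > 0" using assms by simp
  have "u + v = ((r + b) * (1 - snd p)) / (r + b)"
    unfolding u_def v_def add_divide_distrib[symmetric] by (simp add: lA_def lB_def algebra_simps)
  then have uv: "u + v = 1 - snd p" using rb by simp
  have "v / b = lA r (Complex (fst p) (snd p)) / (r + b)" "u / r = lB b (Complex (fst p) (snd p)) / (r + b)"
    using assms by (simp_all add: u_def v_def)
  then have "v / b - u / r = ((r + b) * fst p) / (r + b)"
    by (simp add: lA_def lB_def algebra_simps flip: diff_divide_distrib)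
  then have "v / b - u / r = fst p" using rb by simp
  then have "p = u *\<^sub>R (- (1 / r), 0) + v *\<^sub>R (1 / b, 0) + snd p *\<^sub>R (0, 1)"
    by (simp add: prod_eq_iff)
  moreover have "0 \<le> u" "0 \<le> v" using p assms by (auto simp: u_def v_def)
  ultimately show "p \<in> convex hull {(- (1 / r), 0), (1 / b, 0), (0, 1)}"
    unfolding convex_hull_3 using uv p(1)
    by - (rule CollectI, rule exI[of _ u], rule exI[of _ v], rule exI[of _ "snd p"], auto)
qed

lemma Omega_eq:
  assumes "0 < t"
  shows "Omega t = {p. Complex (fst p) (snd p) \<in> tri (sqrt 3) (slope t)}"
    "closure (Omega t) = {p. Complex (fst p) (snd p) \<in> ctri (sqrt 3) (slope t)}"
proof -
  let ?H = "{p. Complex (fst p) (snd p) \<in> ctri (sqrt 3) (slope t)}"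
  let ?I = "{p. Complex (fst p) (snd p) \<in> tri (sqrt 3) (slope t)}"
  have b: "0 < slope t" using assms by (simp add: add_pos_pos)
  have r0: "0 < sqrt 3" by simp
  have e: "1 / sqrt 3 = sqrt 3 / 3" "1 / slope t = sqrt 3 / 3 + t" by (simp_all add: field_simps)
  have H: "convex hull {(- (sqrt 3 / 3), 0), (sqrt 3 / 3 + t, 0), (0, 1)} = ?H"
    using convex_hull_triangle[OF r0 b] unfolding e .
  have "interior ?H = ?I"
  proof
    have "?I = (\<lambda>p. Complex (fst p) (snd p)) -` tri (sqrt 3) (slope t)" by auto
    moreover have "open \<dots>"
      unfolding complex_eq by (intro open_vimage open_tri continuous_intros)
    ultimately show "?I \<subseteq> interior ?H"
      using tri_subset_ctri by (intro interior_maximal) auto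
    show "interior ?H \<subseteq> ?I"
    proof
      fix p assume "p \<in> interior ?H"
      then obtain e where e: "0 < e" "ball p e \<subseteq> ?H" using mem_interior by blast
      \<comment> \<open>Shifting down makes the inequality for \<open>Im\<close> strict; shifting up
        does so for \<open>lA\<close> and \<open>lB\<close>, which both decrease in
        \<open>Im\<close>.\<close>
      have "p - (0, e/2) \<in> ball p e" "p + (0, e/2) \<in> ball p e" using e(1) by (auto simp: dist_norm norm_Pair)
      then have "p - (0, e/2) \<in> ?H" "p + (0, e/2) \<in> ?H" using e(2) by blast+
      then show "p \<in> ?I" using e(1) by (auto simp: ctri_def tri_def lA_def lB_def)
    qed
  qed
  then show O: "Omega t = ?I" unfolding Omega_def H .
  have "interior ?H \<noteq> {}"
  proof -
    have "(0, 1/2) \<in> ?I" by (simp add: tri_def lA_def lB_def)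
    then show ?thesis using \<open>interior ?H = ?I\<close> by blast
  qed
  moreover have "convex ?H" unfolding H[symmetric] by (rule convex_convex_hull)
  moreover have "closed ?H" unfolding H[symmetric]
    by (intro compact_imp_closed compact_convex_hull finite_imp_compact) auto
  ultimately show "closure (Omega t) = ?H"
    unfolding Omega_def H by (simp add: convex_closure_interior)
qed

lemma torsion_triangle_Omega:
  assumes t: "0 < t" "t \<le> 1 / 10 ^ 7" and u: "torsion_function (Omega t) u"
  shows "\<exists>F. torsion_triangle (sqrt 3) (slope t) (\<lambda>z. u (Re z, Im z)) F \<and>
    (\<forall>z\<in>tri (sqrt 3) (slope t). pdx u (Re z, Im z) = Re (torsion_triangle.D F z)
      \<and> pdy u (Re z, Im z) = - Im (torsion_triangle.D F z))"
proof -
  note O = Omega_eq[OF t(1)]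
  have op: "open (Omega t)" by (simp add: Omega_def)
  have cv: "convex (Omega t)" by (simp add: Omega_def convex_interior)
  have Oc: "{z. (Re z, Im z) \<in> Omega t} = tri (sqrt 3) (slope t)" unfolding O by simp
  obtain F where F: "F holomorphic_on {z. (Re z, Im z) \<in> Omega t}"
    "\<And>z. (Re z, Im z) \<in> Omega t \<Longrightarrow> u (Re z, Im z) = Re (F z) - (cmod z)\<^sup>2 / 4"
    "\<And>z. (Re z, Im z) \<in> Omega t \<Longrightarrow> pdx u (Re z, Im z) = Re (deriv F z) - Re z / 2"
    "\<And>z. (Re z, Im z) \<in> Omega t \<Longrightarrow> pdy u (Re z, Im z) = - Im (deriv F z) - Im z / 2"
    using torsion_function_holomorphic[OF u op cv] by blast
  interpret triangle "sqrt 3" "slope t" by (rule triangle_slope(1)[OF t])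
  have inst: "torsion_triangle (sqrt 3) (slope t) (\<lambda>z. u (Re z, Im z)) F"
  proof unfold_locales
    show "continuous_on (ctri (sqrt 3) (slope t)) (\<lambda>z. u (Re z, Im z))"
      by (rule continuous_on_compose2[of "closure (Omega t)" u])
        (use u in \<open>auto simp: torsion_function_def O(2) intro!: continuous_intros\<close>)
    show "F holomorphic_on tri (sqrt 3) (slope t)" using F(1) unfolding Oc .
    show "u (Re z, Im z) = Re (F z) - (cmod z)\<^sup>2 / 4" if "z \<in> tri (sqrt 3) (slope t)" for z
      using F(2) that by (simp add: O)
    show "u (Re z, Im z) = 0" if "z \<in> ctri (sqrt 3) (slope t)" "z \<notin> tri (sqrt 3) (slope t)" for z
    proof -
      have "(Re z, Im z) \<in> closure (Omega t)" "(Re z, Im z) \<notin> Omega t"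
        unfolding O(2) unfolding O(1) using that by simp_all
      then have "(Re z, Im z) \<in> frontier (Omega t)"
        unfolding frontier_def interior_open[OF op] by simp
      then show ?thesis using u by (simp add: torsion_function_def)
    qed
  qed
  interpret torsion_triangle "sqrt 3" "slope t" "\<lambda>z. u (Re z, Im z)" F by (rule inst)
  show ?thesis
    by (intro exI[of _ F] conjI ballI inst) (use F(3,4) in \<open>auto simp: O D_def\<close>)
qed

text \<open>The difference is harmonic with zero boundary values. The roles of \<open>u\<close> and
  \<open>v\<close> are symmetric, so one inequality is enough.\<close>

lemma torsion_function_unique:
  assumes t: "0 < t" "t \<le> 1 / 10 ^ 7" and u: "torsion_function (Omega t) u" "torsion_function (Omega t) v"
    and p: "p \<in> Omega t"
  shows "u p \<le> v p"
proof -
  obtain F G where "torsion_triangle (sqrt 3) (slope t) (\<lambda>z. u (Re z, Im z)) F"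
    "torsion_triangle (sqrt 3) (slope t) (\<lambda>z. v (Re z, Im z)) G"
    using torsion_triangle_Omega[OF t u(1)] torsion_triangle_Omega[OF t u(2)] by blast
  then interpret u: torsion_triangle "sqrt 3" "slope t" "\<lambda>z. u (Re z, Im z)" F +
    v: torsion_triangle "sqrt 3" "slope t" "\<lambda>z. v (Re z, Im z)" G .
  have "u (Re z, Im z) - v (Re z, Im z) \<le> 0" if "z \<in> u.K" for z
    by (rule maximum_principle_Re[where v = "\<lambda>z. u (Re z, Im z) - v (Re z, Im z)" and G = "\<lambda>z. F z - G z",
          OF open_tri tri_subset_ctri u.compact_ctri])
      (use that u.U_cont v.U_cont u.F_hol v.F_hol u.U_eq v.U_eq u.U_bd v.U_bd
        in \<open>auto intro!: continuous_intros holomorphic_intros\<close>)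
  from this[of "Complex (fst p) (snd p)"] show ?thesis
    using p tri_subset_ctri by (auto simp: Omega_eq[OF t(1)])
qed

text \<open>\<open>fail_point\<close> lets every point bring its own torsion function, with
  arbitrary values off the closure. The derivatives and their limits see only values in the open
  domain, so all torsion functions share one extended gradient.\<close>

lemma grad_closure_unique:
  assumes t: "0 < t" "t \<le> 1 / 10 ^ 7" and u: "torsion_function (Omega t) u" "torsion_function (Omega t) v"
  shows "grad_closure (Omega t) u = grad_closure (Omega t) v"
proof -
  have op: "open (Omega t)" by (simp add: Omega_def)
  have eq: "u p = v p" if "p \<in> Omega t" for p
    using torsion_function_unique[OF t u that] torsion_function_unique[OF t u(2,1) that] by simp
  have pd: "pdx u p = pdx v p \<and> pdy u p = pdy v p" if p: "p \<in> Omega t" for p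
  proof -
    obtain x y where xy: "p = (x, y)" by (cases p)
    have "open ((\<lambda>x. (x, y)) -` Omega t)" "open ((\<lambda>y. (x, y)) -` Omega t)"
      by (auto intro!: open_vimage op continuous_intros)
    then have "\<forall>\<^sub>F x' in nhds x. x' \<in> (\<lambda>x. (x, y)) -` Omega t" "\<forall>\<^sub>F y' in nhds y. y' \<in> (\<lambda>y. (x, y)) -` Omega t"
      using p xy eventually_nhds_in_open[of "(\<lambda>x. (x, y)) -` Omega t" x]
        eventually_nhds_in_open[of "(\<lambda>y. (x, y)) -` Omega t" y] by auto
    then have "\<forall>\<^sub>F x' in nhds x. u (x', y) = v (x', y)" "\<forall>\<^sub>F y' in nhds y. u (x, y') = v (x, y')"
      using eq by (auto elim!: eventually_mono)
    then show ?thesis unfolding pdx_def pdy_def xy by (auto intro!: deriv_cong_ev)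
  qed
  have "Lim (at p within Omega t) (pdx u) = Lim (at p within Omega t) (pdx v)"
    "Lim (at p within Omega t) (pdy u) = Lim (at p within Omega t) (pdy v)" for p
  proof -
    have "\<forall>\<^sub>F q in at p within Omega t. q \<in> Omega t" by (simp add: eventually_at_filter)
    then have "\<forall>\<^sub>F q in at p within Omega t. pdx u q = pdx v q \<and> pdy u q = pdy v q"
      by (rule eventually_mono) (rule pd)
    then show "Lim (at p within Omega t) (pdx u) = Lim (at p within Omega t) (pdx v)"
      "Lim (at p within Omega t) (pdy u) = Lim (at p within Omega t) (pdy v)"
      by (auto intro!: Lim_cong elim: eventually_mono)
  qed
  then show ?thesis by (simp add: fun_eq_iff grad_closure_def pdx_closure_def pdy_closure_def)
qed

lemma torsion_function_Omega_location:
  assumes t: "0 < t" "t \<le> 1 / 10 ^ 7" and u: "torsion_function (Omega t) u"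
  shows "\<exists>x0. 7/24 * t < x0 \<and> x0 < 12/24 * t \<and> (x0, 0) \<in> closure (Omega t)
    \<and> (\<forall>p\<in>closure (Omega t). p \<noteq> (x0, 0) \<longrightarrow> norm (grad_closure (Omega t) u p) < norm (grad_closure (Omega t) u (x0, 0)))
    \<and> 1/32 * t\<^sup>2 < pdy_closure (Omega t) u (t/2, 0) - pdy_closure (Omega t) u (0, 0)"
proof -
  note O = Omega_eq[OF t(1)]
  obtain F where "torsion_triangle (sqrt 3) (slope t) (\<lambda>z. u (Re z, Im z)) F" and
    pd: "\<And>z. z \<in> tri (sqrt 3) (slope t) \<Longrightarrow> pdx u (Re z, Im z) = Re (torsion_triangle.D F z)"
    "\<And>z. z \<in> tri (sqrt 3) (slope t) \<Longrightarrow> pdy u (Re z, Im z) = - Im (torsion_triangle.D F z)"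
    using torsion_triangle_Omega[OF t u] by blast
  then interpret torsion_triangle "sqrt 3" "slope t" "\<lambda>z. u (Re z, Im z)" F by simp
  have lims: "pdx_closure (Omega t) u p = Re (Dh (Complex (fst p) (snd p)))"
    "pdy_closure (Omega t) u p = - Im (Dh (Complex (fst p) (snd p)))" if p: "p \<in> closure (Omega t)" for p
  proof -
    let ?c = "\<lambda>p. Complex (fst p) (snd p)"
    have op: "open (Omega t)" by (simp add: Omega_def)
    have nt: "at p within Omega t \<noteq> bot"
      using at_within_nontrivial_open[OF op p] .
    have "(?c \<longlongrightarrow> ?c p) (at p within Omega t)"
      unfolding complex_eq by (intro tendsto_intros)
    moreover have "\<forall>\<^sub>F q in at p within Omega t. ?c q \<in> T \<and> ?c q \<noteq> ?c p"
      by (auto simp: eventually_at_filter O prod_eq_iff)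
    ultimately have "filterlim ?c (at (?c p) within T) (at p within Omega t)"
      by (simp add: filterlim_at)
    then have lim: "((\<lambda>q. D (?c q)) \<longlongrightarrow> Dh (?c p)) (at p within Omega t)"
      using filterlim_compose[OF D_tendsto_Dh] p O(2) by blast
    have ev: "\<forall>\<^sub>F q in at p within Omega t. q \<in> Omega t" by (simp add: eventually_at_filter)
    have "(pdx u \<longlongrightarrow> Re (Dh (?c p))) (at p within Omega t)"
    proof (rule Lim_transform_eventually[OF tendsto_Re[OF lim]])
      show "\<forall>\<^sub>F q in at p within Omega t. Re (D (?c q)) = pdx u q"
        using ev by eventually_elim (use pd(1) in \<open>force simp: O\<close>)
    qed
    then show "pdx_closure (Omega t) u p = Re (Dh (?c p))"
      unfolding pdx_closure_def by (intro tendsto_Lim nt)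
    have "(pdy u \<longlongrightarrow> - Im (Dh (?c p))) (at p within Omega t)"
    proof (rule Lim_transform_eventually[OF tendsto_minus[OF tendsto_Im[OF lim]]])
      show "\<forall>\<^sub>F q in at p within Omega t. - Im (D (?c q)) = pdy u q"
        using ev by eventually_elim (use pd(2) in \<open>force simp: O\<close>)
    qed
    then show "pdy_closure (Omega t) u p = - Im (Dh (?c p))"
      unfolding pdy_closure_def by (intro tendsto_Lim nt)
  qed
  have norm: "norm (grad_closure (Omega t) u p) = cmod (Dh (Complex (fst p) (snd p)))" if "p \<in> closure (Omega t)" for p
    unfolding grad_closure_def lims[OF that] by (simp add: norm_Pair cmod_def)
  obtain x0 where x0: "7/24 * t < x0" "x0 < 12/24 * t" "of_real x0 \<in> K"
    "\<And>p. p \<in> K \<Longrightarrow> p \<noteq> of_real x0 \<Longrightarrow> cmod (Dh p) < cmod (Dh (of_real x0))"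
    "1/32 * t\<^sup>2 < - Im (Dh (of_real (t/2))) - (- Im (Dh 0))"
    using fail_point_location[OF t triangle_slope(2)[OF t]] by metis
  have c0: "Complex x 0 = of_real x" for x by (simp add: complex_eq_iff)
  have x0c: "(x0, 0) \<in> closure (Omega t)" using x0(3) by (simp add: O(2) c0)
  have axis: "(x, 0) \<in> closure (Omega t)" if "0 \<le> x" "x \<le> t/2" for x
  proof -
    have "slope t * x \<le> 2 * (t/2)"
      using that b_less b_ge r_bounds by (intro mult_mono) auto
    then show ?thesis using that t by (simp add: O(2) ctri_def lA_def lB_def)
  qed
  show ?thesis
  proof (intro exI[of _ x0] conjI ballI impI)
    fix p assume p: "p \<in> closure (Omega t)" "p \<noteq> (x0, 0)"
    then have "Complex (fst p) (snd p) \<in> K" "Complex (fst p) (snd p) \<noteq> of_real x0"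
      by (auto simp: O(2) complex_eq_iff prod_eq_iff)
    from x0(4)[OF this] show "norm (grad_closure (Omega t) u p) < norm (grad_closure (Omega t) u (x0, 0))"
      unfolding norm[OF p(1)] norm[OF x0c] by (simp add: c0)
  next
    show "1/32 * t\<^sup>2 < pdy_closure (Omega t) u (t/2, 0) - pdy_closure (Omega t) u (0, 0)"
      using x0(5) axis[of "t/2"] axis[of 0] t by (simp add: lims c0)
  qed (use x0 x0c in auto)
qed

theorem theorem1p7:
  fixes u :: "real \<Rightarrow> real \<times> real \<Rightarrow> real"
  assumes "\<And>t. t \<ge> 0 \<Longrightarrow> torsion_function (Omega t) (u t)"
  shows "(\<exists>x :: real \<Rightarrow> real. \<forall>\<^sub>F t in at_right 0.
            {p. fail_point (Omega t) p} = {(x t, 0)} \<and>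
            7 / 24 * t < x t \<and> x t < 12 / 24 * t) \<and>
         (\<forall>\<^sub>F t in at_right 0.
            pdy_closure (Omega t) (u t) (t / 2, 0) - pdy_closure (Omega t) (u t) (0, 0)
              > 1 / 32 * t\<^sup>2)"
proof -
  have small: "\<forall>\<^sub>F t in at_right 0. t \<in> {0<..<1 / 10 ^ 7 :: real}"
    by (rule eventually_at_right_real) simp
  have "\<forall>t\<in>{0<..<1 / 10 ^ 7}. \<exists>x0. 7/24 * t < x0 \<and> x0 < 12/24 * t \<and> (x0, 0) \<in> closure (Omega t)
    \<and> (\<forall>p\<in>closure (Omega t). p \<noteq> (x0, 0) \<longrightarrow> norm (grad_closure (Omega t) (u t) p) < norm (grad_closure (Omega t) (u t) (x0, 0)))
    \<and> 1/32 * t\<^sup>2 < pdy_closure (Omega t) (u t) (t/2, 0) - pdy_closure (Omega t) (u t) (0, 0)"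
    using torsion_function_Omega_location assms by simp
  then obtain x where x: "\<And>t. t \<in> {0<..<1 / 10 ^ 7} \<Longrightarrow> 7/24 * t < x t \<and> x t < 12/24 * t \<and> (x t, 0) \<in> closure (Omega t)
    \<and> (\<forall>p\<in>closure (Omega t). p \<noteq> (x t, 0) \<longrightarrow> norm (grad_closure (Omega t) (u t) p) < norm (grad_closure (Omega t) (u t) (x t, 0)))
    \<and> 1/32 * t\<^sup>2 < pdy_closure (Omega t) (u t) (t/2, 0) - pdy_closure (Omega t) (u t) (0, 0)"
    by metis
  have fail: "{p. fail_point (Omega t) p} = {(x t, 0)}" if t: "t \<in> {0<..<1 / 10 ^ 7}" for t
  proof -
    have ut: "torsion_function (Omega t) (u t)" using assms t by simp
    have "p = (x t, 0)" if fp: "fail_point (Omega t) p" for p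
    proof (rule ccontr)
      assume ne: "p \<noteq> (x t, 0)"
      obtain v where v: "torsion_function (Omega t) v" "p \<in> closure (Omega t)"
        "\<And>q. q \<in> closure (Omega t) \<Longrightarrow> norm (grad_closure (Omega t) v q) \<le> norm (grad_closure (Omega t) v p)"
        using fp unfolding fail_point_def by blast
      have "grad_closure (Omega t) v = grad_closure (Omega t) (u t)"
        by (rule grad_closure_unique[OF _ _ v(1) ut]) (use t in auto)
      then show False using v x[OF t] ne by (metis not_less)
    qed
    moreover have "fail_point (Omega t) (x t, 0)"
      unfolding fail_point_def using ut x[OF t] by (metis less_imp_le order_refl)
    ultimately show ?thesis by blast
  qed
  show ?thesis
  proof (intro conjI exI[of _ x])
    show "\<forall>\<^sub>F t in at_right 0. {p. fail_point (Omega t) p} = {(x t, 0)} \<and>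
            7 / 24 * t < x t \<and> x t < 12 / 24 * t"
      using small by eventually_elim (use fail x in blast)
    show "\<forall>\<^sub>F t in at_right 0.
            pdy_closure (Omega t) (u t) (t / 2, 0) - pdy_closure (Omega t) (u t) (0, 0)
              > 1 / 32 * t\<^sup>2"
      using small by eventually_elim (use x in blast)
  qed
qed

end
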